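(* Fix $\chi\in\mathcal{E}$ and $\ell\in[0,1]$. Assume: (1) $r$ and $\sigma_\varepsilon^2$ are continuous on a neighborhood of $\chi$, $F(0)=0$, and $\varphi(t):=E[r(\mathcal{X})-r(\chi)\mid \|\mathcal{X}-\chi\|=t]$ is differentiable at $t=0$; (2) $K$ is a nonnegative bounded kernel with support $[0,1]$ and $\inf_{t\in[0,1]}K(t)>0$; (3) for every $s\in[0,1]$, $\tau_h(s):=F(hs)/F(h)\to\tau_0(s)<\infty$ as $h\to0$; (4) as $n\to\infty$, $h_n\to0$, $nF(h_n)\to\infty$, $A_{n,\ell}:=\frac1n\sum_{i=1}^n\frac{h_i}{h_n}\left[\frac{F(h_i)}{F(h_n)}\right]^{1-\ell}\to\alpha_{[\ell]}<\infty$, and for every real $q\le 2$, $B_{n,q}:=\frac1n\sum_{i=1}^n\left[\frac{F(h_i)}{F(h_n)}\right]^q\to\beta_{[q]}<\infty$; (5) there exist $\lambda>0$ and $\mu>0$ such that $E[\exp(\lambda|Y|^\mu)]<\infty$; (6) $\lim_{n\to\infty}\frac{nF(h_n)(\ln n)^{-1-\frac2\mu}}{(\ln\ln n)^{2(\alpha+1)}}=\infty$ for some $\alpha\ge0$, and $\lim_{n\to\infty}(\ln n)^{\frac2\mu}F(h_n)=0$. If $\lim_{n\to\infty}nh_n^2=0$, then $$\limsup_{n\to\infty}\left[\frac{nF(h_n)}{\ln\ln n}\right]^{1/2}\left[r_n^{[\ell]}(\chi)-r(\chi)\right]=\frac{\left[2\beta_{[1-2\ell]}\sigma_\varepsilon^2(\chi)M_2\right]^{1/2}}{\beta_{[1-\ell]}M_1}\quad\text{almost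 surely.}$$
   Context: $\mathcal{E}$ is a Banach space endowed with a semi-norm $\|\cdot\|$ (neighborhoods and balls are taken with respect to $\|\cdot\|$). $(\mathcal{X},Y)$ is a random pair with values in $\mathcal{E}\times\mathbb{R}$ and $(\mathcal{X}_i,Y_i)_{i\ge1}$ are i.i.d. copies of it. The model is $Y_i=r(\mathcal{X}_i)+\varepsilon_i$ with $r(\chi)=E(Y\mid\mathcal{X}=\chi)$, $E(\varepsilon_i\mid\mathcal{X}_i)=0$ and $E(\varepsilon_i^2\mid\mathcal{X}_i)=\sigma_\varepsilon^2(\mathcal{X}_i)<\infty$. $F(t)=P(\|\chi-\mathcal{X}\|\le t)$, and $(h_n)$ is a sequence of positive bandwidths. The estimator is $$r_n^{[\ell]}(\chi)=\frac{\sum_{i=1}^n\frac{Y_i}{F(h_i)^\ell}K\left(\frac{\|\chi-\mathcal{X}_i\|}{h_i}\right)}{\sum_{i=1}^n\frac{1}{F(h_i)^\ell}K\left(\frac{\|\chi-\mathcal{X}_i\|}{h_i}\right)}$$ (with $0/0=0$). $K$ is differentiable on $[0,1]$ with integrable derivative, and $M_1=K(1)-\int_0^1K'(s)\tau_0(s)\,ds$, $M_2=K^2(1)-\int_0^1(K^2(s))'\tau_0(s)\,ds$. *)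

theory Defs
  imports "HOL-Probability.Probability"
begin

definition is_seminorm :: "('e::real_vector \<Rightarrow> real) \<Rightarrow> bool" where
  "is_seminorm N \<longleftrightarrow>
     (\<forall>x. 0 \<le> N x) \<and> (\<forall>c x. N (c *\<^sub>R x) = \<bar>c\<bar> * N x) \<and> (\<forall>x y. N (x + y) \<le> N x + N y)"

text \<open>
  Topological notions below refer to the semi-norm \<open>N\<close>, not to the norm of the Banach space.
\<close>

definition seminorm_nhd :: "('e::real_vector \<Rightarrow> real) \<Rightarrow> 'e \<Rightarrow> 'e set \<Rightarrow> bool" where
  "seminorm_nhd N x V \<longleftrightarrow> (\<exists>\<delta>>0. {y. N (y - x) < \<delta>} \<subseteq> V)"

definition seminorm_continuous_on ::
    "('e::real_vector \<Rightarrow> real) \<Rightarrow> 'e set \<Rightarrow> ('e \<Rightarrow> real) \<Rightarrow> bool" where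
  "seminorm_continuous_on N V f \<longleftrightarrow>
     (\<forall>x\<in>V. \<forall>e>0. \<exists>d>0. \<forall>y\<in>V. N (y - x) < d \<longrightarrow> \<bar>f y - f x\<bar> < e)"

text \<open>
  \<open>cond_exp_given M S U Z g\<close>: the measurable function \<open>g\<close> is a version of
  \<open>u \<mapsto> E(Z | U = u)\<close>, where \<open>U\<close> takes values in the measurable space \<open>S\<close>.
  The library's conditional expectation is only meaningful for integrable \<open>Z\<close>.
\<close>

definition cond_exp_given ::
    "'a measure \<Rightarrow> 'b measure \<Rightarrow> ('a \<Rightarrow> 'b) \<Rightarrow> ('a \<Rightarrow> real) \<Rightarrow> ('b \<Rightarrow> real) \<Rightarrow> bool" where
  "cond_exp_given M S U Z g \<longleftrightarrow>
     integrable M Z \<and> g \<in> borel_measurable S \<and>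
     (AE \<omega> in M. real_cond_exp M (vimage_algebra (space M) U S) Z \<omega> = g (U \<omega>))"

definition iid_copies ::
    "'a measure \<Rightarrow> 'b measure \<Rightarrow> ('a \<Rightarrow> 'b) \<Rightarrow> (nat \<Rightarrow> 'a \<Rightarrow> 'b) \<Rightarrow> nat set \<Rightarrow> bool" where
  "iid_copies M S Z Zs I \<longleftrightarrow>
     Z \<in> measurable M S \<and> prob_space.indep_vars M (\<lambda>_. S) Zs I \<and>
     (\<forall>i\<in>I. distr M S (Zs i) = distr M S Z)"

definition small_ball_prob ::
    "'a measure \<Rightarrow> ('e::real_vector \<Rightarrow> real) \<Rightarrow> ('a \<Rightarrow> 'e) \<Rightarrow> 'e \<Rightarrow> real \<Rightarrow> real" where
  "small_ball_prob M N X x t = measure M {\<omega> \<in> space M. N (x - X \<omega>) \<le> t}"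

definition A_mean :: "(real \<Rightarrow> real) \<Rightarrow> (nat \<Rightarrow> real) \<Rightarrow> nat \<Rightarrow> real \<Rightarrow> real" where
  "A_mean F h n l =
     (1 / real n) * (\<Sum>i=1..n. (h i / h n) * (F (h i) / F (h n)) powr (1 - l))"

definition B_mean :: "(real \<Rightarrow> real) \<Rightarrow> (nat \<Rightarrow> real) \<Rightarrow> nat \<Rightarrow> real \<Rightarrow> real" where
  "B_mean F h n q = (1 / real n) * (\<Sum>i=1..n. (F (h i) / F (h n)) powr q)"

definition recursive_estimator ::
    "(real \<Rightarrow> real) \<Rightarrow> (real \<Rightarrow> real) \<Rightarrow> ('e::real_vector \<Rightarrow> real) \<Rightarrow> (nat \<Rightarrow> real) \<Rightarrow>
     (nat \<Rightarrow> 'a \<Rightarrow> 'e) \<Rightarrow> (nat \<Rightarrow> 'a \<Rightarrow> real) \<Rightarrow> real \<Rightarrow> nat \<Rightarrow> 'e \<Rightarrow> 'a \<Rightarrow> real" where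
  "recursive_estimator F K N h Xs Ys l n x \<omega> =
     (\<Sum>i=1..n. Ys i \<omega> / F (h i) powr l * K (N (x - Xs i \<omega>) / h i)) /
     (\<Sum>i=1..n. 1 / F (h i) powr l * K (N (x - Xs i \<omega>) / h i))"

text \<open>
  A kernel supported on \<open>[0,1]\<close> jumps at the endpoints, so its derivative is taken within
  \<open>[0,1]\<close> (one-sided at \<open>0\<close> and \<open>1\<close>).
\<close>

abbreviation unit_deriv :: "(real \<Rightarrow> real) \<Rightarrow> real \<Rightarrow> real" where
  "unit_deriv f s \<equiv> vector_derivative f (at s within {0..1})"

definition M1 :: "(real \<Rightarrow> real) \<Rightarrow> (real \<Rightarrow> real) \<Rightarrow> real" where
  "M1 K \<tau>0 = K 1 - (LINT s:{0..1}|lborel. unit_deriv K s * \<tau>0 s)"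

definition M2 :: "(real \<Rightarrow> real) \<Rightarrow> (real \<Rightarrow> real) \<Rightarrow> real" where
  "M2 K \<tau>0 = (K 1)\<^sup>2 - (LINT s:{0..1}|lborel. unit_deriv (\<lambda>u. (K u)\<^sup>2) s * \<tau>0 s)"

end

theory Submission
  imports Defs "HOL-Real_Asymp.Real_Asymp"
begin

text \<open>
  With \<open>R\<^sub>i = Y\<^sub>i - r(x)\<close> and \<open>p\<^sub>i = F(h\<^sub>i)\<close>, the error of the estimator is a ratio \<open>S\<^sub>n / D\<^sub>n\<close>
  of sums of independent variables, where \<open>S\<^sub>n\<close> has summands \<open>p\<^sub>i\<^sup>-\<^sup>l K\<^sub>i R\<^sub>i\<close> and \<open>D\<^sub>n\<close> has
  summands \<open>p\<^sub>i\<^sup>-\<^sup>l K\<^sub>i\<close>.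
  The hypothesis on the means \<open>B\<close> says that \<open>n w\<^sub>n / W\<^sub>n\<close> converges to a positive limit for
  \<open>w\<^sub>i = p\<^sub>i powr q\<close> and \<open>W\<^sub>n = w\<^sub>1 + \<dots> + w\<^sub>n\<close>; this gives power bounds on \<open>W\<^sub>m / W\<^sub>n\<close> and
  \<open>n p\<^sub>n \<ge> c n\<^sup>\<kappa>\<close> for some \<open>\<kappa> > 0\<close>. Hence truncating \<open>R\<^sub>i\<close> at a small power of \<open>i\<close> makes the summands small
  enough for Kolmogorov's law of the iterated logarithm with variance \<open>s\<^sup>2 W\<^sub>n\<close>. It applies to
  \<open>S\<^sub>n\<close> (with \<open>s\<^sup>2 = \<sigma>2(x) M2\<close>) and shows that \<open>D\<^sub>n\<close> is asymptotic to its mean. The mean of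
  \<open>S\<^sub>n\<close> is negligible because \<open>E[K\<^sub>i R\<^sub>i] = O(h\<^sub>i p\<^sub>i)\<close> and \<open>n h\<^sub>n\<^sup>2 \<rightarrow> 0\<close>.
\<close>

section \<open>Exponential tail bounds\<close>

text \<open>The constant of the limit comes from one identity. Let \<open>B\<close> be the mean of
  exponent \<open>1 - 2 * l\<close> and \<open>N = real n * p n powr (1 - l)\<close>. For large
  \<open>n\<close>, \<open>sqrt (n * p n / ln (ln n))\<close> equals
  \<open>sqrt (2 * B) * N / lil_scale W n\<close>. So the normalised error is
  \<open>sqrt (2 * B)\<close> times \<open>S / lil_scale W n\<close>, divided by
  \<open>D / N\<close>; these contribute \<open>sqrt (2 * \<beta> (1 - 2 * l))\<close>, the standard
  deviation \<open>sqrt (\<sigma>2 x * M2)\<close> and \<open>\<beta> (1 - l) * M1\<close>.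
  \<open>M1\<close> and \<open>M2\<close> arise because \<open>K u\<close> is \<open>K 1\<close>
  minus the integral of the derivative over \<open>s \<ge> u\<close>: under expectation the
  indicator of \<open>T \<le> h * s\<close> becomes \<open>F (h * s)\<close>. The obstacle is that
  the means \<open>B\<close> are only known to converge, a priori possibly to 0. Pairing the
  exponents \<open>q\<close> and \<open>- q\<close> forces positive limits, and a positive limit
  forces power growth of \<open>n * p n\<close>. The lower half of the law of the iterated logarithm
  needs lower bounds for probabilities, hence two-sided bounds for moment generating
  functions.\<close>

lemma exp_quadratic_bounds:
  fixes y c :: real
  assumes "\<bar>y\<bar> \<le> c" "c \<le> 1"
  shows "exp y \<le> 1 + y + (1 + c) * y\<^sup>2 / 2" and "1 + y + (1 - c) * y\<^sup>2 / 2 \<le> exp y"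
proof -
  \<comment> \<open>Taylor expansion with a cubic remainder:
    \<open>exp t \<le> exp 1 \<le> 3\<close> turns \<open>exp t / 6 * \<bar>y\<bar> ^ 3\<close> into
    at most \<open>c * y^2 / 2\<close>.\<close>
  obtain t where t: "\<bar>t\<bar> \<le> \<bar>y\<bar>"
    and e: "exp y = (\<Sum>m<3. y ^ m / fact m) + exp t / fact 3 * y ^ 3"
    using Maclaurin_exp_le[of y 3] by blast
  have "exp t \<le> exp 1" using t assms by simp
  also have "\<dots> \<le> 3" by (rule exp_le)
  finally have "exp t / 6 * \<bar>y\<bar> ^ 3 \<le> 1 / 2 * \<bar>y\<bar> ^ 3"
    by (intro mult_right_mono) auto
  also have y3: "\<bar>y\<bar> ^ 3 = \<bar>y\<bar> * y\<^sup>2" by (simp add: power3_eq_cube power2_eq_square)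
  also have "1 / 2 * (\<bar>y\<bar> * y\<^sup>2) \<le> 1 / 2 * (c * y\<^sup>2)" using assms by (intro mult_left_mono mult_right_mono) auto
  finally have *: "\<bar>exp t / 6 * y ^ 3\<bar> \<le> c * y\<^sup>2 / 2"
    by (simp add: abs_mult power_abs y3)
  have "exp y = 1 + y + y\<^sup>2 / 2 + exp t / 6 * y ^ 3"
    using e by (simp add: numeral_3_eq_3 fact_numeral power2_eq_square)
  then show "exp y \<le> 1 + y + (1 + c) * y\<^sup>2 / 2" "1 + y + (1 - c) * y\<^sup>2 / 2 \<le> exp y"
    using * by (auto simp: algebra_simps abs_le_iff add_divide_distrib diff_divide_distrib)
qed

lemma (in prob_space) integrable_bounded:
  fixes f :: "'a \<Rightarrow> real"
  assumes "f \<in> borel_measurable M" "\<And>\<omega>. \<omega> \<in> space M \<Longrightarrow> \<bar>f \<omega>\<bar> \<le> b"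
  shows "integrable M f"
  by (rule integrable_const_bound[where B=b]) (use assms in \<open>auto intro!: AE_I2\<close>)

text \<open>Up to the factors \<open>1 + c\<close> and \<open>1 - 2 * c\<close>, a bounded centred
  variable has the Gaussian moment generating function: in the quadratic bounds on
  \<open>exp\<close> the linear term integrates to 0. The upper bound then uses
  \<open>1 + u \<le> exp u\<close>; the lower one needs \<open>ln (1 + u) \<ge> u - u^2\<close>,
  which costs the second \<open>c\<close>.\<close>

lemma (in prob_space) mgf_bounds_single:
  fixes Z :: "'a \<Rightarrow> real"
  assumes m[measurable]: "Z \<in> borel_measurable M" and b: "\<And>\<omega>. \<omega> \<in> space M \<Longrightarrow> \<bar>Z \<omega>\<bar> \<le> b"
    and c: "\<bar>t\<bar> * b \<le> c" "c \<le> 1" and z: "expectation Z = 0"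
  defines "v \<equiv> expectation (\<lambda>\<omega>. (Z \<omega>)\<^sup>2)"
  shows "expectation (\<lambda>\<omega>. exp (t * Z \<omega>)) \<le> exp ((1 + c) * t\<^sup>2 * v / 2)"
    and "exp ((1 - 2 * c) * t\<^sup>2 * v / 2) \<le> expectation (\<lambda>\<omega>. exp (t * Z \<omega>))"
proof -
  have b0: "0 \<le> b" using b not_empty by fastforce
  then have c0: "0 \<le> c" using c by (meson abs_ge_zero mult_nonneg_nonneg order_trans)
  have tz: "\<bar>t * Z \<omega>\<bar> \<le> c" if "\<omega> \<in> space M" for \<omega>
    using mult_left_mono[OF b[OF that], of "\<bar>t\<bar>"] c by (simp add: abs_mult)
  have i1: "integrable M Z" by (rule integrable_bounded[where b=b]) (use b in auto)
  have i2: "integrable M (\<lambda>\<omega>. (Z \<omega>)\<^sup>2)"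
    by (rule integrable_bounded[where b="b\<^sup>2"]) (use b b0 in \<open>auto simp: abs_le_square_iff[symmetric]\<close>)
  have i3: "integrable M (\<lambda>\<omega>. exp (t * Z \<omega>))"
    by (rule integrable_bounded[where b="exp c"]) (use tz in \<open>auto simp: abs_le_iff\<close>)
  have q: "expectation (\<lambda>\<omega>. 1 + t * Z \<omega> + k * (t * Z \<omega>)\<^sup>2 / 2) = 1 + k * t\<^sup>2 * v / 2" for k
  proof -
    have "expectation (\<lambda>\<omega>. 1 + t * Z \<omega> + k * (t * Z \<omega>)\<^sup>2 / 2)
        = expectation (\<lambda>\<omega>. 1 + t * Z \<omega> + (k * t\<^sup>2 / 2) * (Z \<omega>)\<^sup>2)"
      by (simp add: power_mult_distrib algebra_simps)
    also have "\<dots> = 1 + k * t\<^sup>2 * v / 2"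
      using i1 i2 z by (simp add: v_def prob_space)
    finally show ?thesis .
  qed
  have iq: "integrable M (\<lambda>\<omega>. 1 + t * Z \<omega> + k * (t * Z \<omega>)\<^sup>2 / 2)" for k
    using i1 i2 by (simp add: power_mult_distrib)
  have "expectation (\<lambda>\<omega>. exp (t * Z \<omega>)) \<le> 1 + (1 + c) * t\<^sup>2 * v / 2"
    unfolding q[symmetric] by (rule integral_mono[OF i3 iq]) (use exp_quadratic_bounds(1)[OF tz c(2)] in auto)
  also have "\<dots> \<le> exp ((1 + c) * t\<^sup>2 * v / 2)" by (rule exp_ge_add_one_self)
  finally show "expectation (\<lambda>\<omega>. exp (t * Z \<omega>)) \<le> exp ((1 + c) * t\<^sup>2 * v / 2)" .
  have v0: "0 \<le> t\<^sup>2 * v" unfolding v_def by simp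
  have "t\<^sup>2 * v = expectation (\<lambda>\<omega>. (t * Z \<omega>)\<^sup>2)" by (simp add: v_def power_mult_distrib)
  also have "\<dots> \<le> expectation (\<lambda>\<omega>. c\<^sup>2)"
  proof (rule integral_mono)
    show "integrable M (\<lambda>\<omega>. (t * Z \<omega>)\<^sup>2)" using i2 by (simp add: power_mult_distrib)
    show "(t * Z \<omega>)\<^sup>2 \<le> c\<^sup>2" if "\<omega> \<in> space M" for \<omega>
      using tz[OF that] c0 by (simp add: abs_le_square_iff[symmetric])
  qed simp
  finally have vc: "t\<^sup>2 * v \<le> c\<^sup>2" by (simp add: prob_space)
  \<comment> \<open>\<open>u\<close> lies below both \<open>c\<close> and
    \<open>t^2 * v / 2\<close>, so \<open>u^2\<close> costs at most
    \<open>c * t^2 * v / 2\<close>.\<close>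
  define u where "u = (1 - c) * t\<^sup>2 * v / 2"
  have u0: "0 \<le> u" unfolding u_def using v0 c by (simp add: mult.assoc)
  have u: "u \<le> t\<^sup>2 * v / 2" unfolding u_def using v0 c0 by (simp add: algebra_simps mult_left_le_one_le)
  have "c\<^sup>2 \<le> c" using c c0 by (simp add: power2_eq_square mult_left_le_one_le)
  then have uc: "u \<le> c" using u vc v0 by simp
  then have "u * u \<le> c * (t\<^sup>2 * v / 2)" using u u0 c0 by (intro mult_mono) auto
  then have "(1 - 2 * c) * t\<^sup>2 * v / 2 \<le> u - u\<^sup>2"
    unfolding u_def by (simp add: power2_eq_square algebra_simps diff_divide_distrib)
  also have "\<dots> \<le> ln (1 + u)" using u0 uc c by (intro ln_one_plus_pos_lower_bound) auto
  finally have "exp ((1 - 2 * c) * t\<^sup>2 * v / 2) \<le> exp (ln (1 + u))" by simp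
  also have "\<dots> = 1 + (1 - c) * t\<^sup>2 * v / 2" using u0 by (simp add: u_def)
  also have "\<dots> \<le> expectation (\<lambda>\<omega>. exp (t * Z \<omega>))"
    unfolding q[symmetric] by (rule integral_mono[OF iq i3]) (use exp_quadratic_bounds(2)[OF tz c(2)] in auto)
  finally show "exp ((1 - 2 * c) * t\<^sup>2 * v / 2) \<le> expectation (\<lambda>\<omega>. exp (t * Z \<omega>))" .
qed

lemma (in prob_space) mgf_bounds_sum:
  fixes Z :: "'i \<Rightarrow> 'a \<Rightarrow> real"
  assumes ind: "indep_vars (\<lambda>_. borel) Z I" and fin: "finite I"
    and b: "\<And>i \<omega>. i \<in> I \<Longrightarrow> \<omega> \<in> space M \<Longrightarrow> \<bar>Z i \<omega>\<bar> \<le> b"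
    and c: "\<bar>t\<bar> * b \<le> c" "c \<le> 1" and z: "\<And>i. i \<in> I \<Longrightarrow> expectation (Z i) = 0"
  defines "V \<equiv> \<Sum>i\<in>I. expectation (\<lambda>\<omega>. (Z i \<omega>)\<^sup>2)"
  shows "expectation (\<lambda>\<omega>. exp (t * (\<Sum>i\<in>I. Z i \<omega>))) \<le> exp ((1 + c) * t\<^sup>2 * V / 2)"
    and "exp ((1 - 2 * c) * t\<^sup>2 * V / 2) \<le> expectation (\<lambda>\<omega>. exp (t * (\<Sum>i\<in>I. Z i \<omega>)))"
proof -
  have m[measurable]: "Z i \<in> borel_measurable M" if "i \<in> I" for i
    using ind that unfolding indep_vars_def by auto
  have tz: "\<bar>t * Z i \<omega>\<bar> \<le> c" if "\<omega> \<in> space M" "i \<in> I" for \<omega> i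
    using mult_left_mono[OF b[OF that(2,1)], of "\<bar>t\<bar>"] c by (simp add: abs_mult)
  have "expectation (\<lambda>\<omega>. exp (t * (\<Sum>i\<in>I. Z i \<omega>))) = expectation (\<lambda>\<omega>. \<Prod>i\<in>I. exp (t * Z i \<omega>))"
    by (simp add: sum_distrib_left exp_sum fin)
  also have "\<dots> = (\<Prod>i\<in>I. expectation (\<lambda>\<omega>. exp (t * Z i \<omega>)))"
  proof (rule indep_vars_lebesgue_integral[OF fin])
    show "indep_vars (\<lambda>_. borel) (\<lambda>i \<omega>. exp (t * Z i \<omega>)) I"
      by (rule indep_vars_compose2[OF ind]) auto
    show "integrable M (\<lambda>\<omega>. exp (t * Z i \<omega>))" if "i \<in> I" for i
      using that by (intro integrable_bounded[where b="exp c"]) (use tz in \<open>auto simp: abs_le_iff\<close>)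
  qed
  finally have *: "expectation (\<lambda>\<omega>. exp (t * (\<Sum>i\<in>I. Z i \<omega>))) = (\<Prod>i\<in>I. expectation (\<lambda>\<omega>. exp (t * Z i \<omega>)))" .
  have e: "exp (k * t\<^sup>2 * V / 2) = (\<Prod>i\<in>I. exp (k * t\<^sup>2 * expectation (\<lambda>\<omega>. (Z i \<omega>)\<^sup>2) / 2))" for k
    by (simp add: V_def exp_sum[symmetric] fin sum_distrib_left sum_divide_distrib)
  show "expectation (\<lambda>\<omega>. exp (t * (\<Sum>i\<in>I. Z i \<omega>))) \<le> exp ((1 + c) * t\<^sup>2 * V / 2)"
    unfolding * e by (intro prod_mono conjI mgf_bounds_single(1) integral_nonneg) (use b c z in auto)
  show "exp ((1 - 2 * c) * t\<^sup>2 * V / 2) \<le> expectation (\<lambda>\<omega>. exp (t * (\<Sum>i\<in>I. Z i \<omega>)))"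
    unfolding * e by (intro prod_mono conjI mgf_bounds_single(2)) (use b c z in auto)
qed

text \<open>Under the exponential tilt by \<open>t\<close> the sum concentrates near \<open>t V\<close>: the part of \<open>E[exp (t S)]\<close>
  coming from outside the window \<open>(1 \<plusminus> d) t V\<close> is bounded by tilting with \<open>(1 \<plusminus> d) t\<close> instead.\<close>

lemma (in prob_space) lower_tail:
  fixes Z :: "'i \<Rightarrow> 'a \<Rightarrow> real"
  assumes ind: "indep_vars (\<lambda>_. borel) Z I" and fin: "finite I"
    and b: "\<And>i \<omega>. i \<in> I \<Longrightarrow> \<omega> \<in> space M \<Longrightarrow> \<bar>Z i \<omega>\<bar> \<le> b"
    and z: "\<And>i. i \<in> I \<Longrightarrow> expectation (Z i) = 0"
    and V: "V = (\<Sum>i\<in>I. expectation (\<lambda>\<omega>. (Z i \<omega>)\<^sup>2))"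
    and d: "0 < d" "d < 1" and t: "0 < t" and b0: "0 \<le> b" and tb: "2 * t * b \<le> d\<^sup>2 / 12" and tV: "8 \<le> d\<^sup>2 * (t\<^sup>2 * V)"
  shows "exp (- (1 + 4 * d) * (t\<^sup>2 * V) / 2) \<le> prob {\<omega> \<in> space M. (1 - d) * t * V < (\<Sum>i\<in>I. Z i \<omega>)}"
proof -
  have m[measurable]: "Z i \<in> borel_measurable M" if "i \<in> I" for i
    using ind that unfolding indep_vars_def by auto
  define S where "S = (\<lambda>\<omega>. \<Sum>i\<in>I. Z i \<omega>)"
  have mS[measurable]: "S \<in> borel_measurable M" unfolding S_def by measurable
  \<comment> \<open>Each outer tilt has exponent at most
    \<open>(1 - 12 * c + 4 * c) * q / 2\<close>, where \<open>12 * c = d^2\<close>, against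
    \<open>(1 - 2 * c) * q / 2\<close> for the full expectation. The gap
    \<open>3 * c * q = d^2 * q / 4\<close> is at least 2, so the two outer parts together take at
    most half of the expectation.\<close>
  define c where "c = d\<^sup>2 / 12"
  have d2: "d\<^sup>2 \<le> 1" using d by (simp add: power_le_one)
  have c: "0 \<le> c" "c \<le> 1" using d2 by (auto simp: c_def)
  define q where "q = t\<^sup>2 * V"
  have q0: "8 \<le> d\<^sup>2 * q" using tV by (simp add: q_def)
  have "0 < d\<^sup>2 * q" using q0 by linarith
  then have qpos: "0 < q" using d by (simp add: zero_less_mult_iff)
  have sb: "\<bar>S \<omega>\<bar> \<le> card I * b" if "\<omega> \<in> space M" for \<omega>
    unfolding S_def using sum_norm_bound[of I "\<lambda>i. Z i \<omega>" b] b that by simp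
  have ie: "integrable M (\<lambda>\<omega>. exp (u * S \<omega>))" for u
  proof (rule integrable_bounded[where b="exp (\<bar>u\<bar> * (card I * b))"])
    fix \<omega> assume "\<omega> \<in> space M"
    then have "\<bar>u * S \<omega>\<bar> \<le> \<bar>u\<bar> * (card I * b)"
      unfolding abs_mult by (intro mult_left_mono sb) auto
    then show "\<bar>exp (u * S \<omega>)\<bar> \<le> exp (\<bar>u\<bar> * (card I * b))" by (simp add: abs_le_iff)
  qed simp
  have up: "expectation (\<lambda>\<omega>. exp (u * S \<omega>)) \<le> exp ((1 + c) * (u\<^sup>2 * V) / 2)" if "0 \<le> u" "u \<le> 2 * t" for u
  proof -
    have "\<bar>u\<bar> * b \<le> c" using tb mult_right_mono[of u "2*t" b] that b0 by (simp add: c_def)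
    then show ?thesis using mgf_bounds_sum(1)[OF ind fin b, of u c] c z unfolding V S_def by (simp add: mult.assoc)
  qed
  have lo: "exp ((1 - 2 * c) * q / 2) \<le> expectation (\<lambda>\<omega>. exp (t * S \<omega>))"
  proof -
    have "0 \<le> t * b" using t b0 by simp
    then have "\<bar>t\<bar> * b \<le> c" using tb t unfolding c_def by linarith
    then show ?thesis using mgf_bounds_sum(2)[OF ind fin b, of t c] c z unfolding V S_def q_def by (simp add: mult.assoc)
  qed
  let ?A = "{\<omega> \<in> space M. (1 - d) * t * V < S \<omega>}"
  \<comment> \<open>Chernoff factors: the first two compare \<open>exp (t * S)\<close> with the
    tilts by \<open>(1 - d) * t\<close> and \<open>(1 + d) * t\<close> at the edges of the window;
    the third is the value of \<open>exp (t * S)\<close> at the upper edge.\<close>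
  define k1 where "k1 = exp (d * (1 - d) * q)"
  define k2 where "k2 = exp (- (d * (1 + d) * q))"
  define k3 where "k3 = exp ((1 + d) * q)"
  have pw: "exp (t * S \<omega>) \<le> k1 * exp ((1 - d) * t * S \<omega>) + k2 * exp ((1 + d) * t * S \<omega>) + k3 * indicator ?A \<omega>"
    (is "_ \<le> ?a + ?b + ?c") if "\<omega> \<in> space M" for \<omega>
  proof -
    consider "S \<omega> \<le> (1 - d) * t * V" | "(1 + d) * t * V \<le> S \<omega>" | "(1 - d) * t * V < S \<omega>" "S \<omega> < (1 + d) * t * V"
      by linarith
    then show ?thesis
    proof cases
      case 1
      have "t * S \<omega> \<le> d * (1 - d) * q + (1 - d) * t * S \<omega>"
        using mult_left_mono[OF 1, of "d * t"] d t by (simp add: q_def power2_eq_square algebra_simps)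
      then have "exp (t * S \<omega>) \<le> ?a" by (simp add: k1_def exp_add[symmetric])
      also have "\<dots> \<le> ?a + ?b + ?c" by (simp add: k2_def k3_def)
      finally show ?thesis .
    next
      case 2
      have "t * S \<omega> \<le> - (d * (1 + d) * q) + (1 + d) * t * S \<omega>"
        using mult_left_mono[OF 2, of "d * t"] d t by (simp add: q_def power2_eq_square algebra_simps)
      then have "exp (t * S \<omega>) \<le> ?b" by (simp add: k2_def exp_add[symmetric])
      also have "\<dots> \<le> ?a + ?b + ?c" by (simp add: k1_def k3_def)
      finally show ?thesis .
    next
      case 3
      have "t * S \<omega> \<le> (1 + d) * q"
        using mult_left_mono[of "S \<omega>" "(1 + d) * t * V" t] 3 t by (simp add: q_def power2_eq_square algebra_simps)
      then have "exp (t * S \<omega>) \<le> ?c" using 3 that by (simp add: k3_def)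
      also have "\<dots> \<le> ?a + ?b + ?c" by (simp add: k1_def k2_def)
      finally show ?thesis .
    qed
  qed
  have iA: "integrable M (\<lambda>\<omega>. k3 * indicator ?A \<omega> :: real)" by (intro integrable_mult_right) (auto simp: emeasure_eq_measure)
  have "expectation (\<lambda>\<omega>. exp (t * S \<omega>)) \<le> expectation (\<lambda>\<omega>. k1 * exp ((1 - d) * t * S \<omega>) + k2 * exp ((1 + d) * t * S \<omega>) + k3 * indicator ?A \<omega>)"
    by (rule integral_mono) (use pw ie iA in auto)
  also have "\<dots> = k1 * expectation (\<lambda>\<omega>. exp ((1 - d) * t * S \<omega>)) + k2 * expectation (\<lambda>\<omega>. exp ((1 + d) * t * S \<omega>)) + k3 * prob ?A"
    using iA ie by simp
  also have "\<dots> \<le> k1 * exp ((1 + c) * (((1 - d) * t)\<^sup>2 * V) / 2) + k2 * exp ((1 + c) * (((1 + d) * t)\<^sup>2 * V) / 2) + k3 * prob ?A"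
    using d t by (intro add_mono mult_left_mono up order_refl) (auto simp: k1_def k2_def)
  also have "k1 * exp ((1 + c) * (((1 - d) * t)\<^sup>2 * V) / 2) \<le> exp ((1 - 8 * c) * q / 2)"
  proof -
    have "(1 - d)\<^sup>2 \<le> 1" using d by (simp add: power_le_one)
    then have "2 * (d * (1 - d)) + (1 + c) * (1 - d)\<^sup>2 \<le> 1 - 8 * c"
    proof -
      have "c * (1 - d)\<^sup>2 \<le> c" using \<open>(1 - d)\<^sup>2 \<le> 1\<close> c by (simp add: mult_left_le)
      moreover have "(1 + c) * (1 - d)\<^sup>2 = 1 - 2 * d + d\<^sup>2 + c * (1 - d)\<^sup>2" "d * (1 - d) = d - d\<^sup>2"
        by (simp_all add: power2_eq_square algebra_simps)
      ultimately show ?thesis using zero_le_power2[of d] unfolding c_def by linarith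
    qed
    from mult_right_mono[OF this, of "q/2"] have "d * (1 - d) * q + (1 + c) * ((1 - d)\<^sup>2 * q) / 2 \<le> (1 - 8 * c) * q / 2"
      using qpos by (simp add: algebra_simps add_divide_distrib)
    then show ?thesis by (simp add: k1_def exp_add[symmetric] q_def power_mult_distrib mult.assoc)
  qed
  also have "k2 * exp ((1 + c) * (((1 + d) * t)\<^sup>2 * V) / 2) \<le> exp ((1 - 8 * c) * q / 2)"
  proof -
    have "(1 + d)\<^sup>2 \<le> 4" using d power_mono[of "1+d" 2 2] by simp
    then have "- 2 * (d * (1 + d)) + (1 + c) * (1 + d)\<^sup>2 \<le> 1 - 8 * c"
    proof -
      have "c * (1 + d)\<^sup>2 \<le> 4 * c" using mult_left_mono[OF \<open>(1 + d)\<^sup>2 \<le> 4\<close>, of c] c by simp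
      moreover have "(1 + c) * (1 + d)\<^sup>2 = 1 + 2 * d + d\<^sup>2 + c * (1 + d)\<^sup>2" "d * (1 + d) = d + d\<^sup>2"
        by (simp_all add: power2_eq_square algebra_simps)
      ultimately show ?thesis using zero_le_power2[of d] unfolding c_def by linarith
    qed
    from mult_right_mono[OF this, of "q/2"] have "- (d * (1 + d) * q) + (1 + c) * ((1 + d)\<^sup>2 * q) / 2 \<le> (1 - 8 * c) * q / 2"
      using qpos by (simp add: algebra_simps add_divide_distrib)
    then show ?thesis by (simp add: k2_def exp_add[symmetric] q_def power_mult_distrib mult.assoc)
  qed
  finally have 1: "exp ((1 - 2 * c) * q / 2) \<le> 2 * exp ((1 - 8 * c) * q / 2) + k3 * prob ?A"
    using lo by linarith
  have "exp ((1 - 8 * c) * q / 2) = exp ((1 - 2 * c) * q / 2) * exp (- (3 * c * q))"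
    by (simp add: exp_add[symmetric] algebra_simps diff_divide_distrib)
  also have "\<dots> \<le> exp ((1 - 2 * c) * q / 2) * (1 / 4)"
  proof (rule mult_left_mono)
    have "2 \<le> 3 * c * q" using q0 by (simp add: c_def)
    then have "exp (- (3 * c * q)) \<le> exp (- 2)" by simp
    also have "\<dots> \<le> (1 / 4 :: real)"
    proof -
      have "1 + 2 + 2\<^sup>2 / 2 \<le> exp (2::real)" by (rule exp_lower_Taylor_quadratic) simp
      then show ?thesis by (simp add: exp_minus field_simps)
    qed
    finally show "exp (- (3 * c * q)) \<le> 1 / 4" .
  qed simp
  finally have 2: "exp ((1 - 2 * c) * q / 2) / 2 \<le> k3 * prob ?A"
    using 1 by linarith
  \<comment> \<open>The loss in the exponent, in units of \<open>q / 2\<close>: \<open>2 * d\<close>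
    from the value at the upper edge, \<open>2 * c \<le> d\<close> from the lower bound for the
    expectation, and \<open>d\<close> to absorb the factor 1/2. Together this is
    \<open>4 * d\<close>.\<close>
  have "exp (- (1 + 4 * d) * q / 2) * k3 \<le> exp ((1 - 2 * c) * q / 2) * exp (- (d * q / 2))"
  proof -
    have "2 * c \<le> d" using d d2 mult_left_le_one_le[of d d] by (simp add: c_def power2_eq_square)
    then have "(- (1 + 4 * d) + 2 * (1 + d)) * q \<le> ((1 - 2 * c) - d) * q"
      using qpos by (intro mult_right_mono) auto
    then show ?thesis unfolding k3_def exp_add[symmetric] by (simp add: algebra_simps add_divide_distrib diff_divide_distrib)
  qed
  also have "\<dots> \<le> exp ((1 - 2 * c) * q / 2) * (1 / 2)"
  proof (rule mult_left_mono)
    have "d\<^sup>2 * q \<le> d * q" using d qpos by (simp add: power2_eq_square mult_left_le_one_le)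
    then have "1 \<le> d * q / 2" using q0 by simp
    then have "2 \<le> exp (d * q / 2)" using exp_ge_add_one_self[of "d * q / 2"] by linarith
    then show "exp (- (d * q / 2)) \<le> 1 / 2" by (simp add: exp_minus field_simps)
  qed simp
  also have "\<dots> \<le> prob ?A * k3" using 2 by (simp add: mult.commute)
  finally have "exp (- (1 + 4 * d) * q / 2) \<le> prob ?A"
    by (simp add: k3_def)
  then show ?thesis by (simp add: q_def S_def)
qed

section \<open>Maximal inequality for sums of bounded independent variables\<close>

text \<open>Write \<open>S_j\<close> for \<open>sum z {1..j}\<close>. The value is
  \<open>exp (t * S_m)\<close>, where \<open>m\<close> is the smaller of \<open>n\<close> and the
  first \<open>j \<ge> 1\<close> with \<open>a \<le> S_j\<close>. It is a function of the path
  \<open>z\<close> and not of the sample point, so that independence of the coordinates passes to it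
  by composition.\<close>

primrec stopped_exp :: "real \<Rightarrow> real \<Rightarrow> nat \<Rightarrow> (nat \<Rightarrow> real) \<Rightarrow> real" where
  "stopped_exp t a 0 z = 1"
| "stopped_exp t a (Suc n) z =
     (if \<exists>j\<in>{1..n}. a \<le> sum z {1..j} then stopped_exp t a n z else exp (t * sum z {1..Suc n}))"

lemma stopped_exp_cong: "(\<And>i. i \<in> {1..n} \<Longrightarrow> z i = z' i) \<Longrightarrow> stopped_exp t a n z = stopped_exp t a n z'"
proof (induction n)
  case (Suc n)
  have "sum z {1..j} = sum z' {1..j}" if "j \<le> Suc n" for j
    using Suc.prems that by (intro sum.cong) auto
  moreover have "stopped_exp t a n z = stopped_exp t a n z'" using Suc by auto
  ultimately show ?case by (simp del: sum.cl_ivl_Suc)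
qed simp

lemma measurable_partial_sum:
  assumes "j \<le> n"
  shows "(\<lambda>z :: nat \<Rightarrow> real. sum z {1..j}) \<in> borel_measurable (PiM {1..n} (\<lambda>_. borel))"
proof -
  have "(\<lambda>z :: nat \<Rightarrow> real. \<Sum>i\<in>{1..j}. 1 * z i) \<in> borel_measurable (PiM {1..n} (\<lambda>_. borel))"
    using assms by (intro borel_measurable_sum borel_measurable_times borel_measurable_const measurable_component_singleton) auto
  then show ?thesis by simp
qed

lemma pred_partial_sum_exceeds:
  assumes "k \<le> n"
  shows "Measurable.pred (PiM {1..n} (\<lambda>_. borel)) (\<lambda>z :: nat \<Rightarrow> real. \<exists>j\<in>{1..k}. a \<le> sum z {1..j})"
proof (rule pred_intros_finite)
  fix j assume "j \<in> {1..k}"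
  then have [measurable]: "(\<lambda>z :: nat \<Rightarrow> real. sum z {1..j}) \<in> borel_measurable (PiM {1..n} (\<lambda>_. borel))"
    using assms by (intro measurable_partial_sum) auto
  show "Measurable.pred (PiM {1..n} (\<lambda>_. borel)) (\<lambda>z :: nat \<Rightarrow> real. a \<le> sum z {1..j})" by measurable
qed simp

lemma measurable_stopped_exp[measurable]: "stopped_exp t a n \<in> borel_measurable (PiM {1..n} (\<lambda>_. borel))"
proof -
  have "stopped_exp t a m \<in> borel_measurable (PiM {1..n} (\<lambda>_. borel))" if "m \<le> n" for m
    using that
  proof (induction m)
    case 0
    have "stopped_exp t a 0 = (\<lambda>z. 1)" by auto
    then show ?case by (simp only: borel_measurable_const)
  next
    case (Suc m)
    have [measurable]: "stopped_exp t a m \<in> borel_measurable (PiM {1..n} (\<lambda>_. borel))" using Suc by simp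
    note pred_partial_sum_exceeds[measurable] measurable_partial_sum[measurable]
    have [measurable]: "m \<le> n" "Suc m \<le> n" using Suc.prems by auto
    show ?case unfolding stopped_exp.simps by measurable
  qed
  then show ?thesis by simp
qed

text \<open>At the stopping index the partial sum is at least \<open>a\<close>, and the value is
  frozen afterwards.\<close>

lemma stopped_exp_ge:
  assumes "0 \<le> t" "\<exists>j\<in>{1..n}. a \<le> sum z {1..j}"
  shows "exp (t * a) \<le> stopped_exp t a n z"
  using assms(2)
proof (induction n)
  case (Suc n)
  show ?case
  proof (cases "\<exists>j\<in>{1..n}. a \<le> sum z {1..j}")
    case False
    then have "a \<le> sum z {1..Suc n}" using Suc.prems by (metis atLeastAtMost_iff le_Suc_eq)
    then have "t * a \<le> t * sum z {1..Suc n}" using assms(1) by (rule mult_left_mono)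
    then show ?thesis using False by auto
  qed (use Suc in auto)
qed simp

lemma stopped_exp_unstopped:
  assumes "\<not> (\<exists>j\<in>{1..n}. a \<le> sum z {1..j})"
  shows "stopped_exp t a n z = exp (t * sum z {1..n})"
  using assms by (cases n) auto

lemma stopped_exp_pos: "0 < stopped_exp t a n z"
  by (induction n) auto

lemma stopped_exp_le:
  assumes "0 \<le> t" "\<And>i. i \<in> {1..n} \<Longrightarrow> z i \<le> b" "0 \<le> b"
  shows "stopped_exp t a n z \<le> exp (t * (n * b))"
  using assms(2)
proof (induction n)
  case (Suc n)
  have "stopped_exp t a n z \<le> exp (t * (n * b))" using Suc by auto
  also have "\<dots> \<le> exp (t * (Suc n * b))" using assms by (simp add: mult_left_mono mult_right_mono)
  finally have 1: "stopped_exp t a n z \<le> exp (t * (Suc n * b))" .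
  have "sum z {1..Suc n} \<le> Suc n * b" using sum_bounded_above[of "{1..Suc n}" z b] Suc.prems by simp
  then have "exp (t * sum z {1..Suc n}) \<le> exp (t * (Suc n * b))" using assms(1) by (simp only: exp_le_cancel_iff mult_left_mono)
  then show ?case using 1 by (simp del: sum.cl_ivl_Suc)
qed simp

text \<open>The exponential of the walk stopped at level \<open>a\<close> is, up to the compensator, a supermartingale.\<close>

lemma (in prob_space) maximal_tail:
  fixes Z :: "nat \<Rightarrow> 'a \<Rightarrow> real"
  assumes ind: "indep_vars (\<lambda>_. borel) Z {1..}"
    and b: "\<And>i \<omega>. i \<in> {1..n} \<Longrightarrow> \<omega> \<in> space M \<Longrightarrow> \<bar>Z i \<omega>\<bar> \<le> b" and b0: "0 \<le> b"
    and z: "\<And>i. i \<in> {1..n} \<Longrightarrow> expectation (Z i) = 0"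
    and t: "0 \<le> t" "t * b \<le> c" "c \<le> 1"
  shows "prob {\<omega> \<in> space M. \<exists>j\<in>{1..n}. a \<le> (\<Sum>i=1..j. Z i \<omega>)}
    \<le> exp (- t * a + (1 + c) * t\<^sup>2 * (\<Sum>i=1..n. expectation (\<lambda>\<omega>. (Z i \<omega>)\<^sup>2)) / 2)"
proof -
  have m[measurable]: "Z i \<in> borel_measurable M" if "i \<in> {1..}" for i
    using ind that unfolding indep_vars_def by auto
  have c0: "0 \<le> c" using t b0 by (meson mult_nonneg_nonneg order_trans)
  define U where "U = (\<lambda>k \<omega>. stopped_exp t a k (\<lambda>i. Z i \<omega>))"
  define H where "H = (\<lambda>k \<omega>. \<exists>j\<in>{1..k}. a \<le> (\<Sum>i=1..j. Z i \<omega>))"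
  \<comment> \<open>\<open>w i\<close> is the logarithm of the bound on the moment generating
    function of \<open>Z i\<close>; it compensates the growth of the expectation in one
    step.\<close>
  define w where "w = (\<lambda>i. (1 + c) * t\<^sup>2 * expectation (\<lambda>\<omega>. (Z i \<omega>)\<^sup>2) / 2)"
  have w0: "0 \<le> w i" for i unfolding w_def using c0 by (intro divide_nonneg_pos mult_nonneg_nonneg) auto
  have Ur: "U k \<omega> = stopped_exp t a k (restrict (\<lambda>i. Z i \<omega>) {1..k})" for k \<omega>
    unfolding U_def by (rule stopped_exp_cong) auto
  have Um[measurable]: "U k \<in> borel_measurable M" for k
  proof -
    have "(\<lambda>\<omega>. restrict (\<lambda>i. Z i \<omega>) {1..k}) \<in> measurable M (PiM {1..k} (\<lambda>_. borel))"
      by (rule measurable_restrict) auto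
    from measurable_compose[OF this measurable_stopped_exp] show ?thesis by (simp add: Ur[abs_def])
  qed
  have Hm[measurable]: "Measurable.pred M (H k)" for k
    unfolding H_def by (rule pred_intros_finite) (auto intro!: borel_measurable_le borel_measurable_sum)
  have Ui: "integrable M (U k)" if "k \<le> n" for k
  proof (rule integrable_bounded[where b="exp (t * (k * b))"])
    fix \<omega> assume "\<omega> \<in> space M"
    then have "U k \<omega> \<le> exp (t * (k * b))"
      unfolding U_def using b that by (intro stopped_exp_le t b0) (force simp: abs_le_iff)
    then show "\<bar>U k \<omega>\<bar> \<le> exp (t * (k * b))" using stopped_exp_pos[of t a k] by (simp add: U_def abs_of_pos)
  qed simp
  have main: "expectation (U k) \<le> exp (\<Sum>i=1..k. w i)" if "k \<le> n" for k
    using that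
  proof (induction k)
    case 0
    then show ?case by (simp add: U_def prob_space)
  next
    case (Suc k)
    define G where "G = (\<lambda>\<omega>. U k \<omega> * of_bool (\<not> H k \<omega>))"
    \<comment> \<open>If the level was reached before, the value stays. Otherwise it is multiplied
      by a factor that depends only on \<open>Z (Suc k)\<close>, while \<open>G\<close> depends only
      on the first \<open>k\<close> variables.\<close>
    have USuc: "U (Suc k) \<omega> = U k \<omega> * of_bool (H k \<omega>) + G \<omega> * exp (t * Z (Suc k) \<omega>)" for \<omega>
      using stopped_exp_unstopped[of k a "\<lambda>i. Z i \<omega>" t]
      by (auto simp: U_def H_def G_def exp_add[symmetric] algebra_simps)
    have "indep_var borel G borel (\<lambda>\<omega>. exp (t * Z (Suc k) \<omega>))"
    proof -
      let ?g = "\<lambda>z. stopped_exp t a k z * of_bool (\<not> (\<exists>j\<in>{1..k}. a \<le> sum z {1..j}))"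
      note pred_partial_sum_exceeds[OF order_refl, measurable]
      have gm: "?g \<in> borel_measurable (PiM {1..k} (\<lambda>_. borel))" by measurable
      have hm: "(\<lambda>z. exp (t * z (Suc k))) \<in> borel_measurable (PiM {Suc k} (\<lambda>_. borel))"
        by measurable
      have "indep_var borel (?g \<circ> (\<lambda>\<omega>. restrict (\<lambda>i. Z i \<omega>) {1..k})) borel ((\<lambda>z. exp (t * z (Suc k))) \<circ> (\<lambda>\<omega>. restrict (\<lambda>i. Z i \<omega>) {Suc k}))"
        by (rule indep_var_compose[OF indep_var_restrict[OF ind] gm hm]) auto
      moreover have "?g \<circ> (\<lambda>\<omega>. restrict (\<lambda>i. Z i \<omega>) {1..k}) = G"
      proof
        fix \<omega>
        have "sum (restrict (\<lambda>i. Z i \<omega>) {1..k}) {1..j} = (\<Sum>i=1..j. Z i \<omega>)" if "j \<in> {1..k}" for j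
          using that by (intro sum.cong) auto
        then show "(?g \<circ> (\<lambda>\<omega>. restrict (\<lambda>i. Z i \<omega>) {1..k})) \<omega> = G \<omega>"
          by (simp add: G_def Ur H_def)
      qed
      ultimately show ?thesis by (simp add: comp_def)
    qed
    moreover have iG: "integrable M G"
      unfolding G_def using Ui[of k] Suc.prems by (intro Bochner_Integration.integrable_bound[OF Ui[of k]]) auto
    moreover have tZ: "\<bar>t * Z (Suc k) \<omega>\<bar> \<le> c" if "\<omega> \<in> space M" for \<omega>
      using mult_left_mono[OF b[of "Suc k" \<omega>], of t] t Suc.prems that by (simp add: abs_mult)
    then have iZ: "integrable M (\<lambda>\<omega>. exp (t * Z (Suc k) \<omega>))"
      by (intro integrable_bounded[where b="exp c"]) (auto simp: abs_le_iff)
    ultimately have eq: "expectation (\<lambda>\<omega>. G \<omega> * exp (t * Z (Suc k) \<omega>)) = expectation G * expectation (\<lambda>\<omega>. exp (t * Z (Suc k) \<omega>))"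
      and ip: "integrable M (\<lambda>\<omega>. G \<omega> * exp (t * Z (Suc k) \<omega>))"
      using indep_var_lebesgue_integral indep_var_integrable by auto
    have iH: "integrable M (\<lambda>\<omega>. U k \<omega> * of_bool (H k \<omega>))"
      using Ui[of k] Suc.prems by (intro Bochner_Integration.integrable_bound[OF Ui[of k]]) auto
    have G0: "0 \<le> expectation G" unfolding G_def U_def
      by (intro Bochner_Integration.integral_nonneg mult_nonneg_nonneg) (auto intro: less_imp_le stopped_exp_pos)
    have H0: "0 \<le> expectation (\<lambda>\<omega>. U k \<omega> * of_bool (H k \<omega>))" unfolding U_def
      by (intro Bochner_Integration.integral_nonneg mult_nonneg_nonneg) (auto intro: less_imp_le stopped_exp_pos)
    have mg: "expectation (\<lambda>\<omega>. exp (t * Z (Suc k) \<omega>)) \<le> exp (w (Suc k))"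
      unfolding w_def using b z t Suc.prems by (intro mgf_bounds_single(1)) auto
    have "expectation (U (Suc k)) = expectation (\<lambda>\<omega>. U k \<omega> * of_bool (H k \<omega>)) + expectation G * expectation (\<lambda>\<omega>. exp (t * Z (Suc k) \<omega>))"
      unfolding USuc[abs_def] using ip iH eq by simp
    also have "\<dots> \<le> expectation (\<lambda>\<omega>. U k \<omega> * of_bool (H k \<omega>)) * exp (w (Suc k)) + expectation G * exp (w (Suc k))"
      using mg G0 H0 w0[of "Suc k"] mult_left_mono[of 1 "exp (w (Suc k))"] by (intro add_mono mult_left_mono) auto
    also have "\<dots> = expectation (\<lambda>\<omega>. U k \<omega> * of_bool (H k \<omega>) + G \<omega>) * exp (w (Suc k))"
      using iH iG by (simp add: algebra_simps)
    also have "(\<lambda>\<omega>. U k \<omega> * of_bool (H k \<omega>) + G \<omega>) = U k" by (auto simp: G_def)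
    also have "expectation (U k) * exp (w (Suc k)) \<le> exp (\<Sum>i=1..k. w i) * exp (w (Suc k))"
      using Suc by (intro mult_right_mono) auto
    also have "\<dots> = exp (\<Sum>i=1..Suc k. w i)" by (simp add: exp_add)
    finally show ?case .
  qed
  \<comment> \<open>Markov's inequality: on the event the stopped exponential is at least
    \<open>exp (t * a)\<close>.\<close>
  have "exp (t * a) * prob {\<omega> \<in> space M. H n \<omega>} = expectation (\<lambda>\<omega>. exp (t * a) * indicator {\<omega> \<in> space M. H n \<omega>} \<omega>)"
    by simp
  also have "\<dots> \<le> expectation (U n)"
  proof (rule integral_mono)
    show "exp (t * a) * indicator {\<omega> \<in> space M. H n \<omega>} \<omega> \<le> U n \<omega>" for \<omega>
      using stopped_exp_ge[OF t(1), of n a "\<lambda>i. Z i \<omega>"] stopped_exp_pos[of t a n "\<lambda>i. Z i \<omega>"]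
      by (auto simp: U_def H_def indicator_def)
  qed (auto intro!: Ui integrable_mult_right simp: emeasure_eq_measure)
  also have "\<dots> \<le> exp (\<Sum>i=1..n. w i)" using main by simp
  finally have "prob {\<omega> \<in> space M. H n \<omega>} \<le> exp (- t * a + (\<Sum>i=1..n. w i))"
    by (simp add: exp_add exp_minus exp_diff field_simps)
  then show ?thesis
    by (simp add: H_def w_def sum_distrib_left sum_divide_distrib)
qed

section \<open>The law of the iterated logarithm\<close>

text \<open>If no event occurs from \<open>n\<close> on, none occurs at the indices
  \<open>n, ..., N - 1\<close>. By independence this has probability at most
  \<open>exp (- sum p {n..<N})\<close>, and the sum diverges. The events have the form
  \<open>X k \<in> A k\<close> so that independence can be stated for the variables.\<close>

lemma (in prob_space) borel_cantelli_2:
  fixes X :: "nat \<Rightarrow> 'a \<Rightarrow> real"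
  assumes ind: "indep_vars (\<lambda>_. borel) X UNIV" and A: "\<And>k. A k \<in> sets borel"
    and div: "\<not> summable (\<lambda>k. prob {\<omega> \<in> space M. X k \<omega> \<in> A k})"
  shows "AE \<omega> in M. \<exists>\<^sub>F k in sequentially. X k \<omega> \<in> A k"
proof -
  have m[measurable]: "X k \<in> borel_measurable M" for k using ind unfolding indep_vars_def by auto
  note A[measurable]
  define p where "p = (\<lambda>k. prob {\<omega> \<in> space M. X k \<omega> \<in> A k})"
  have p: "0 \<le> p k" "p k \<le> 1" for k by (auto simp: p_def)
  have null: "prob {\<omega> \<in> space M. \<forall>k\<ge>n. X k \<omega> \<notin> A k} = 0" (is "prob ?E = 0") for n
  proof (rule ccontr)
    assume "prob ?E \<noteq> 0"
    then have pos: "0 < prob ?E" by (simp add: zero_less_measure_iff)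
    \<comment> \<open>One partial sum over \<open>{n..<N}\<close> beyond
      \<open>- ln (prob ?E)\<close> already contradicts a positive probability.\<close>
    have "\<exists>N. - ln (prob ?E) + sum p {..<n} < sum p {..<N}"
    proof (rule ccontr)
      assume "\<not> ?thesis"
      then have "summable p" using p by (intro summableI_nonneg_bounded) (auto simp: not_less)
      then show False using div by (simp add: p_def)
    qed
    then obtain N where N: "- ln (prob ?E) + sum p {..<n} < sum p {..<N}" by blast
    have "- ln (prob ?E) \<ge> 0" using pos by simp
    then have "sum p {..<n} < sum p {..<N}" using N by linarith
    then have nN: "n < N" using p sum_mono2[of "{..<n}" "{..<N}" p] by (meson finite_lessThan lessThan_subset_iff linorder_not_le sum_mono2 order.strict_trans2 less_irrefl)
    have s: "- ln (prob ?E) < sum p {n..<N}"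
      using N sum.atLeastLessThan_concat[of 0 n N p] nN by (simp add: atLeast0LessThan)
    have "prob ?E \<le> prob (\<Inter>k\<in>{n..<N}. X k -` (- A k) \<inter> space M)"
      using nN by (intro finite_measure_mono) auto
    also have "\<dots> = (\<Prod>k\<in>{n..<N}. prob (X k -` (- A k) \<inter> space M))"
      using nN by (intro indep_varsD[OF ind]) auto
    also have "\<dots> \<le> (\<Prod>k\<in>{n..<N}. exp (- p k))"
    proof (intro prod_mono conjI measure_nonneg)
      fix k
      have "X k -` (- A k) \<inter> space M = space M - {\<omega> \<in> space M. X k \<omega> \<in> A k}" by auto
      then have "prob (X k -` (- A k) \<inter> space M) = 1 - p k"
        by (simp add: p_def prob_compl)
      then show "prob (X k -` (- A k) \<inter> space M) \<le> exp (- p k)" using exp_ge_add_one_self[of "- p k"] by simp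
    qed
    also have "\<dots> = exp (- sum p {n..<N})" by (simp add: exp_sum[symmetric] sum_negf)
    also have "\<dots> < exp (ln (prob ?E))" using s by simp
    finally show False using pos by simp
  qed
  have "AE \<omega> in M. \<not> (\<forall>k\<ge>n. X k \<omega> \<notin> A k)" for n
    using null[of n] by (subst AE_iff_measurable[OF _ refl]) (auto simp: emeasure_eq_measure)
  then have "AE \<omega> in M. \<forall>n. \<not> (\<forall>k\<ge>n. X k \<omega> \<notin> A k)" by (simp add: AE_all_countable)
  then show ?thesis by eventually_elim (auto simp: frequently_sequentially)
qed

section \<open>Upper and lower bounds along geometric blocks\<close>

text \<open>Kolmogorov's scale has the iterated logarithm of the variance. When \<open>W n\<close>
  lies between multiples of two positive powers of \<open>n\<close>, \<open>ln (ln (W n))\<close> is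
  asymptotic to \<open>ln (ln n)\<close>, so the index can take its place.\<close>

definition lil_scale :: "(nat \<Rightarrow> real) \<Rightarrow> nat \<Rightarrow> real" where
  "lil_scale W n = sqrt (2 * W n * ln (ln (real n)))"

lemma eventually_lnln_pos: "\<forall>\<^sub>F n in sequentially. 0 < ln (ln (real n))"
  by real_asymp

lemma lnln_mono:
  assumes "1 < ln (real n)" "n \<le> k"
  shows "ln (ln (real n)) \<le> ln (ln (real k))"
proof -
  have n: "0 < n" using assms by (cases n) auto
  then have "ln (real n) \<le> ln (real k)" using assms by (subst ln_le_cancel_iff) auto
  then show ?thesis using assms by (subst ln_le_cancel_iff) auto
qed

text \<open>The index blocks \<open>(\<rho>\<^sup>k, \<rho>\<^sup>k\<^sup>+\<^sup>1]\<close> with \<open>\<rho>\<close> close to 1.\<close>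

lemma (in prob_space) lil_upper:
  fixes Z :: "nat \<Rightarrow> 'a \<Rightarrow> real"
  assumes ind: "indep_vars (\<lambda>_. borel) Z {1..}"
    and bd: "\<And>n i \<omega>. i \<in> {1..n} \<Longrightarrow> \<omega> \<in> space M \<Longrightarrow> \<bar>Z i \<omega>\<bar> \<le> B n" and B0: "\<And>n. 0 \<le> B n"
    and z: "\<And>i. i \<ge> 1 \<Longrightarrow> expectation (Z i) = 0"
    and n0: "1 \<le> n0" and Wpos: "\<And>n. n0 \<le> n \<Longrightarrow> 0 < W n"
    and Wmono: "\<And>n m. n0 \<le> n \<Longrightarrow> n \<le> m \<Longrightarrow> W n \<le> W m"
    and Wup: "\<And>n m. n0 \<le> n \<Longrightarrow> n \<le> m \<Longrightarrow> W m \<le> (real m / real n) powr g * W n"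
    and BW: "(\<lambda>n. (B n)\<^sup>2 * ln (ln (real n)) / W n) \<longlonglongrightarrow> 0"
    and v: "0 < v" "\<forall>\<^sub>F n in sequentially. (\<Sum>i=1..n. expectation (\<lambda>\<omega>. (Z i \<omega>)\<^sup>2)) \<le> v * W n"
    and g: "0 \<le> g" and eps: "0 < \<epsilon>"
  shows "AE \<omega> in M. \<forall>\<^sub>F n in sequentially. (\<Sum>i=1..n. Z i \<omega>) \<le> (1 + \<epsilon>) * sqrt v * lil_scale W n"
proof -
  have m[measurable]: "Z i \<in> borel_measurable M" if "i \<in> {1..}" for i
    using ind that unfolding indep_vars_def by auto
  \<comment> \<open>Over one block the index grows by a factor of at most \<open>\<rho>^2\<close>,
    the square leaving room for rounding up, so \<open>W\<close> grows by at most
    \<open>(\<rho>^2) powr g \<le> 1 + \<epsilon> / 2\<close>. The exponent has \<open>g + 1\<close>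
    in the denominator because \<open>g = 0\<close> is allowed.\<close>
  define \<rho> where "\<rho> = (1 + \<epsilon> / 2) powr (1 / (2 * (g + 1)))"
  have rho: "1 < \<rho>" unfolding \<rho>_def using eps g by (intro gr_one_powr) auto
  have rhog: "(\<rho>\<^sup>2) powr g \<le> 1 + \<epsilon> / 2"
  proof -
    have "\<rho>\<^sup>2 = \<rho> powr 2" using rho by simp
    then have "(\<rho>\<^sup>2) powr g = (1 + \<epsilon> / 2) powr (1 / (2 * (g + 1)) * (2 * g))"
      by (simp add: \<rho>_def powr_powr)
    also have "1 / (2 * (g + 1)) * (2 * g) = g / (g + 1)" using g by (simp add: field_simps)
    finally have "(\<rho>\<^sup>2) powr g = (1 + \<epsilon> / 2) powr (g / (g + 1))" .
    also have "\<dots> \<le> (1 + \<epsilon> / 2) powr 1" using eps g by (intro powr_mono) auto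
    finally show ?thesis using eps by simp
  qed
  define N where "N = (\<lambda>k::nat. nat \<lceil>\<rho> ^ k\<rceil>)"
  have Nge: "\<rho> ^ k \<le> real (N k)" for k unfolding N_def by linarith
  have Nle: "real (N k) \<le> \<rho> ^ k + 1" for k
  proof -
    have "0 \<le> \<rho> ^ k" using rho by simp
    then show ?thesis unfolding N_def by linarith
  qed
  have Nmono: "N k \<le> N j" if "k \<le> j" for k j
    unfolding N_def using power_increasing[OF that, of \<rho>] rho by (intro nat_mono ceiling_mono) auto
  have rk: "filterlim (\<lambda>k. \<rho> ^ k) at_top sequentially"
    using rho by (intro filterlim_at_infinity_imp_filterlim_at_top filterlim_realpow_sequentially_gt1 always_eventually) auto
  have Nreal: "filterlim (\<lambda>k. real (N k)) at_top sequentially"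
    by (rule filterlim_at_top_mono[OF rk]) (use Nge in auto)
  then have Nlim: "filterlim N at_top sequentially"
    by (simp add: filterlim_sequentially_iff_filterlim_real)
  have N1lim: "filterlim (\<lambda>k. N (Suc k)) at_top sequentially"
    by (rule filterlim_compose[OF Nlim filterlim_Suc])
  define LL where "LL = (\<lambda>n::nat. ln (ln (real n)))"
  \<comment> \<open>The solution of \<open>(1 - c) * (1 + \<epsilon>) = 1 + \<epsilon> / 2\<close>:
    one half of the excess \<open>\<epsilon>\<close> pays for the error in the tail bound, the other
    for the growth of \<open>W\<close> over a block.\<close>
  define c where "c = (\<epsilon> / 2) / (1 + \<epsilon>)"
  have c: "0 < c" "c \<le> 1" using eps by (auto simp: c_def)
  \<comment> \<open>The level belongs to the start of the block, the variance to its end;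
    \<open>t k\<close> minimises the Gaussian exponent
    \<open>- t * a k + t^2 * v * W (N (Suc k)) / 2\<close>.\<close>
  define a where "a = (\<lambda>k. (1 + \<epsilon>) * sqrt v * lil_scale W (N k))"
  define t where "t = (\<lambda>k. a k / (v * W (N (Suc k))))"
  define H where "H = (\<lambda>k. {\<omega> \<in> space M. \<exists>j\<in>{1..N (Suc k)}. a k \<le> (\<Sum>i=1..j. Z i \<omega>)})"
  have Hm[measurable]: "H k \<in> sets M" for k
    unfolding H_def by measurable
  have LLpos: "\<forall>\<^sub>F n in sequentially. 0 < LL n \<and> 1 < ln (real n) \<and> n0 \<le> n"
  proof -
    have "\<forall>\<^sub>F n::nat in sequentially. 1 < ln (real n)" by real_asymp
    then show ?thesis using eventually_lnln_pos eventually_ge_at_top[of n0] unfolding LL_def by eventually_elim auto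
  qed
  have LLmono: "LL n \<le> LL k" if "1 < ln (real n)" "n \<le> k" "1 \<le> n" for n k
    unfolding LL_def using that by (intro lnln_mono)
  \<comment> \<open>The threshold is what \<open>t k * B \<le> c\<close> requires, since the square
    of the left side is at most \<open>2 * (1 + \<epsilon>)^2 / v\<close> times this ratio.\<close>
  have "\<forall>\<^sub>F n in sequentially. (B n)\<^sup>2 * LL n / W n < c\<^sup>2 * v / (2 * (1 + \<epsilon>)\<^sup>2)"
    using order_tendstoD(2)[OF BW, of "c\<^sup>2 * v / (2 * (1 + \<epsilon>)\<^sup>2)"] c v eps unfolding LL_def by simp
  from eventually_compose_filterlim[OF this N1lim]
  have e1: "\<forall>\<^sub>F k in sequentially. (B (N (Suc k)))\<^sup>2 * LL (N (Suc k)) / W (N (Suc k)) < c\<^sup>2 * v / (2 * (1 + \<epsilon>)\<^sup>2)" .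
  note e2 = eventually_compose_filterlim[OF v(2) N1lim]
  note e3 = eventually_compose_filterlim[OF LLpos Nlim]
  have e4: "\<forall>\<^sub>F k in sequentially. 1 / (\<rho> * (\<rho> - 1)) \<le> \<rho> ^ k"
    using rk by (simp add: filterlim_at_top)
  have e5: "\<forall>\<^sub>F k::nat in sequentially. 1 \<le> k" by (rule eventually_ge_at_top)
  have bound: "\<forall>\<^sub>F k in sequentially. prob (H k) \<le> (ln \<rho>) powr (- (1 + \<epsilon>)) * real k powr (- (1 + \<epsilon>))"
    using e1 e2 e3 e4 e5
  proof eventually_elim
    case (elim k)
    let ?n = "N k" let ?m = "N (Suc k)"
    have nm: "?n \<le> ?m" by (rule Nmono) simp
    have n0n: "n0 \<le> ?n" and L0: "0 < LL ?n" and l1: "1 < ln (real ?n)" using elim by auto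
    have Wn: "0 < W ?n" and Wm: "0 < W ?m" using Wpos n0n nm by auto
    have LLm: "LL ?n \<le> LL ?m" using LLmono l1 nm n0 n0n by auto
    have a2: "(a k)\<^sup>2 = (1 + \<epsilon>)\<^sup>2 * v * (2 * W ?n * LL ?n)" and a0: "0 \<le> a k"
      using v eps Wn L0 by (auto simp: a_def lil_scale_def LL_def power_mult_distrib)
    have t0: "0 \<le> t k" unfolding t_def using a0 v Wm by simp
    have tv: "t k * (v * W ?m) = a k" using v Wm by (simp add: t_def)
    have WW: "W ?m \<le> (1 + \<epsilon> / 2) * W ?n"
    proof -
      have "1 \<le> \<rho> ^ k * (\<rho> * (\<rho> - 1))" using elim(4) rho by (simp add: field_simps)
      then have "\<rho> ^ Suc k + 1 \<le> \<rho>\<^sup>2 * \<rho> ^ k" by (simp add: algebra_simps power2_eq_square)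
      then have "real ?m \<le> \<rho>\<^sup>2 * \<rho> ^ k" using Nle[of "Suc k"] by linarith
      also have "\<dots> \<le> \<rho>\<^sup>2 * real ?n" using Nge[of k] by (intro mult_left_mono) auto
      finally have "real ?m / real ?n \<le> \<rho>\<^sup>2" using n0n n0 by (simp add: field_simps)
      then have "(real ?m / real ?n) powr g \<le> 1 + \<epsilon> / 2"
        using powr_mono2[of g "real ?m / real ?n" "\<rho>\<^sup>2"] g rhog by simp
      then show ?thesis using Wup[OF n0n nm] Wn by (meson mult_right_mono less_imp_le order_trans)
    qed
    have tB: "t k * B ?m \<le> c"
    proof (rule power2_le_imp_le)
      have "(t k * B ?m)\<^sup>2 = (1 + \<epsilon>)\<^sup>2 * 2 / v * ((W ?n * LL ?n * (B ?m)\<^sup>2) / (W ?m * W ?m))"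
        unfolding t_def power_mult_distrib power_divide a2 using v Wm by (simp add: power2_eq_square)
      also have "\<dots> \<le> (1 + \<epsilon>)\<^sup>2 * 2 / v * ((W ?m * LL ?m * (B ?m)\<^sup>2) / (W ?m * W ?m))"
        using Wmono[OF n0n nm] LLm L0 Wn Wm v by (intro mult_left_mono divide_right_mono mult_mono) auto
      also have "\<dots> = (1 + \<epsilon>)\<^sup>2 * 2 / v * ((B ?m)\<^sup>2 * LL ?m / W ?m)" using Wm by (simp add: field_simps)
      also have "\<dots> \<le> (1 + \<epsilon>)\<^sup>2 * 2 / v * (c\<^sup>2 * v / (2 * (1 + \<epsilon>)\<^sup>2))"
        using elim(1) v by (intro mult_left_mono) auto
      also have "\<dots> = c\<^sup>2" using v eps by (simp add: field_simps)
      finally show "(t k * B ?m)\<^sup>2 \<le> c\<^sup>2" .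
    qed (use c in simp)
    have "prob (H k) \<le> exp (- t k * a k + (1 + c) * (t k)\<^sup>2 * (\<Sum>i=1..?m. expectation (\<lambda>\<omega>. (Z i \<omega>)\<^sup>2)) / 2)"
      unfolding H_def by (rule maximal_tail[OF ind]) (use bd B0 z t0 tB c in auto)
    also have "\<dots> \<le> exp (- ((1 + \<epsilon>) * LL ?n))"
    proof -
      have "(1 + c) * (t k)\<^sup>2 * (\<Sum>i=1..?m. expectation (\<lambda>\<omega>. (Z i \<omega>)\<^sup>2)) \<le> (1 + c) * (t k)\<^sup>2 * (v * W ?m)"
        using elim(2) c by (intro mult_left_mono) auto
      also have "\<dots> = (1 + c) * t k * a k" by (simp add: power2_eq_square tv[symmetric])
      finally have "- t k * a k + (1 + c) * (t k)\<^sup>2 * (\<Sum>i=1..?m. expectation (\<lambda>\<omega>. (Z i \<omega>)\<^sup>2)) / 2 \<le> - ((1 - c) * (t k * a k) / 2)"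
        by (simp add: algebra_simps diff_divide_distrib)
      also have "t k * a k = (1 + \<epsilon>)\<^sup>2 * 2 * LL ?n * (W ?n / W ?m)"
        using a2 v Wm unfolding t_def by (simp add: power2_eq_square)
      also have "(1 - c) * ((1 + \<epsilon>)\<^sup>2 * 2 * LL ?n * (W ?n / W ?m)) / 2 = (1 + \<epsilon>) * LL ?n * ((1 + \<epsilon> / 2) * W ?n / W ?m)"
      proof -
        have "(1 - c) * (1 + \<epsilon>) = 1 + \<epsilon> / 2" using eps by (simp add: c_def field_simps)
        then have "(1 - c) * (1 + \<epsilon>)\<^sup>2 = (1 + \<epsilon> / 2) * (1 + \<epsilon>)" by (simp add: power2_eq_square)
        then have "(1 - c) * (1 + \<epsilon>)\<^sup>2 * (LL ?n * (W ?n / W ?m)) = (1 + \<epsilon> / 2) * (1 + \<epsilon>) * (LL ?n * (W ?n / W ?m))" by simp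
        then show ?thesis by (simp add: mult_ac)
      qed
      also have "- \<dots> \<le> - ((1 + \<epsilon>) * LL ?n * 1)"
        unfolding neg_le_iff_le using WW Wm eps L0 by (intro mult_left_mono) (auto simp: field_simps)
      finally show ?thesis by simp
    qed
    \<comment> \<open>As \<open>ln (N k) \<ge> k * ln \<rho>\<close>, the bound is a constant times
      \<open>k powr (- (1 + \<epsilon>))\<close>, which is summable.\<close>
    also have "\<dots> = (ln (real ?n)) powr (- (1 + \<epsilon>))"
      using l1 by (simp add: powr_def LL_def algebra_simps)
    also have "\<dots> \<le> (real k * ln \<rho>) powr (- (1 + \<epsilon>))"
    proof (rule powr_mono2')
      show "0 < real k * ln \<rho>" using elim(5) rho by simp
      have "ln (\<rho> ^ k) \<le> ln (real ?n)" using Nge[of k] rho by (intro ln_mono) auto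
      then show "real k * ln \<rho> \<le> ln (real ?n)" using rho by (simp add: ln_realpow)
    qed (use eps in auto)
    also have "\<dots> = (ln \<rho>) powr (- (1 + \<epsilon>)) * real k powr (- (1 + \<epsilon>))"
      using rho by (simp add: powr_mult mult.commute)
    finally show ?case .
  qed
  have "summable (\<lambda>k. prob (H k))"
  proof (rule summable_comparison_test_ev)
    show "\<forall>\<^sub>F k in sequentially. norm (prob (H k)) \<le> (ln \<rho>) powr (- (1 + \<epsilon>)) * real k powr (- (1 + \<epsilon>))"
      using bound by simp
    show "summable (\<lambda>k. (ln \<rho>) powr (- (1 + \<epsilon>)) * real k powr (- (1 + \<epsilon>)))"
      using eps by (intro summable_mult) (simp add: summable_real_powr_iff)
  qed
  then have "AE \<omega> in M. \<forall>\<^sub>F k in sequentially. \<omega> \<in> space M - H k"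
    by (intro borel_cantelli_AE1) (auto simp: emeasure_eq_measure)
  then show ?thesis
  proof eventually_elim
    case (elim \<omega>)
    from elim e3 have "\<forall>\<^sub>F k in sequentially. \<omega> \<in> space M - H k \<and> 0 < LL (N k) \<and> 1 < ln (real (N k)) \<and> n0 \<le> N k"
      by eventually_elim auto
    then obtain K where K: "\<And>k. K \<le> k \<Longrightarrow> \<omega> \<in> space M - H k \<and> 0 < LL (N k) \<and> 1 < ln (real (N k)) \<and> n0 \<le> N k"
      unfolding eventually_sequentially by blast
    have "(\<Sum>i=1..n. Z i \<omega>) \<le> (1 + \<epsilon>) * sqrt v * lil_scale W n" if n: "N K \<le> n" for n
    proof -
      have ex: "\<exists>k. n < N k"
      proof -
        have "\<forall>\<^sub>F k in sequentially. Suc n \<le> N k" using Nlim by (simp add: filterlim_at_top)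
        then show ?thesis by (metis eventually_happens' sequentially_bot Suc_le_eq)
      qed
      \<comment> \<open>This index lies beyond \<open>K\<close>, so it is a successor
        \<open>Suc j\<close>, and by minimality \<open>N j \<le> n < N (Suc j)\<close>.\<close>
      define k where "k = (LEAST k. n < N k)"
      have k: "n < N k" unfolding k_def using ex by (rule LeastI_ex)
      have "K < k" using k n Nmono by (meson linorder_not_less order.strict_trans2 le_trans)
      then obtain j where j: "k = Suc j" "K \<le> j" by (cases k) auto
      have nj: "N j \<le> n" using not_less_Least[of j "\<lambda>k. n < N k"] j unfolding k_def by auto
      have Kj: "\<omega> \<in> space M - H j" "0 < LL (N j)" "1 < ln (real (N j))" "n0 \<le> N j" using K[OF j(2)] by auto
      have "(\<Sum>i=1..n. Z i \<omega>) < a j"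
      proof (rule ccontr)
        assume "\<not> ?thesis"
        moreover have "n \<in> {1..N (Suc j)}" using Kj(4) k nj n0 j(1) by auto
        ultimately have "\<omega> \<in> H j" using Kj(1) unfolding H_def by (auto simp: not_less)
        then show False using Kj(1) by simp
      qed
      also have "a j \<le> (1 + \<epsilon>) * sqrt v * lil_scale W n"
        unfolding a_def lil_scale_def using Wmono[OF Kj(4) nj] LLmono[OF Kj(3) nj] Kj n0 eps v Wpos[of "N j"]
        by (intro mult_left_mono real_sqrt_le_mono mult_mono) (auto simp: LL_def)
      finally show ?thesis by simp
    qed
    then show ?case unfolding eventually_sequentially by blast
  qed
qed

text \<open>The index blocks \<open>(\<rho>\<^sup>k, \<rho>\<^sup>k\<^sup>+\<^sup>1]\<close> with \<open>\<rho>\<close> large: the block increments are independent and dominate what precedes them.\<close>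

lemma (in prob_space) lil_lower:
  fixes Z :: "nat \<Rightarrow> 'a \<Rightarrow> real"
  assumes ind: "indep_vars (\<lambda>_. borel) Z {1..}"
    and bd: "\<And>n i \<omega>. i \<in> {1..n} \<Longrightarrow> \<omega> \<in> space M \<Longrightarrow> \<bar>Z i \<omega>\<bar> \<le> B n" and B0: "\<And>n. 0 \<le> B n"
    and z: "\<And>i. i \<ge> 1 \<Longrightarrow> expectation (Z i) = 0"
    and n0: "1 \<le> n0" and Wpos: "\<And>n. n0 \<le> n \<Longrightarrow> 0 < W n"
    and Wlo: "\<And>n m. n0 \<le> n \<Longrightarrow> n \<le> m \<Longrightarrow> (real m / real n) powr g1 * W n \<le> W m"
    and Wup: "\<And>n m. n0 \<le> n \<Longrightarrow> n \<le> m \<Longrightarrow> W m \<le> (real m / real n) powr g * W n"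
    and BW: "(\<lambda>n. (B n)\<^sup>2 * ln (ln (real n)) / W n) \<longlonglongrightarrow> 0"
    and v: "0 < v" "(\<lambda>n. (\<Sum>i=1..n. expectation (\<lambda>\<omega>. (Z i \<omega>)\<^sup>2)) / W n) \<longlonglongrightarrow> v"
    and g: "0 < g1" "0 \<le> g" and eps: "0 < \<epsilon>" "\<epsilon> < 1"
  shows "AE \<omega> in M. \<exists>\<^sub>F n in sequentially. (1 - \<epsilon>) * sqrt v * lil_scale W n < (\<Sum>i=1..n. Z i \<omega>)"
proof -
  have m[measurable]: "Z i \<in> borel_measurable M" if "i \<in> {1..}" for i
    using ind that unfolding indep_vars_def by auto
  have Wmono: "W n \<le> W m" if "n0 \<le> n" "n \<le> m" for n m
  proof -
    have "1 \<le> (real m / real n) powr g1" using that n0 g by (intro ge_one_powr_ge_zero) auto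
    then have "1 * W n \<le> (real m / real n) powr g1 * W n" using Wpos[OF that(1)] by (intro mult_right_mono) auto
    then show ?thesis using Wlo[OF that] by simp
  qed
  \<comment> \<open>The final loss is \<open>8 * d\<close> in the block increment and
    \<open>4 * d\<close> from the sum before it, together \<open>\<epsilon>\<close>.\<close>
  define d where "d = \<epsilon> / 12"
  have d: "0 < d" "d < 1 / 12" using eps by (auto simp: d_def)
  have d2: "d\<^sup>2 \<le> d" "0 < d\<^sup>2" using d by (auto simp: power2_eq_square mult_left_le_one_le)
  \<comment> \<open>An integer, so the block ends are exact powers and nothing is rounded. Its size
    makes \<open>W\<close> at the start of a block at most \<open>d^2\<close> times \<open>W\<close>
    at the end.\<close>
  obtain \<rho> :: nat where rho: "2 \<le> \<rho>" and rhod: "real \<rho> powr (- g1) \<le> d\<^sup>2"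
  proof -
    have "(\<lambda>n. real n powr (- g1)) \<longlonglongrightarrow> 0" using g by real_asymp
    then have "\<forall>\<^sub>F n in sequentially. real n powr (- g1) < d\<^sup>2" using d2 by (intro order_tendstoD) auto
    then have "\<forall>\<^sub>F n in sequentially. real n powr (- g1) < d\<^sup>2 \<and> 2 \<le> n"
      using eventually_ge_at_top[of 2] by eventually_elim auto
    then show ?thesis using that unfolding eventually_sequentially by (meson less_imp_le order_refl)
  qed
  define N where "N = (\<lambda>k. \<rho> ^ k)"
  have Nlim: "filterlim N at_top sequentially"
    unfolding N_def using rho by (intro filterlim_at_top_mono[OF filterlim_ident] always_eventually allI) (simp add: less_imp_le)
  have N1lim: "filterlim (\<lambda>k. N (Suc k)) at_top sequentially"
    by (rule filterlim_compose[OF Nlim filterlim_Suc])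
  define LL where "LL = (\<lambda>n::nat. ln (ln (real n)))"
  define V where "V = (\<lambda>n. \<Sum>i=1..n. expectation (\<lambda>\<omega>. (Z i \<omega>)\<^sup>2))"
  define I where "I = (\<lambda>k. {N k + 1..N (Suc k)})"
  define Vb where "Vb = (\<lambda>k. \<Sum>i\<in>I k. expectation (\<lambda>\<omega>. (Z i \<omega>)\<^sup>2))"
  \<comment> \<open>Chosen so that \<open>(t k)^2 * Vb k = 2 * (1 - 4 * d) * LL\<close>. The tail
    bound costs a factor \<open>1 + 4 * d\<close> in the exponent, and
    \<open>(1 + 4 * d) * (1 - 4 * d) \<le> 1\<close> leaves a probability of at least
    \<open>exp (- LL)\<close>.\<close>
  define t where "t = (\<lambda>k. sqrt (2 * (1 - 4 * d) * LL (N (Suc k)) / Vb k))"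
  define X where "X = (\<lambda>k \<omega>. \<Sum>i\<in>I k. Z i \<omega>)"
  have N1: "1 \<le> N k" "N k \<le> N (Suc k)" for k unfolding N_def using rho by auto
  have split: "(\<Sum>i=1..N (Suc k). f i) = (\<Sum>i=1..N k. f i) + (\<Sum>i\<in>I k. f i)" for k and f :: "nat \<Rightarrow> real"
    unfolding I_def using N1[of k] sum.ub_add_nat[of 1 "N k" f "N (Suc k) - N k"] by simp
  \<comment> \<open>The lower bound on \<open>LL\<close> yields the condition of the tail bound that
    \<open>d^2 * (t^2 * V)\<close> is at least 8.\<close>
  have LLpos: "\<forall>\<^sub>F n in sequentially. 8 / (2 * d\<^sup>2 * (1 - 4 * d)) < LL n \<and> 0 < LL n \<and> 1 < ln (real n) \<and> n0 \<le> n"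
  proof -
    have "\<forall>\<^sub>F n::nat in sequentially. 1 < ln (real n)" by real_asymp
    moreover have "filterlim LL at_top sequentially" unfolding LL_def by real_asymp
    then have "\<forall>\<^sub>F n in sequentially. 8 / (2 * d\<^sup>2 * (1 - 4 * d)) < LL n" by (simp add: filterlim_at_top_dense)
    ultimately show ?thesis using eventually_lnln_pos eventually_ge_at_top[of n0] unfolding LL_def by eventually_elim auto
  qed
  have LLmono: "LL n \<le> LL k" if "1 < ln (real n)" "n \<le> k" "1 \<le> n" for n k
    unfolding LL_def using that by (intro lnln_mono)
  have Vev: "\<forall>\<^sub>F n in sequentially. (1 - d\<^sup>2) * v < V n / W n \<and> V n / W n < (1 + d\<^sup>2) * v"
    using order_tendstoD[OF v(2)] d2 v(1) unfolding V_def by (intro eventually_conj) auto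
  \<comment> \<open>Solves \<open>2 / (v / 2) * b2 = (d^2 / 24)^2\<close>; with
    \<open>Vb k \<ge> v / 2 * W\<close> this becomes
    \<open>2 * t * B \<le> d^2 / 12\<close>.\<close>
  define b2 where "b2 = (d\<^sup>2 / 24)\<^sup>2 * (v / 2) / 2"
  have "\<forall>\<^sub>F n in sequentially. (B n)\<^sup>2 * LL n / W n < b2"
    using order_tendstoD(2)[OF BW, of b2] d2 v unfolding LL_def b2_def by simp
  note e1 = eventually_compose_filterlim[OF this N1lim]
  note e2 = eventually_compose_filterlim[OF Vev N1lim]
  note e2' = eventually_compose_filterlim[OF Vev Nlim]
  note e3 = eventually_compose_filterlim[OF LLpos Nlim]
  note e3' = eventually_compose_filterlim[OF LLpos N1lim]
  have WN: "W (N k) \<le> d\<^sup>2 * W (N (Suc k))" if "n0 \<le> N k" for k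
  proof -
    have "real (N (Suc k)) / real (N k) = real \<rho>" using rho by (simp add: N_def)
    then have "real \<rho> powr g1 * W (N k) \<le> W (N (Suc k))" using Wlo[OF that N1(2)] by metis
    then have "W (N k) \<le> real \<rho> powr (- g1) * W (N (Suc k))" using rho by (simp add: powr_minus field_simps)
    also have "\<dots> \<le> d\<^sup>2 * W (N (Suc k))" using rhod Wpos[OF order_trans[OF that N1(2)]] by (intro mult_right_mono) auto
    finally show ?thesis .
  qed
  \<comment> \<open>The block variance is a difference of totals: at least the fraction
    \<open>1 - d^2\<close> at the end, minus at most \<open>(1 + d^2) * d^2 \<le> 2 * d^2\<close> at
    the start.\<close>
  have Vbge: "\<forall>\<^sub>F k in sequentially. (1 - 3 * d\<^sup>2) * (v * W (N (Suc k))) \<le> Vb k"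
    using e2 e2' e3
  proof eventually_elim
    case (elim k)
    have W: "0 < W (N k)" "0 < W (N (Suc k))" using Wpos elim N1(2)[of k] by auto
    have "Vb k = V (N (Suc k)) - V (N k)" unfolding V_def Vb_def using split[of "\<lambda>i. expectation (\<lambda>\<omega>. (Z i \<omega>)\<^sup>2)" k] by simp
    moreover have "(1 - d\<^sup>2) * v * W (N (Suc k)) \<le> V (N (Suc k))" using elim W by (simp add: field_simps)
    moreover have "V (N k) \<le> (1 + d\<^sup>2) * v * W (N k)" using elim W by (simp add: field_simps)
    moreover have "(1 + d\<^sup>2) * v * W (N k) \<le> (1 + d\<^sup>2) * v * (d\<^sup>2 * W (N (Suc k)))"
      using WN[of k] elim v d2 by (intro mult_left_mono) auto
    moreover have "(1 + d\<^sup>2) * v * (d\<^sup>2 * W (N (Suc k))) \<le> 2 * v * (d\<^sup>2 * W (N (Suc k)))"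
      using d d2 v W by (intro mult_right_mono) auto
    ultimately show ?case by (simp add: algebra_simps)
  qed
  have d3: "1 / 2 \<le> 1 - 3 * d\<^sup>2" "0 < 1 - 4 * d" using d d2 by auto
  have main: "\<forall>\<^sub>F k in sequentially. exp (- LL (N (Suc k))) \<le> prob {\<omega> \<in> space M. (1 - d) * t k * Vb k < X k \<omega>}"
    using e1 e3 e3' Vbge
  proof eventually_elim
    case (elim k)
    let ?m = "N (Suc k)"
    have W: "0 < W ?m" using Wpos elim by auto
    have "1 / 2 * (v * W ?m) \<le> (1 - 3 * d\<^sup>2) * (v * W ?m)"
      by (rule mult_right_mono[OF d3(1)]) (use v W in auto)
    also note elim(4)
    finally have Vbh: "v / 2 * W ?m \<le> Vb k" by simp
    have vb0: "0 < v / 2 * W ?m" using v W by simp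
    then have Vb0: "0 < Vb k" using Vbh by linarith
    have L0: "0 < LL ?m" using elim by auto
    have t2: "(t k)\<^sup>2 = 2 * (1 - 4 * d) * LL ?m / Vb k" using d3 L0 Vb0 by (simp add: t_def)
    have tV: "(t k)\<^sup>2 * Vb k = 2 * (1 - 4 * d) * LL ?m" using t2 Vb0 by simp
    have t0: "0 < t k" using d3 L0 Vb0 by (simp add: t_def)
    have tB: "2 * t k * B ?m \<le> d\<^sup>2 / 12"
    proof -
      have "t k * B ?m \<le> d\<^sup>2 / 24"
      proof (rule power2_le_imp_le)
        have "(t k * B ?m)\<^sup>2 = (1 - 4 * d) * (2 * (LL ?m * (B ?m)\<^sup>2) / Vb k)" by (simp add: power_mult_distrib t2)
        also have "\<dots> \<le> 1 * (2 * (LL ?m * (B ?m)\<^sup>2) / Vb k)" using d L0 Vb0 by (intro mult_right_mono) auto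
        also have "\<dots> \<le> 2 * (LL ?m * (B ?m)\<^sup>2) / (v / 2 * W ?m)"
          unfolding mult_1 using Vbh L0 vb0 by (intro divide_left_mono) auto
        also have "\<dots> = 2 / (v / 2) * ((B ?m)\<^sup>2 * LL ?m / W ?m)" using v W by (simp add: field_simps)
        also have "\<dots> \<le> 2 / (v / 2) * b2" using elim v by (intro mult_left_mono) auto
        also have "\<dots> = (d\<^sup>2 / 24)\<^sup>2" using v by (simp add: b2_def)
        finally show "(t k * B ?m)\<^sup>2 \<le> (d\<^sup>2 / 24)\<^sup>2" .
      qed simp
      then show ?thesis by simp
    qed
    have "exp (- LL ?m) \<le> exp (- (1 + 4 * d) * ((t k)\<^sup>2 * Vb k) / 2)"
    proof -
      have "(1 + 4 * d) * (1 - 4 * d) \<le> 1" by (simp add: algebra_simps)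
      then have "(1 + 4 * d) * (1 - 4 * d) * LL ?m \<le> 1 * LL ?m" using L0 by (intro mult_right_mono) auto
      moreover have "- (1 + 4 * d) * (2 * (1 - 4 * d) * LL ?m) / 2 = - ((1 + 4 * d) * (1 - 4 * d) * LL ?m)"
        by (simp add: algebra_simps diff_divide_distrib)
      ultimately show ?thesis unfolding tV by simp
    qed
    also have "\<dots> \<le> prob {\<omega> \<in> space M. (1 - d) * t k * Vb k < (\<Sum>i\<in>I k. Z i \<omega>)}"
    proof (rule lower_tail[where b="B ?m"])
      show "indep_vars (\<lambda>_. borel) Z (I k)" by (rule indep_vars_subset[OF ind]) (auto simp: I_def)
      show "\<bar>Z i \<omega>\<bar> \<le> B ?m" if "i \<in> I k" "\<omega> \<in> space M" for i \<omega>
        using that by (intro bd) (auto simp: I_def)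
      have "8 < LL ?m * (2 * d\<^sup>2 * (1 - 4 * d))" using elim d2 d3 by (simp add: divide_less_eq)
      then show "8 \<le> d\<^sup>2 * ((t k)\<^sup>2 * Vb k)" unfolding tV by (simp add: algebra_simps)
    qed (use d t0 B0 tB z in \<open>auto simp: I_def Vb_def\<close>)
    finally show ?case by (simp add: X_def)
  qed
  have indX: "indep_vars (\<lambda>_. borel) X UNIV"
  proof -
    have disj: "disjoint_family_on I UNIV"
      unfolding disjoint_family_on_def
    proof (intro ballI impI)
      have *: "I i \<inter> I j = {}" if "i < j" for i j
      proof -
        have "N (Suc i) \<le> N j" unfolding N_def using rho that by (intro power_increasing) auto
        then show ?thesis by (auto simp: I_def)
      qed
      fix i j :: nat assume "i \<noteq> j"
      then show "I i \<inter> I j = {}" using *[of i j] *[of j i] by (cases i j rule: linorder_cases) auto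
    qed
    have "indep_vars (\<lambda>k. PiM (I k) (\<lambda>_. borel)) (\<lambda>k \<omega>. restrict (\<lambda>i. Z i \<omega>) (I k)) UNIV"
      by (rule indep_vars_restrict[OF ind _ disj]) (auto simp: I_def)
    moreover have "(\<lambda>z :: nat \<Rightarrow> real. \<Sum>i\<in>I k. 1 * z i) \<in> borel_measurable (PiM (I k) (\<lambda>_. borel))" for k
      by (intro borel_measurable_sum borel_measurable_times borel_measurable_const measurable_component_singleton)
    ultimately have "indep_vars (\<lambda>_. borel) (\<lambda>k \<omega>. \<Sum>i\<in>I k. 1 * restrict (\<lambda>i. Z i \<omega>) (I k) i) UNIV"
      by (rule indep_vars_compose2)
    then show ?thesis by (simp add: X_def[abs_def] cong: sum.cong)
  qed
  have "\<not> summable (\<lambda>k. prob {\<omega> \<in> space M. X k \<omega> \<in> {(1 - d) * t k * Vb k<..}})"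
  proof
    assume "summable (\<lambda>k. prob {\<omega> \<in> space M. X k \<omega> \<in> {(1 - d) * t k * Vb k<..}})"
    then have "summable (\<lambda>k. exp (- LL (N (Suc k))))"
      by (rule summable_comparison_test_ev[rotated]) (use main in simp)
    \<comment> \<open>At the index \<open>\<rho> ^ Suc k\<close> the lower bound is a constant
      multiple of \<open>1 / (k + 1)\<close>, so the probabilities diverge like the harmonic
      series.\<close>
    moreover have "exp (- LL (N (Suc k))) = inverse (ln (real \<rho>)) * inverse (real (Suc k))" for k
    proof -
      have "ln (real (N (Suc k))) = real (Suc k) * ln (real \<rho>)" using rho unfolding N_def by (simp add: ln_mult ln_realpow algebra_simps)
      moreover have "0 < real (Suc k) * ln (real \<rho>)" using rho by simp
      ultimately show ?thesis by (simp add: LL_def exp_minus)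
    qed
    ultimately have "summable (\<lambda>k. inverse (real (Suc k)))" using rho by (simp add: summable_cmult_iff)
    then show False using not_summable_harmonic[where 'a=real] summable_Suc_iff[of "\<lambda>n. inverse (real n)"] by blast
  qed
  then have io: "AE \<omega> in M. \<exists>\<^sub>F k in sequentially. X k \<omega> \<in> {(1 - d) * t k * Vb k<..}"
    by (intro borel_cantelli_2[OF indX]) auto
  \<comment> \<open>Crude constants suffice for the sum before the block, because its scale is
    smaller by the factor \<open>d\<close>.\<close>
  have neg: "AE \<omega> in M. \<forall>\<^sub>F n in sequentially. (\<Sum>i=1..n. - Z i \<omega>) \<le> (1 + 1) * sqrt (2 * v) * lil_scale W n"
  proof (rule lil_upper[where B=B and ?n0.0=n0 and W=W and g=g])
    show "indep_vars (\<lambda>_. borel) (\<lambda>i \<omega>. - Z i \<omega>) {1..}" by (rule indep_vars_compose2[OF ind]) auto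
    have "\<forall>\<^sub>F n in sequentially. (1 - d\<^sup>2) * v < V n / W n \<and> V n / W n < (1 + d\<^sup>2) * v \<and> n0 \<le> n"
      using Vev eventually_ge_at_top[of n0] by eventually_elim auto
    then show "\<forall>\<^sub>F n in sequentially. (\<Sum>i=1..n. expectation (\<lambda>\<omega>. (- Z i \<omega>)\<^sup>2)) \<le> (2 * v) * W n"
    proof eventually_elim
      case (elim n)
      have "V n \<le> (1 + d\<^sup>2) * v * W n" using elim Wpos[of n] by (simp add: field_simps)
      also have "\<dots> \<le> 2 * v * W n" using d d2 v Wpos[of n] elim by (intro mult_right_mono) auto
      finally show ?case by (simp add: V_def)
    qed
  qed (use bd B0 z n0 Wpos Wmono Wup BW v g in auto)
  show ?thesis
    using io neg
  proof eventually_elim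
    case (elim \<omega>)
    note e4 = eventually_compose_filterlim[OF elim(2) Nlim]
    from e4 Vbge e3 have "\<forall>\<^sub>F k in sequentially. X k \<omega> \<in> {(1 - d) * t k * Vb k<..} \<longrightarrow>
      (1 - \<epsilon>) * sqrt v * lil_scale W (N (Suc k)) < (\<Sum>i=1..N (Suc k). Z i \<omega>)"
    proof (eventually_elim, intro impI)
      fix k
      let ?m = "N (Suc k)"
      assume 1: "X k \<omega> \<in> {(1 - d) * t k * Vb k<..}"
        and 2: "(\<Sum>i=1..N k. - Z i \<omega>) \<le> (1 + 1) * sqrt (2 * v) * lil_scale W (N k)"
        and 3: "(1 - 3 * d\<^sup>2) * (v * W ?m) \<le> Vb k"
        and e: "8 / (2 * d\<^sup>2 * (1 - 4 * d)) < LL (N k) \<and> 0 < LL (N k) \<and> 1 < ln (real (N k)) \<and> n0 \<le> N k"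
      have 4: "0 < LL (N k)" "1 < ln (real (N k))" "n0 \<le> N k" using e by auto
      have W: "0 < W (N k)" "0 < W ?m" using Wpos 4 N1(2)[of k] by auto
      have LLm: "LL (N k) \<le> LL ?m" using LLmono[OF 4(2) N1(2)] N1(1) by simp
      define s where "s = sqrt v * lil_scale W ?m"
      have s2: "s = sqrt (v * (2 * W ?m * LL ?m))" by (simp add: s_def lil_scale_def LL_def real_sqrt_mult)
      have s0: "0 \<le> s" unfolding s2 using v(1) W 4(1) LLm by (intro real_sqrt_ge_zero mult_nonneg_nonneg) auto
      have "0 < (1 - 3 * d\<^sup>2) * (v * W ?m)" using d3(1) v(1) W(2) by (intro mult_pos_pos) linarith+
      then have Vb0: "0 < Vb k" using 3 by linarith
      have "(1 - 8 * d) * s \<le> (1 - d) * t k * Vb k"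
      proof -
        have "t k * Vb k = sqrt (2 * (1 - 4 * d) * LL ?m / Vb k * (Vb k * Vb k))"
          unfolding t_def real_sqrt_mult[of _ "Vb k * Vb k"] using Vb0 by simp
        also have "\<dots> = sqrt ((1 - 4 * d) * (2 * LL ?m * Vb k))" using Vb0 by (simp add: field_simps)
        also have "\<dots> \<ge> sqrt ((1 - 4 * d) * (2 * LL ?m * ((1 - 3 * d\<^sup>2) * (v * W ?m))))"
          using 3 4 LLm d3 by (intro real_sqrt_le_mono mult_left_mono) auto
        also have "sqrt ((1 - 4 * d) * (2 * LL ?m * ((1 - 3 * d\<^sup>2) * (v * W ?m)))) = sqrt ((1 - 4 * d) * (1 - 3 * d\<^sup>2)) * s"
          unfolding s2 real_sqrt_mult[symmetric] by (simp add: mult_ac)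
        finally have A: "sqrt ((1 - 4 * d) * (1 - 3 * d\<^sup>2)) * s \<le> t k * Vb k" .
        \<comment> \<open>The product lies in \<open>[0, 1]\<close>, so its square root is at least
          the product itself. Multiplying \<open>1 - 7 * d\<close> by the factor
          \<open>1 - d\<close> of the tail bound gives at least \<open>1 - 8 * d\<close>.\<close>
        have "1 - 7 * d \<le> (1 - 4 * d) * (1 - 3 * d\<^sup>2)"
        proof -
          have "(1 - 4 * d) * (1 - 3 * d\<^sup>2) = 1 - 4 * d - 3 * d\<^sup>2 + 12 * (d * d\<^sup>2)" by (simp add: algebra_simps)
          moreover have "0 \<le> d * d\<^sup>2" using d by simp
          ultimately show ?thesis using d2 by linarith
        qed
        also have "\<dots> \<le> sqrt ((1 - 4 * d) * (1 - 3 * d\<^sup>2))"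
        proof (rule real_le_rsqrt)
          let ?u = "(1 - 4 * d) * (1 - 3 * d\<^sup>2)"
          have "0 \<le> 1 - 4 * d" "1 - 4 * d \<le> 1" "0 \<le> 1 - 3 * d\<^sup>2" "1 - 3 * d\<^sup>2 \<le> 1"
            using d d2 by linarith+
          then have u: "0 \<le> ?u" "?u \<le> 1" by (simp_all add: mult_le_one)
          then show "?u\<^sup>2 \<le> ?u" by (simp add: power2_eq_square mult_left_le_one_le)
        qed
        finally have "(1 - 7 * d) * s \<le> t k * Vb k" using A s0 by (meson mult_right_mono order_trans)
        then have "(1 - d) * ((1 - 7 * d) * s) \<le> (1 - d) * (t k * Vb k)" using d by (intro mult_left_mono) auto
        moreover have "(1 - 8 * d) * s \<le> (1 - d) * (1 - 7 * d) * s" using s0 d by (intro mult_right_mono) (auto simp: algebra_simps)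
        ultimately show ?thesis by (simp add: mult.assoc)
      qed
      \<comment> \<open>The ratio \<open>d^2\<close> of the values of \<open>W\<close> becomes
        \<open>d\<close> under the root; \<open>sqrt 2 \<le> 2\<close> and the factor
        \<open>1 + 1\<close> turn it into \<open>4 * d\<close>.\<close>
      moreover have "(1 + 1) * sqrt (2 * v) * lil_scale W (N k) \<le> 4 * d * s"
      proof -
        have "sqrt (2 * v) * lil_scale W (N k) = sqrt (2 * v * (2 * W (N k) * LL (N k)))"
          by (simp add: lil_scale_def LL_def real_sqrt_mult)
        also have "\<dots> \<le> sqrt (2 * v * (2 * (d\<^sup>2 * W ?m) * LL ?m))"
          using WN[OF 4(3)] LLm 4 v W d2 by (intro real_sqrt_le_mono mult_left_mono mult_mono) auto
        also have "\<dots> \<le> sqrt ((2 * d)\<^sup>2 * (v * (2 * W ?m * LL ?m)))"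
          using v W LLm 4 by (intro real_sqrt_le_mono) (simp add: power_mult_distrib)
        also have "\<dots> = 2 * d * s" unfolding s2 real_sqrt_mult[of "(2 * d)\<^sup>2"] using d by (simp only: real_sqrt_abs abs_of_nonneg)
        finally show ?thesis by (simp add: mult_ac)
      qed
      moreover have "(\<Sum>i=1..?m. Z i \<omega>) = (\<Sum>i=1..N k. Z i \<omega>) + X k \<omega>" unfolding X_def by (rule split)
      moreover have "(1 - \<epsilon>) * s = (1 - 8 * d) * s - 4 * d * s" by (simp add: d_def algebra_simps)
      ultimately have "(1 - \<epsilon>) * s < (\<Sum>i=1..?m. Z i \<omega>)" using 1 2 unfolding sum_negf greaterThan_iff by linarith
      then show "(1 - \<epsilon>) * sqrt v * lil_scale W ?m < (\<Sum>i=1..?m. Z i \<omega>)" by (simp add: s_def)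
    qed
    with elim(1) have "\<exists>\<^sub>F k in sequentially. (1 - \<epsilon>) * sqrt v * lil_scale W (N (Suc k)) < (\<Sum>i=1..N (Suc k). Z i \<omega>)"
      by (rule frequently_rev_mp)
    then show ?case
      unfolding frequently_def using eventually_compose_filterlim[OF _ N1lim] by blast
  qed
qed

section \<open>Sums with regularly varying growth\<close>

text \<open>Toeplitz averaging: from \<open>k\<close> on, the terms are within \<open>e / 2\<close>
  of \<open>s\<close> relative to their weights, and the fixed error \<open>C\<close> of the first
  \<open>k\<close> terms is outweighed because the total weight diverges.\<close>

lemma weighted_cesaro:
  fixes a w :: "nat \<Rightarrow> real"
  assumes w: "\<And>i. 1 \<le> i \<Longrightarrow> 0 < w i"
    and W: "filterlim (\<lambda>n. \<Sum>i=1..n. w i) at_top sequentially"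
    and a: "(\<lambda>i. a i / w i) \<longlonglongrightarrow> s"
  shows "(\<lambda>n. (\<Sum>i=1..n. a i) / (\<Sum>i=1..n. w i)) \<longlonglongrightarrow> s"
proof (rule LIMSEQ_I)
  fix e :: real assume e: "0 < e"
  obtain k where k: "\<And>i. k \<le> i \<Longrightarrow> \<bar>a i / w i - s\<bar> < e / 2"
    using LIMSEQ_D[OF a, of "e/2"] e by auto
  define C where "C = (\<Sum>i=1..k. \<bar>a i - s * w i\<bar>)"
  have bound: "\<bar>(\<Sum>i=1..n. a i) - s * (\<Sum>i=1..n. w i)\<bar> \<le> C + e / 2 * (\<Sum>i=1..n. w i)" for n
  proof -
    have "\<bar>(\<Sum>i=1..n. a i) - s * (\<Sum>i=1..n. w i)\<bar> = \<bar>\<Sum>i=1..n. a i - s * w i\<bar>"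
      by (simp add: sum_subtractf sum_distrib_left)
    also have "\<dots> \<le> (\<Sum>i=1..n. \<bar>a i - s * w i\<bar>)" by (rule sum_abs)
    also have "\<dots> \<le> (\<Sum>i=1..n. (if i \<le> k then \<bar>a i - s * w i\<bar> else 0) + e / 2 * w i)"
    proof (rule sum_mono)
      fix i assume i: "i \<in> {1..n}"
      then have wi: "0 < w i" using w by auto
      show "\<bar>a i - s * w i\<bar> \<le> (if i \<le> k then \<bar>a i - s * w i\<bar> else 0) + e / 2 * w i"
      proof (cases "i \<le> k")
        case False
        have "\<bar>a i - s * w i\<bar> = \<bar>a i / w i - s\<bar> * w i" using wi by (simp add: abs_mult[of _ "w i", symmetric, unfolded abs_of_pos[OF wi]] left_diff_distrib)
        also have "\<dots> \<le> e / 2 * w i" using k[of i] False wi by (intro mult_right_mono) auto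
        finally show ?thesis using False by simp
      qed (use e wi in simp)
    qed
    also have "\<dots> = (\<Sum>i=1..n. (if i \<le> k then \<bar>a i - s * w i\<bar> else 0)) + e / 2 * (\<Sum>i=1..n. w i)"
      by (simp add: sum.distrib sum_distrib_left)
    also have "(\<Sum>i=1..n. (if i \<le> k then \<bar>a i - s * w i\<bar> else 0)) = (\<Sum>i\<in>{1..n} \<inter> {..k}. \<bar>a i - s * w i\<bar>)"
      by (simp add: sum.inter_restrict atMost_def)
    also have "\<dots> \<le> C" unfolding C_def by (intro sum_mono2) auto
    finally show ?thesis by simp
  qed
  have "\<forall>\<^sub>F n in sequentially. 2 * C / e + 1 \<le> (\<Sum>i=1..n. w i)" using W by (simp add: filterlim_at_top)
  then obtain m where m: "\<And>n. m \<le> n \<Longrightarrow> 2 * C / e + 1 \<le> (\<Sum>i=1..n. w i)" unfolding eventually_sequentially by blast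
  show "\<exists>m. \<forall>n\<ge>m. norm ((\<Sum>i=1..n. a i) / (\<Sum>i=1..n. w i) - s) < e"
  proof (intro exI allI impI)
    fix n assume n: "m \<le> n"
    define S where "S = (\<Sum>i=1..n. w i)"
    have C0: "0 \<le> C" unfolding C_def by (intro sum_nonneg) auto
    have "0 \<le> 2 * C / e" using C0 e by simp
    then have S: "0 < S" "2 * C / e < S" using m[OF n] unfolding S_def by linarith+
    then have "C < e / 2 * S" using e by (simp add: field_simps)
    then have "\<bar>(\<Sum>i=1..n. a i) - s * S\<bar> < e * S" using bound[of n] unfolding S_def by (simp add: field_simps)
    moreover have "(\<Sum>i=1..n. a i) / S - s = ((\<Sum>i=1..n. a i) - s * S) / S" using S by (simp add: field_simps)
    ultimately show "norm ((\<Sum>i=1..n. a i) / (\<Sum>i=1..n. w i) - s) < e" using S(1) unfolding S_def[symmetric]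
      by (simp add: pos_divide_less_eq)
  qed
qed

text \<open>The increments of two logarithms are compared and telescoped. It serves with a power of
  the index on either side.\<close>

lemma ratio_powr_le:
  fixes p q :: "nat \<Rightarrow> real"
  assumes pos: "\<And>n. n0 \<le> n \<Longrightarrow> 0 < p n \<and> 0 < q n"
    and step: "\<And>n. n0 \<le> n \<Longrightarrow> ln (p (Suc n)) - ln (p n) \<le> ln (q (Suc n)) - ln (q n)"
    and nm: "n0 \<le> n" "n \<le> m"
  shows "p m / p n \<le> q m / q n"
proof -
  have "ln (p m) - ln (p n) \<le> ln (q m) - ln (q n)"
    using nm(2)
  proof (induction m rule: dec_induct)
    case (step m)
    then show ?case using assms(2)[of m] nm by simp
  qed simp
  moreover have "0 < p m" "0 < p n" "0 < q m" "0 < q n" using pos[of m] pos[of n] nm by auto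
  ultimately have "ln (p m / p n) \<le> ln (q m / q n)" by (simp add: ln_div)
  then show ?thesis using \<open>0 < p m\<close> \<open>0 < p n\<close> \<open>0 < q m\<close> \<open>0 < q n\<close> by (subst (asm) ln_le_cancel_iff) auto
qed

text \<open>A discrete form of Karamata's theorem. With \<open>x n = w (Suc n) / W (Suc n)\<close>
  the increment of \<open>ln W\<close> is \<open>- ln (1 - x n)\<close>, asymptotic to
  \<open>\<gamma> / n\<close>, while the increment of \<open>ln n\<close> is asymptotic to
  \<open>1 / n\<close>. The factors 1/2 and 2 on \<open>\<gamma>\<close> absorb the errors.\<close>

lemma regular_variation_bounds:
  fixes w W :: "nat \<Rightarrow> real"
  assumes w: "\<And>i. 1 \<le> i \<Longrightarrow> 0 < w i" and W_def: "W = (\<lambda>n. \<Sum>i=1..n. w i)"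
    and lim: "(\<lambda>n. real n * w n / W n) \<longlonglongrightarrow> \<gamma>" and gam: "0 < \<gamma>"
  shows "\<exists>n0\<ge>1. \<forall>n\<ge>n0. \<forall>m\<ge>n. (real m / real n) powr (\<gamma> / 2) * W n \<le> W m \<and> W m \<le> (real m / real n) powr (2 * \<gamma>) * W n"
proof -
  have Wpos: "0 < W n" if "1 \<le> n" for n unfolding W_def using that w by (intro sum_pos) auto
  define x where "x = (\<lambda>n. w (Suc n) / W (Suc n))"
  have l1: "(\<lambda>n. real (Suc n) * x n) \<longlonglongrightarrow> \<gamma>"
    using LIMSEQ_Suc[OF lim] by (simp add: x_def)
  have "(\<lambda>n. (real (Suc n) * x n) * (1 / real (Suc n))) \<longlonglongrightarrow> \<gamma> * 0"
    by (intro tendsto_mult l1) real_asymp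
  then have l2: "x \<longlonglongrightarrow> 0" by simp
  \<comment> \<open>\<open>x n\<close> and \<open>x n / (1 - x n)\<close> enclose
    \<open>- ln (1 - x n)\<close>. They are compared with \<open>1 / n\<close> and
    \<open>1 / (n + 1)\<close> respectively, which enclose the increment of \<open>ln n\<close> from
    above and below.\<close>
  have "(\<lambda>n. (real (Suc n) * x n) * (real n / real (Suc n))) \<longlonglongrightarrow> \<gamma> * 1"
    by (intro tendsto_mult l1) real_asymp
  then have l3: "(\<lambda>n. x n * real n) \<longlonglongrightarrow> \<gamma>" by (simp add: mult_ac)
  have "(\<lambda>n. (real (Suc n) * x n) / (1 - x n)) \<longlonglongrightarrow> \<gamma> / (1 - 0)"
    by (intro tendsto_divide l1 tendsto_diff tendsto_const l2) simp
  then have l4: "(\<lambda>n. (real (Suc n) * x n) / (1 - x n)) \<longlonglongrightarrow> \<gamma>" by simp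
  have "\<forall>\<^sub>F n in sequentially. \<gamma> / 2 < x n * real n \<and> (real (Suc n) * x n) / (1 - x n) < 2 * \<gamma> \<and> 1 \<le> n"
    using order_tendstoD(1)[OF l3, of "\<gamma>/2"] order_tendstoD(2)[OF l4, of "2*\<gamma>"] gam eventually_ge_at_top[of 1]
    by (auto simp: eventually_conj_iff)
  then obtain n0 where n0: "\<And>n. n0 \<le> n \<Longrightarrow> \<gamma> / 2 < x n * real n \<and> (real (Suc n) * x n) / (1 - x n) < 2 * \<gamma> \<and> 1 \<le> n"
    unfolding eventually_sequentially by blast
  have n01: "1 \<le> n0" using n0[of n0] by simp
  have step: "\<gamma> / 2 * (ln (Suc n) - ln n) \<le> ln (W (Suc n)) - ln (W n)"
    "ln (W (Suc n)) - ln (W n) \<le> 2 * \<gamma> * (ln (Suc n) - ln n)" if n: "n0 \<le> n" for n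
  proof -
    have n1: "1 \<le> n" using n0[OF n] by simp
    have W: "0 < W n" "0 < W (Suc n)" "0 < w (Suc n)" using Wpos n1 w by auto
    have WS: "W (Suc n) = W n + w (Suc n)" by (simp add: W_def)
    have x: "0 < x n" "x n < 1" "1 - x n = W n / W (Suc n)" using W WS by (auto simp: x_def field_simps)
    have D: "ln (W (Suc n)) - ln (W n) = - ln (1 - x n)" using W x(3) by (simp add: ln_div)
    have "1 + 1 / real n = real (Suc n) / real n" using n1 by (simp add: field_simps)
    then have 1: "ln (Suc n) - ln n = ln (1 + 1 / real n)" using n1 by (simp add: ln_div)
    have "ln (1 + 1 / real n) \<le> 1 / real n" by (rule ln_add_one_self_le_self) simp
    then have "\<gamma> / 2 * (ln (Suc n) - ln n) \<le> \<gamma> / 2 * (1 / real n)" unfolding 1 using gam by (intro mult_left_mono) auto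
    also have "\<dots> \<le> x n" using n0[OF n] by (simp add: field_simps)
    also have "\<dots> \<le> - ln (1 - x n)" using ln_le_minus_one[of "1 - x n"] x by simp
    finally show "\<gamma> / 2 * (ln (Suc n) - ln n) \<le> ln (W (Suc n)) - ln (W n)" using D by simp
    have "- ln (1 - x n) = ln (1 / (1 - x n))" using x(2) by (simp add: ln_div)
    also have "\<dots> \<le> 1 / (1 - x n) - 1" using x(2) by (intro ln_le_minus_one) simp
    also have "\<dots> = x n / (1 - x n)" using x(2) by (simp add: field_simps)
    also have "\<dots> \<le> 2 * \<gamma> * (1 / real (Suc n))" using n0[OF n] by (simp add: field_simps)
    also have "\<dots> \<le> 2 * \<gamma> * (ln (Suc n) - ln n)"
    proof -
      have "ln n - ln (Suc n) = ln (real n / real (Suc n))" using n1 by (simp add: ln_div)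
      also have "\<dots> \<le> real n / real (Suc n) - 1" using n1 by (intro ln_le_minus_one) simp
      also have "\<dots> = - (1 / real (Suc n))" by (simp add: field_simps)
      finally show ?thesis using gam by (intro mult_left_mono) auto
    qed
    finally show "ln (W (Suc n)) - ln (W n) \<le> 2 * \<gamma> * (ln (Suc n) - ln n)" using D by simp
  qed
  have "(real m / real n) powr (\<gamma> / 2) * W n \<le> W m \<and> W m \<le> (real m / real n) powr (2 * \<gamma>) * W n"
    if nm: "n0 \<le> n" "n \<le> m" for n m
  proof -
    have W: "0 < W n" "0 < W m" "0 < n" using Wpos n01 nm by auto
    have "real m powr (\<gamma> / 2) / real n powr (\<gamma> / 2) \<le> W m / W n"
      by (rule ratio_powr_le[where p="\<lambda>n. real n powr (\<gamma> / 2)" and ?n0.0=n0])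
         (use n01 Wpos nm step(1) in \<open>auto simp: ln_powr algebra_simps\<close>)
    moreover have "W m / W n \<le> real m powr (2 * \<gamma>) / real n powr (2 * \<gamma>)"
      by (rule ratio_powr_le[where q="\<lambda>n. real n powr (2 * \<gamma>)" and ?n0.0=n0])
         (use n01 Wpos nm step(2) in \<open>auto simp: ln_powr algebra_simps\<close>)
    ultimately show ?thesis using W by (simp add: powr_divide field_simps)
  qed
  then show ?thesis using n01 by blast
qed

section \<open>Kernel expectations\<close>

text \<open>The integral over \<open>{u..1}\<close> is written over \<open>{0..1}\<close> with the
  factor \<open>u \<le> s\<close>, so that \<open>u\<close> occurs only in an indicator and Fubini's
  theorem can be applied to a random \<open>u\<close>.\<close>

lemma unit_deriv_FTC:
  fixes G :: "real \<Rightarrow> real"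
  assumes d: "G differentiable_on {0..1}" and i: "set_integrable lborel {0..1} (unit_deriv G)" and u: "u \<in> {0..1}"
  shows "G u = G 1 - (\<integral>s. indicator {0..1} s * unit_deriv G s * of_bool (u \<le> s) \<partial>lborel)"
proof -
  have "(unit_deriv G has_integral (G 1 - G u)) {u..1}"
  proof (rule fundamental_theorem_of_calculus)
    fix s assume s: "s \<in> {u..1}"
    then have "(G has_vector_derivative unit_deriv G s) (at s within {0..1})"
      using d u unfolding differentiable_on_def by (subst vector_derivative_works[symmetric]) auto
    then show "(G has_vector_derivative unit_deriv G s) (at s within {u..1})"
      by (rule has_vector_derivative_within_subset) (use u in auto)
  qed (use u in simp)
  moreover have "set_integrable lborel {u..1} (unit_deriv G)"
    using u by (intro set_integrable_subset[OF i]) auto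
  then have "(unit_deriv G has_integral (LINT s:{u..1}|lborel. unit_deriv G s)) {u..1}"
    using set_borel_integral_eq_integral by (metis has_integral_integral)
  ultimately have "G 1 - G u = (LINT s:{u..1}|lborel. unit_deriv G s)" by (rule has_integral_unique)
  also have "\<dots> = (\<integral>s. indicator {0..1} s * unit_deriv G s * of_bool (u \<le> s) \<partial>lborel)"
    unfolding set_lebesgue_integral_def using u by (intro Bochner_Integration.integral_cong) (auto simp: indicator_def)
  finally show ?thesis by simp
qed

lemma (in prob_space) expectation_of_bool:
  assumes "{\<omega> \<in> space M. P \<omega>} \<in> sets M"
  shows "expectation (\<lambda>\<omega>. of_bool (P \<omega>)) = prob {\<omega> \<in> space M. P \<omega>}"
    and "integrable M (\<lambda>\<omega>. of_bool (P \<omega>) :: real)"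
proof -
  have eq: "of_bool (P \<omega>) = (indicator {\<omega> \<in> space M. P \<omega>} \<omega> :: real)" if "\<omega> \<in> space M" for \<omega>
    using that by (simp add: indicator_def)
  have "expectation (\<lambda>\<omega>. of_bool (P \<omega>)) = expectation (indicator {\<omega> \<in> space M. P \<omega>})"
    by (rule Bochner_Integration.integral_cong) (auto simp: eq)
  also have "\<dots> = prob {\<omega> \<in> space M. P \<omega>}"
    unfolding Bochner_Integration.integral_indicator by (rule arg_cong[where f=prob]) auto
  finally show "expectation (\<lambda>\<omega>. of_bool (P \<omega>)) = prob {\<omega> \<in> space M. P \<omega>}" .
  have "integrable M (indicator {\<omega> \<in> space M. P \<omega>} :: 'a \<Rightarrow> real)"
    using assms by (simp add: emeasure_eq_measure)
  then show "integrable M (\<lambda>\<omega>. of_bool (P \<omega>) :: real)"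
    by (subst Bochner_Integration.integrable_cong[OF refl eq])
qed

text \<open>Integration by parts through Fubini's theorem: in the representation of
  \<open>G (T / h)\<close> the only random factor is the indicator of \<open>T \<le> h * s\<close>,
  whose expectation is \<open>F (h * s)\<close>.\<close>

lemma (in prob_space) kernel_expectation:
  fixes G :: "real \<Rightarrow> real" and T :: "'a \<Rightarrow> real"
  assumes d: "G differentiable_on {0..1}" and i: "set_integrable lborel {0..1} (unit_deriv G)"
    and T[measurable]: "T \<in> borel_measurable M" and T0: "\<And>\<omega>. \<omega> \<in> space M \<Longrightarrow> 0 \<le> T \<omega>" and h: "0 < h"
  defines "F \<equiv> \<lambda>t. prob {\<omega> \<in> space M. T \<omega> \<le> t}"
  shows "expectation (\<lambda>\<omega>. of_bool (T \<omega> \<le> h) * G (T \<omega> / h))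
      = G 1 * F h - (\<integral>s. indicator {0..1} s * unit_deriv G s * F (h * s) \<partial>lborel)"
proof -
  interpret P: pair_sigma_finite lborel M ..
  define g where "g = (\<lambda>s. indicator {0..1} s * unit_deriv G s)"
  have gi: "integrable lborel g" using i by (simp add: g_def set_integrable_def)
  then have gm[measurable]: "g \<in> borel_measurable borel" by auto
  define f where "f = (\<lambda>(s, \<omega>). g s * of_bool (T \<omega> \<le> h * s) :: real)"
  have fm[measurable]: "f \<in> borel_measurable (lborel \<Otimes>\<^sub>M M)" unfolding f_def by measurable
  have ob: "(\<integral>\<omega>. of_bool (T \<omega> \<le> t) \<partial>M) = F t" for t
    unfolding F_def by (rule expectation_of_bool(1)) measurable
  have Fb: "0 \<le> F t" "F t \<le> 1" for t by (auto simp: F_def)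
  have fi: "integrable (lborel \<Otimes>\<^sub>M M) f"
  proof (rule P.Fubini_integrable)
    have eq: "(\<lambda>s. \<integral>\<omega>. norm (f (s, \<omega>)) \<partial>M) = (\<lambda>s. \<bar>g s\<bar> * F (h * s))"
      by (simp add: f_def abs_mult ob)
    have "(\<lambda>s. \<integral>\<omega>. norm (f (s, \<omega>)) \<partial>M) \<in> borel_measurable lborel" by measurable
    then show "integrable lborel (\<lambda>s. \<integral>\<omega>. norm (f (s, \<omega>)) \<partial>M)"
      unfolding eq using Fb by (intro Bochner_Integration.integrable_bound[OF gi]) (auto simp: abs_mult mult_left_le)
    show "AE s in lborel. integrable M (\<lambda>\<omega>. f (s, \<omega>))"
    proof (rule AE_I2)
      fix s show "integrable M (\<lambda>\<omega>. f (s, \<omega>))"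
        by (rule integrable_bounded[where b="\<bar>g s\<bar>"]) (auto simp: f_def abs_mult)
    qed
  qed simp
  have sw: "(\<integral>\<omega>. (\<integral>s. g s * of_bool (T \<omega> \<le> h * s) \<partial>lborel) \<partial>M) = (\<integral>s. g s * F (h * s) \<partial>lborel)"
    using P.Fubini_integral[of "\<lambda>s \<omega>. g s * of_bool (T \<omega> \<le> h * s)"] fi by (simp add: f_def ob)
  have ii: "integrable M (\<lambda>\<omega>. \<integral>s. g s * of_bool (T \<omega> \<le> h * s) \<partial>lborel)"
    using P.integrable_snd[of "\<lambda>s \<omega>. g s * of_bool (T \<omega> \<le> h * s)"] fi by (simp add: f_def)
  have oi: "integrable M (\<lambda>\<omega>. of_bool (T \<omega> \<le> h) :: real)" by (rule integrable_bounded[where b=1]) auto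
  have "expectation (\<lambda>\<omega>. of_bool (T \<omega> \<le> h) * G (T \<omega> / h))
      = expectation (\<lambda>\<omega>. G 1 * of_bool (T \<omega> \<le> h) - (\<integral>s. g s * of_bool (T \<omega> \<le> h * s) \<partial>lborel))"
  proof (intro Bochner_Integration.integral_cong refl)
    fix \<omega> assume \<omega>: "\<omega> \<in> space M"
    show "of_bool (T \<omega> \<le> h) * G (T \<omega> / h) = G 1 * of_bool (T \<omega> \<le> h) - (\<integral>s. g s * of_bool (T \<omega> \<le> h * s) \<partial>lborel)"
    proof (cases "T \<omega> \<le> h")
      case True
      have "G (T \<omega> / h) = G 1 - (\<integral>s. indicator {0..1} s * unit_deriv G s * of_bool (T \<omega> / h \<le> s) \<partial>lborel)"
        using True h T0[OF \<omega>] by (intro unit_deriv_FTC[OF d i]) auto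
      then show ?thesis using True h by (simp add: g_def field_simps)
    next
      case False
      \<comment> \<open>For \<open>T > h\<close> both sides vanish, because
        \<open>h * s \<le> h\<close> on the unit interval.\<close>
      have "g s * of_bool (T \<omega> \<le> h * s) = 0" for s
      proof (cases "s \<in> {0..1}")
        case True
        then have "h * s \<le> h" using h by (simp add: mult_left_le)
        then show ?thesis using False by simp
      qed (auto simp: g_def)
      then have "(\<lambda>s. g s * of_bool (T \<omega> \<le> h * s)) = (\<lambda>s. 0)" by (intro ext)
      then show ?thesis using False by simp
    qed
  qed
  also have "\<dots> = G 1 * F h - (\<integral>s. g s * F (h * s) \<partial>lborel)"
    using ii oi by (simp add: ob sw)
  finally show ?thesis by (simp add: g_def mult.assoc)
qed

text \<open>Dominated convergence: for \<open>s \<le> 1\<close> monotonicity of \<open>F\<close>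
  gives \<open>F (h * s) / F h \<le> 1\<close>, so the derivative itself dominates. For
  \<open>G\<close> equal to \<open>K\<close> and to its square the limits are \<open>M1\<close> and
  \<open>M2\<close>.\<close>

lemma (in prob_space) kernel_ratio_limit:
  fixes G :: "real \<Rightarrow> real" and T :: "'a \<Rightarrow> real"
  assumes d: "G differentiable_on {0..1}" and i: "set_integrable lborel {0..1} (unit_deriv G)"
    and T[measurable]: "T \<in> borel_measurable M" and T0: "\<And>\<omega>. \<omega> \<in> space M \<Longrightarrow> 0 \<le> T \<omega>"
    and F_def: "F = (\<lambda>t. prob {\<omega> \<in> space M. T \<omega> \<le> t})"
    and Fpos: "\<And>t. 0 < t \<Longrightarrow> 0 < F t"
    and tau: "\<And>s. s \<in> {0..1} \<Longrightarrow> ((\<lambda>t. F (t * s) / F t) \<longlongrightarrow> \<tau>0 s) (at_right 0)"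
    and h: "\<And>n. 1 \<le> n \<Longrightarrow> 0 < h n" "h \<longlonglongrightarrow> (0::real)"
  shows "(\<lambda>n. expectation (\<lambda>\<omega>. of_bool (T \<omega> \<le> h n) * G (T \<omega> / h n)) / F (h n))
     \<longlonglongrightarrow> G 1 - (LINT s:{0..1}|lborel. unit_deriv G s * \<tau>0 s)"
proof -
  define g where "g = (\<lambda>s. indicator {0..1} s * unit_deriv G s)"
  have gi: "integrable lborel g" using i by (simp add: g_def set_integrable_def)
  then have gm[measurable]: "g \<in> borel_measurable borel" by auto
  have Fmono: "F s \<le> F t" if "s \<le> t" for s t unfolding F_def using that by (intro finite_measure_mono) auto
  have Fm[measurable]: "F \<in> borel_measurable borel"
    by (intro borel_measurable_mono monoI Fmono)
  \<comment> \<open>\<open>h\<close> is known to be positive from index 1 on, hence the shift by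
    \<open>Suc\<close>, undone at the end.\<close>
  have hlim: "filterlim (\<lambda>n. h (Suc n)) (at_right 0) sequentially"
    using LIMSEQ_Suc[OF h(2)] by (intro filterlim_at_withinI) (auto intro!: always_eventually h(1))
  have pt: "(\<lambda>n. g s * (F (h (Suc n) * s) / F (h (Suc n)))) \<longlonglongrightarrow> g s * \<tau>0 s" for s
  proof (cases "s \<in> {0..1}")
    case True
    show ?thesis by (intro tendsto_mult tendsto_const filterlim_compose[OF tau[OF True] hlim])
  qed (simp add: g_def)
  have "(\<lambda>n. \<integral>s. g s * (F (h (Suc n) * s) / F (h (Suc n))) \<partial>lborel) \<longlonglongrightarrow> (\<integral>s. g s * \<tau>0 s \<partial>lborel)"
  proof (rule integral_dominated_convergence[where w="\<lambda>s. \<bar>g s\<bar>"])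
    show "(\<lambda>s. g s * \<tau>0 s) \<in> borel_measurable lborel"
      by (rule borel_measurable_LIMSEQ_real[OF pt]) measurable
    show "AE s in lborel. norm (g s * (F (h (Suc n) * s) / F (h (Suc n)))) \<le> \<bar>g s\<bar>" for n
    proof (rule AE_I2)
      fix s
      have hn: "0 < h (Suc n)" using h by simp
      have "\<bar>F (h (Suc n) * s) / F (h (Suc n))\<bar> \<le> 1" if "s \<in> {0..1}"
      proof -
        have "F (h (Suc n) * s) \<le> F (h (Suc n))" using that hn by (intro Fmono) (simp add: mult_left_le)
        moreover have "0 \<le> F (h (Suc n) * s)" by (simp add: F_def)
        ultimately show ?thesis using Fpos[OF hn] by simp
      qed
      then show "norm (g s * (F (h (Suc n) * s) / F (h (Suc n)))) \<le> \<bar>g s\<bar>"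
        using mult_left_mono[of "\<bar>F (h (Suc n) * s) / F (h (Suc n))\<bar>" 1 "\<bar>g s\<bar>"]
        by (cases "s \<in> {0..1}") (simp_all only: real_norm_def abs_mult, simp_all add: g_def)
    qed
    show "integrable lborel (\<lambda>s. \<bar>g s\<bar>)" using gi by simp
  qed (use pt in auto)
  then have "(\<lambda>n. G 1 - (\<integral>s. g s * (F (h (Suc n) * s) / F (h (Suc n))) \<partial>lborel)) \<longlonglongrightarrow> G 1 - (\<integral>s. g s * \<tau>0 s \<partial>lborel)"
    by (intro tendsto_diff tendsto_const)
  also have "(\<lambda>n. G 1 - (\<integral>s. g s * (F (h (Suc n) * s) / F (h (Suc n))) \<partial>lborel))
    = (\<lambda>n. expectation (\<lambda>\<omega>. of_bool (T \<omega> \<le> h (Suc n)) * G (T \<omega> / h (Suc n))) / F (h (Suc n)))"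
  proof
    fix n
    have hn: "0 < h (Suc n)" using h by simp
    have "(\<integral>s. g s * (F (h (Suc n) * s) / F (h (Suc n))) \<partial>lborel) = (\<integral>s. g s * F (h (Suc n) * s) \<partial>lborel) / F (h (Suc n))"
      by simp
    then show "G 1 - (\<integral>s. g s * (F (h (Suc n) * s) / F (h (Suc n))) \<partial>lborel)
       = expectation (\<lambda>\<omega>. of_bool (T \<omega> \<le> h (Suc n)) * G (T \<omega> / h (Suc n))) / F (h (Suc n))"
      using kernel_expectation[OF d i T T0 hn] Fpos[OF hn]
      by (simp add: F_def g_def diff_divide_distrib)
  qed
  also have "(\<integral>s. g s * \<tau>0 s \<partial>lborel) = (LINT s:{0..1}|lborel. unit_deriv G s * \<tau>0 s)"
    by (simp add: set_lebesgue_integral_def g_def mult.assoc)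
  finally show ?thesis by (rule LIMSEQ_imp_Suc)
qed

section \<open>The law of the iterated logarithm for regularly growing variances\<close>

text \<open>The bounds are indexed by a natural number and not by a positive real, so that an almost
  sure statement for all of them involves only countably many null sets.\<close>

lemma limsup_eqI:
  fixes f u b :: "nat \<Rightarrow> real"
  assumes u: "\<And>k. \<forall>\<^sub>F n in sequentially. f n \<le> u k" "u \<longlonglongrightarrow> L"
    and b: "\<And>k. \<exists>\<^sub>F n in sequentially. b k \<le> f n" "b \<longlonglongrightarrow> L"
  shows "limsup (\<lambda>n. ereal (f n)) = ereal L"
proof (rule antisym)
  have "limsup (\<lambda>n. ereal (f n)) \<le> ereal (u k)" for k
    by (rule Limsup_bounded) (use u(1)[of k] in simp)
  then show "limsup (\<lambda>n. ereal (f n)) \<le> ereal L"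
    using u(2) by (intro LIMSEQ_le_const[of "\<lambda>k. ereal (u k)"]) auto
  have "ereal (b k) \<le> limsup (\<lambda>n. ereal (f n))" for k
  proof (rule ccontr)
    assume "\<not> ?thesis"
    then have "\<forall>\<^sub>F n in sequentially. ereal (f n) < ereal (b k)" by (intro Limsup_lessD) (simp add: not_le)
    then have "\<forall>\<^sub>F n in sequentially. \<not> b k \<le> f n" by eventually_elim simp
    then show False using b(1)[of k] by (simp add: frequently_def)
  qed
  then show "ereal L \<le> limsup (\<lambda>n. ereal (f n))"
    using b(2) by (intro LIMSEQ_le_const2[of "\<lambda>k. ereal (b k)"]) auto
qed

text \<open>Eventually \<open>i * w i \<le> 2 * \<gamma> * W i\<close>, so the bound on
  \<open>Q\<close> makes its square at most a multiple of \<open>W i\<close> times a negative power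
  of \<open>i\<close>, which beats the iterated logarithm. Centring subtracts the square of the
  mean, negligible against \<open>w i\<close>. The upper bound takes any \<open>v > s2\<close> and
  therefore also covers \<open>s2 = 0\<close>.\<close>

lemma (in prob_space) regular_lil_bounds:
  fixes Q :: "nat \<Rightarrow> 'a \<Rightarrow> real"
  assumes ind: "indep_vars (\<lambda>_. borel) Q {1..}"
    and w: "\<And>i. 1 \<le> i \<Longrightarrow> 0 < w i" and W_def: "W = (\<lambda>n. \<Sum>i=1..n. w i)"
    and lim: "(\<lambda>n. real n * w n / W n) \<longlonglongrightarrow> \<gamma>" "0 < \<gamma>"
    and Qb: "\<And>i \<omega>. 1 \<le> i \<Longrightarrow> \<omega> \<in> space M \<Longrightarrow> (Q i \<omega>)\<^sup>2 \<le> C * (w i * real i powr (1 - \<kappa>))"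
    and C: "0 \<le> C" "0 < \<kappa>"
    and q2: "(\<lambda>i. expectation (\<lambda>\<omega>. (Q i \<omega>)\<^sup>2) / w i) \<longlonglongrightarrow> s2"
    and q1: "(\<lambda>i. (expectation (Q i))\<^sup>2 / w i) \<longlonglongrightarrow> 0"
  shows "\<And>v \<epsilon>. s2 < v \<Longrightarrow> 0 < v \<Longrightarrow> 0 < \<epsilon> \<Longrightarrow>
      AE \<omega> in M. \<forall>\<^sub>F n in sequentially. (\<Sum>i=1..n. Q i \<omega> - expectation (Q i)) \<le> (1 + \<epsilon>) * sqrt v * lil_scale W n"
    and "\<And>\<epsilon>. 0 < s2 \<Longrightarrow> 0 < \<epsilon> \<Longrightarrow> \<epsilon> < 1 \<Longrightarrow>
      AE \<omega> in M. \<exists>\<^sub>F n in sequentially. (1 - \<epsilon>) * sqrt s2 * lil_scale W n < (\<Sum>i=1..n. Q i \<omega> - expectation (Q i))"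
    and "\<forall>\<^sub>F n in sequentially. 0 < lil_scale W n"
    and "0 \<le> s2"
proof -
  have m[measurable]: "Q i \<in> borel_measurable M" if "1 \<le> i" for i
    using ind that unfolding indep_vars_def by auto
  define Z where "Z = (\<lambda>i \<omega>. Q i \<omega> - expectation (Q i))"
  define b where "b = (\<lambda>i. sqrt (C * (w i * real i powr (1 - \<kappa>))))"
  have b0: "0 \<le> b i" if "1 \<le> i" for i using that C w[of i] by (simp add: b_def)
  have Qle: "\<bar>Q i \<omega>\<bar> \<le> b i" if "1 \<le> i" "\<omega> \<in> space M" for i \<omega>
    unfolding b_def using real_sqrt_le_mono[OF Qb[OF that]] by simp
  have Qi: "integrable M (Q i)" if "1 \<le> i" for i
    using that by (intro integrable_bounded[where b="b i"] Qle) auto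
  have Qi2: "integrable M (\<lambda>\<omega>. (Q i \<omega>)\<^sup>2)" if "1 \<le> i" for i
  proof (rule integrable_bounded[where b="(b i)\<^sup>2"])
    show "\<bar>(Q i \<omega>)\<^sup>2\<bar> \<le> (b i)\<^sup>2" if "\<omega> \<in> space M" for \<omega>
      using power_mono[OF Qle[OF \<open>1 \<le> i\<close> that], of 2] by simp
  qed (use that in measurable)
  have EQ: "\<bar>expectation (Q i)\<bar> \<le> b i" if "1 \<le> i" for i
  proof -
    have "\<bar>expectation (Q i)\<bar> \<le> expectation (\<lambda>\<omega>. \<bar>Q i \<omega>\<bar>)"
      using integral_norm_bound[of M "Q i"] by simp
    also have "\<dots> \<le> expectation (\<lambda>\<omega>. b i)" using Qle that Qi by (intro integral_mono) auto
    finally show ?thesis by (simp add: prob_space)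
  qed
  \<comment> \<open>A running maximum, since the bound must hold for all indices up to
    \<open>n\<close>. The factor 2 pays for centring, and inserting 0 gives a value at
    \<open>n = 0\<close>.\<close>
  define B where "B = (\<lambda>n. Max (insert 0 ((\<lambda>i. 2 * b i) ` {1..n})))"
  have B0: "0 \<le> B n" for n unfolding B_def by (rule Max_ge) auto
  have bd: "\<bar>Z i \<omega>\<bar> \<le> B n" if "i \<in> {1..n}" "\<omega> \<in> space M" for n i \<omega>
  proof -
    have "\<bar>Z i \<omega>\<bar> \<le> 2 * b i" using Qle[of i \<omega>] EQ[of i] that unfolding Z_def by auto
    also have "\<dots> \<le> B n" unfolding B_def using that by (intro Max_ge) auto
    finally show ?thesis .
  qed
  have Wpos: "0 < W n" if "1 \<le> n" for n unfolding W_def using that w by (intro sum_pos) auto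
  obtain n0 where n0: "1 \<le> n0" and
    reg: "\<And>n m. n0 \<le> n \<Longrightarrow> n \<le> m \<Longrightarrow> (real m / real n) powr (\<gamma> / 2) * W n \<le> W m \<and> W m \<le> (real m / real n) powr (2 * \<gamma>) * W n"
    using regular_variation_bounds[OF w W_def lim] by blast
  have Wtop: "filterlim W at_top sequentially"
  proof (rule filterlim_at_top_mono)
    have "0 < W n0" "0 < real n0" using Wpos n0 by auto
    then show "filterlim (\<lambda>m. (real m / real n0) powr (\<gamma> / 2) * W n0) at_top sequentially"
      using lim(2) by real_asymp
    show "\<forall>\<^sub>F m in sequentially. (real m / real n0) powr (\<gamma> / 2) * W n0 \<le> W m"
      using eventually_ge_at_top[of n0] by eventually_elim (use reg in auto)
  qed
  have scale: "\<forall>\<^sub>F n in sequentially. 0 < lil_scale W n"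
    using eventually_lnln_pos eventually_ge_at_top[of 1]
  proof eventually_elim
    case (elim n)
    then show ?case using Wpos[of n] by (simp only: lil_scale_def real_sqrt_gt_0_iff) (intro mult_pos_pos, auto)
  qed
  then show "\<forall>\<^sub>F n in sequentially. 0 < lil_scale W n" .
  show s20: "0 \<le> s2"
  proof (rule LIMSEQ_le_const[OF q2], intro exI allI impI)
    fix i :: nat assume "1 \<le> i"
    then show "0 \<le> expectation (\<lambda>\<omega>. (Q i \<omega>)\<^sup>2) / w i" using w[of i] by simp
  qed
  have EZ2: "expectation (\<lambda>\<omega>. (Z i \<omega>)\<^sup>2) = expectation (\<lambda>\<omega>. (Q i \<omega>)\<^sup>2) - (expectation (Q i))\<^sup>2" if "1 \<le> i" for i
    unfolding Z_def using variance_eq[OF Qi[OF that] Qi2[OF that]] .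
  have Vlim: "(\<lambda>n. (\<Sum>i=1..n. expectation (\<lambda>\<omega>. (Z i \<omega>)\<^sup>2)) / W n) \<longlonglongrightarrow> s2"
    unfolding W_def
  proof (rule weighted_cesaro[OF w])
    have "(\<lambda>i. expectation (\<lambda>\<omega>. (Q i \<omega>)\<^sup>2) / w i - (expectation (Q i))\<^sup>2 / w i) \<longlonglongrightarrow> s2 - 0"
      by (intro tendsto_diff q2 q1)
    moreover have "\<forall>\<^sub>F i in sequentially. expectation (\<lambda>\<omega>. (Q i \<omega>)\<^sup>2) / w i - (expectation (Q i))\<^sup>2 / w i = expectation (\<lambda>\<omega>. (Z i \<omega>)\<^sup>2) / w i"
      using eventually_ge_at_top[of 1] by eventually_elim (simp add: EZ2 diff_divide_distrib)
    ultimately show "(\<lambda>i. expectation (\<lambda>\<omega>. (Z i \<omega>)\<^sup>2) / w i) \<longlonglongrightarrow> s2"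
      by (simp add: tendsto_cong)
  qed (use Wtop W_def in auto)
  \<comment> \<open>With an exponent of at most \<open>\<gamma> / 2\<close> the function
    \<open>f\<close> below is nondecreasing from \<open>n0\<close> on, so the bound at index
    \<open>i\<close> carries over to later \<open>n\<close>.\<close>
  define k where "k = min \<kappa> (\<gamma> / 2)"
  have k: "0 < k" "k \<le> \<kappa>" "k \<le> \<gamma> / 2" using C lim(2) by (auto simp: k_def)
  define f where "f = (\<lambda>i. W i * real i powr (- k))"
  have fmono: "f n \<le> f m" if "n0 \<le> n" "n \<le> m" for n m
  proof -
    have n: "0 < real n" "0 < real m" using n0 that by auto
    have "(real m / real n) powr k * W n \<le> (real m / real n) powr (\<gamma> / 2) * W n"
      using that n k n0 Wpos[of n] by (intro mult_right_mono powr_mono) auto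
    also have "\<dots> \<le> W m" using reg[OF that] by simp
    finally have "real m powr k * W n \<le> W m * real n powr k" using n by (simp add: powr_divide field_simps)
    then show ?thesis using n by (simp add: f_def powr_minus field_simps)
  qed
  have fpos: "0 < f n" if "1 \<le> n" for n unfolding f_def using Wpos[OF that] that by simp
  have "\<forall>\<^sub>F i in sequentially. real i * w i / W i < 2 * \<gamma>" using lim by (intro order_tendstoD(2)[OF lim(1)]) auto
  then have "\<forall>\<^sub>F i in sequentially. real i * w i / W i < 2 * \<gamma> \<and> n0 \<le> i"
    using eventually_ge_at_top[of n0] by eventually_elim auto
  then obtain n1 where n1: "\<And>i. n1 \<le> i \<Longrightarrow> real i * w i / W i < 2 * \<gamma> \<and> n0 \<le> i"
    unfolding eventually_sequentially by blast
  have n1n0: "n0 \<le> n1" using n1[of n1] by simp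
  \<comment> \<open>The second summand covers the finitely many indices below \<open>n1\<close>,
    measured against \<open>f n1\<close>.\<close>
  define D where "D = 4 * C * (2 * \<gamma>) + (\<Sum>i<n1. (2 * b i)\<^sup>2) / f n1"
  have f1: "0 < f n1" using fpos n1n0 n0 by auto
  have S0: "0 \<le> (\<Sum>i<n1. (2 * b i)\<^sup>2) / f n1" using f1 by (intro divide_nonneg_pos sum_nonneg) auto
  have D0: "0 \<le> D" using S0 C lim(2) by (simp add: D_def)
  have bD: "(2 * b i)\<^sup>2 \<le> D * f n" if i: "1 \<le> i" "i \<le> n" "n1 \<le> n" for i n
  proof (cases "n1 \<le> i")
    case True
    have Wi: "0 < W i" using Wpos i by auto
    have "(2 * b i)\<^sup>2 = 4 * C * (w i * real i powr (1 - \<kappa>))"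
      using C w[of i] i by (simp add: b_def power_mult_distrib)
    also have "\<dots> \<le> 4 * C * (2 * \<gamma> * f i)"
    proof (rule mult_left_mono)
      have "w i * real i powr (1 - \<kappa>) \<le> w i * real i powr (1 - k)"
        using w[of i] i k by (intro mult_left_mono powr_mono) auto
      also have "\<dots> = real i * w i * real i powr (- k)" using i by (simp add: powr_diff powr_minus field_simps)
      also have "\<dots> \<le> 2 * \<gamma> * W i * real i powr (- k)"
        using n1[OF True] Wi by (intro mult_right_mono) (auto simp: field_simps)
      finally show "w i * real i powr (1 - \<kappa>) \<le> 2 * \<gamma> * f i" by (simp add: f_def mult.assoc)
    qed (use C in simp)
    also have "\<dots> = 4 * C * (2 * \<gamma>) * f i" by simp
    also have "\<dots> \<le> D * f i" unfolding D_def using S0 fpos[OF i(1)] by (intro mult_right_mono) auto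
    also have "\<dots> \<le> D * f n" using fmono[of i n] True n1n0 i D0 by (intro mult_left_mono) auto
    finally show ?thesis .
  next
    case False
    have "(2 * b i)\<^sup>2 \<le> (\<Sum>i<n1. (2 * b i)\<^sup>2)" using False by (intro member_le_sum) auto
    also have "\<dots> = (\<Sum>i<n1. (2 * b i)\<^sup>2) / f n1 * f n1" using f1 by simp
    also have "\<dots> \<le> D * f n1" unfolding D_def using f1 C lim(2) by (intro mult_right_mono) auto
    also have "\<dots> \<le> D * f n" using fmono[of n1 n] n1n0 i D0 by (intro mult_left_mono) auto
    finally show ?thesis .
  qed
  have BD: "(B n)\<^sup>2 \<le> D * f n" if n: "n1 \<le> n" for n
  proof -
    have fn: "0 < f n" using fpos[of n] n n1n0 n0 by auto
    have "B n \<le> sqrt (D * f n)"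
      unfolding B_def
    proof (rule Max.boundedI)
      fix y assume "y \<in> insert 0 ((\<lambda>i. 2 * b i) ` {1..n})"
      then show "y \<le> sqrt (D * f n)"
        using bD n D0 fn by (auto intro!: real_le_rsqrt)
    qed auto
    then have "(B n)\<^sup>2 \<le> (sqrt (D * f n))\<^sup>2" using B0 by (intro power_mono) auto
    then show ?thesis using D0 fn by simp
  qed
  have BW: "(\<lambda>n. (B n)\<^sup>2 * ln (ln (real n)) / W n) \<longlonglongrightarrow> 0"
  proof (rule tendsto_sandwich[of "\<lambda>_. 0"])
    show "\<forall>\<^sub>F n in sequentially. 0 \<le> (B n)\<^sup>2 * ln (ln (real n)) / W n"
      using eventually_lnln_pos eventually_ge_at_top[of 1]
    proof eventually_elim
      case (elim n) then show ?case using Wpos[OF elim(2)] elim(1) by (intro divide_nonneg_pos mult_nonneg_nonneg zero_le_power2) linarith+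
    qed
    show "\<forall>\<^sub>F n in sequentially. (B n)\<^sup>2 * ln (ln (real n)) / W n \<le> D * (real n powr (- k) * ln (ln (real n)))"
      using eventually_lnln_pos eventually_ge_at_top[of n1]
    proof eventually_elim
      case (elim n)
      have Wn: "0 < W n" using Wpos elim n1n0 n0 by auto
      have "(B n)\<^sup>2 * ln (ln (real n)) / W n \<le> D * f n * ln (ln (real n)) / W n"
        using BD[OF elim(2)] elim(1) Wn by (intro divide_right_mono mult_right_mono) linarith+
      then show ?case using Wn by (simp add: f_def field_simps)
    qed
    have "(\<lambda>n. real n powr (- k) * ln (ln (real n))) \<longlonglongrightarrow> 0" using k(1) by real_asymp
    from tendsto_mult_left[OF this, of D]
    show "(\<lambda>n. D * (real n powr (- k) * ln (ln (real n)))) \<longlonglongrightarrow> 0" by simp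
  qed simp
  have indZ: "indep_vars (\<lambda>_. borel) Z {1..}"
    unfolding Z_def by (rule indep_vars_compose2[OF ind]) auto
  have EZ: "expectation (Z i) = 0" if "1 \<le> i" for i using Qi[OF that] by (simp add: Z_def prob_space)
  have Wmono: "W n \<le> W m" if "n0 \<le> n" "n \<le> m" for n m
    unfolding W_def using that w by (intro sum_mono2) (auto intro: less_imp_le)
  show "AE \<omega> in M. \<forall>\<^sub>F n in sequentially. (\<Sum>i=1..n. Q i \<omega> - expectation (Q i)) \<le> (1 + \<epsilon>) * sqrt v * lil_scale W n"
    if v: "s2 < v" "0 < v" "0 < \<epsilon>" for v \<epsilon>
  proof -
    have "\<forall>\<^sub>F n in sequentially. (\<Sum>i=1..n. expectation (\<lambda>\<omega>. (Z i \<omega>)\<^sup>2)) / W n < v \<and> 1 \<le> n"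
      using order_tendstoD(2)[OF Vlim v(1)] eventually_ge_at_top[of 1] by eventually_elim auto
    then have V: "\<forall>\<^sub>F n in sequentially. (\<Sum>i=1..n. expectation (\<lambda>\<omega>. (Z i \<omega>)\<^sup>2)) \<le> v * W n"
    proof eventually_elim
      case (elim n) then show ?case using Wpos[of n] by (auto simp: pos_divide_less_eq less_imp_le)
    qed
    show ?thesis
      using lil_upper[where ?n0.0=n0 and g="2*\<gamma>" and B=B, OF indZ bd B0 EZ n0 _ _ _ BW v(2) V _ v(3)] Wpos n0 Wmono reg lim(2)
      by (simp add: Z_def)
  qed
  show "AE \<omega> in M. \<exists>\<^sub>F n in sequentially. (1 - \<epsilon>) * sqrt s2 * lil_scale W n < (\<Sum>i=1..n. Q i \<omega> - expectation (Q i))"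
    if "0 < s2" "0 < \<epsilon>" "\<epsilon> < 1" for \<epsilon>
    using lil_lower[where ?n0.0=n0 and ?g1.0="\<gamma>/2" and g="2*\<gamma>" and B=B, OF indZ bd B0 EZ n0 _ _ _ BW that(1) Vlim _ _ that(2,3)] Wpos n0 reg lim(2)
    by (simp add: Z_def)
qed

text \<open>The upper estimate uses \<open>v\<close> slightly above \<open>s2\<close>. The lower
  half of the law requires \<open>s2 > 0\<close>; for \<open>s2 = 0\<close> the matching lower
  estimate is the upper one for \<open>- Q\<close>, as both constants then tend to 0.\<close>

lemma (in prob_space) regular_lil:
  fixes Q :: "nat \<Rightarrow> 'a \<Rightarrow> real"
  assumes ind: "indep_vars (\<lambda>_. borel) Q {1..}"
    and w: "\<And>i. 1 \<le> i \<Longrightarrow> 0 < w i" and W_def: "W = (\<lambda>n. \<Sum>i=1..n. w i)"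
    and lim: "(\<lambda>n. real n * w n / W n) \<longlonglongrightarrow> \<gamma>" "0 < \<gamma>"
    and Qb: "\<And>i \<omega>. 1 \<le> i \<Longrightarrow> \<omega> \<in> space M \<Longrightarrow> (Q i \<omega>)\<^sup>2 \<le> C * (w i * real i powr (1 - \<kappa>))"
    and C: "0 \<le> C" "0 < \<kappa>"
    and q2: "(\<lambda>i. expectation (\<lambda>\<omega>. (Q i \<omega>)\<^sup>2) / w i) \<longlonglongrightarrow> s2"
    and q1: "(\<lambda>i. (expectation (Q i))\<^sup>2 / w i) \<longlonglongrightarrow> 0"
  shows "AE \<omega> in M. limsup (\<lambda>n. ereal ((\<Sum>i=1..n. Q i \<omega> - expectation (Q i)) / lil_scale W n)) = ereal (sqrt s2)"
    (is "AE \<omega> in M. limsup (\<lambda>n. ereal (?S n \<omega> / _)) = _")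
proof -
  note bounds = regular_lil_bounds[OF ind w W_def lim Qb C q2 q1]
  have scale: "\<forall>\<^sub>F n in sequentially. 0 < lil_scale W n" by (rule bounds(3))
  have s20: "0 \<le> s2" by (rule bounds(4))
  define e where "e = (\<lambda>k. 1 / (real k + 2))"
  have e: "0 < e k" "e k < 1" for k by (auto simp: e_def)
  have e0: "e \<longlonglongrightarrow> 0" unfolding e_def by real_asymp
  have "AE \<omega> in M. \<forall>k. \<forall>\<^sub>F n in sequentially. ?S n \<omega> \<le> (1 + e k) * sqrt (s2 + e k) * lil_scale W n"
    unfolding AE_all_countable using e s20 by (intro allI bounds(1)) (auto intro!: add_nonneg_pos)
  then have up: "AE \<omega> in M. \<forall>k. \<forall>\<^sub>F n in sequentially. ?S n \<omega> / lil_scale W n \<le> (1 + e k) * sqrt (s2 + e k)"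
  proof eventually_elim
    case (elim \<omega>)
    show ?case
    proof
      fix k
      show "\<forall>\<^sub>F n in sequentially. ?S n \<omega> / lil_scale W n \<le> (1 + e k) * sqrt (s2 + e k)"
        using elim[rule_format, of k] scale by eventually_elim (simp add: pos_divide_le_eq)
    qed
  qed
  have ulim: "(\<lambda>k. (1 + e k) * sqrt (s2 + e k)) \<longlonglongrightarrow> sqrt s2"
    using tendsto_mult[OF tendsto_add[OF tendsto_const e0] tendsto_real_sqrt[OF tendsto_add[OF tendsto_const e0]], of 1 s2] by simp
  have lo: "\<exists>l. l \<longlonglongrightarrow> sqrt s2 \<and> (AE \<omega> in M. \<forall>k. \<exists>\<^sub>F n in sequentially. l k \<le> ?S n \<omega> / lil_scale W n)"
  proof (cases "s2 = 0")
    case False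
    then have s2: "0 < s2" using s20 by simp
    have "AE \<omega> in M. \<forall>k. \<exists>\<^sub>F n in sequentially. (1 - e k) * sqrt s2 * lil_scale W n < ?S n \<omega>"
      unfolding AE_all_countable using e s2 by (intro allI bounds(2)) auto
    then have "AE \<omega> in M. \<forall>k. \<exists>\<^sub>F n in sequentially. (1 - e k) * sqrt s2 \<le> ?S n \<omega> / lil_scale W n"
    proof eventually_elim
      case (elim \<omega>)
      show ?case
      proof
        fix k
        have "\<forall>\<^sub>F n in sequentially. (1 - e k) * sqrt s2 * lil_scale W n < ?S n \<omega> \<longrightarrow> (1 - e k) * sqrt s2 \<le> ?S n \<omega> / lil_scale W n"
          using scale by eventually_elim (simp add: pos_le_divide_eq)
        with elim[rule_format, of k] show "\<exists>\<^sub>F n in sequentially. (1 - e k) * sqrt s2 \<le> ?S n \<omega> / lil_scale W n"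
          by (rule frequently_rev_mp)
      qed
    qed
    moreover have "(\<lambda>k. (1 - e k) * sqrt s2) \<longlonglongrightarrow> (1 - 0) * sqrt s2"
      by (intro tendsto_intros e0)
    ultimately show ?thesis by (intro exI[of _ "\<lambda>k. (1 - e k) * sqrt s2"]) simp
  next
    case True
    have ind': "indep_vars (\<lambda>_. borel) (\<lambda>i \<omega>. - Q i \<omega>) {1..}" by (rule indep_vars_compose2[OF ind]) auto
    have "AE \<omega> in M. \<forall>k. \<forall>\<^sub>F n in sequentially. (\<Sum>i=1..n. - Q i \<omega> - expectation (\<lambda>\<omega>. - Q i \<omega>)) \<le> (1 + e k) * sqrt (s2 + e k) * lil_scale W n"
      unfolding AE_all_countable using e s20 q2 q1 Qb w
      by (intro allI regular_lil_bounds(1)[OF ind' w W_def lim _ C, where ?s2.0=s2]) (auto intro!: add_nonneg_pos)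
    then have "AE \<omega> in M. \<forall>k. \<exists>\<^sub>F n in sequentially. - ((1 + e k) * sqrt (s2 + e k)) \<le> ?S n \<omega> / lil_scale W n"
    proof eventually_elim
      case (elim \<omega>)
      show ?case
      proof
        fix k
        have "\<forall>\<^sub>F n in sequentially. - ((1 + e k) * sqrt (s2 + e k)) \<le> ?S n \<omega> / lil_scale W n"
          using elim[rule_format, of k] scale
        proof eventually_elim
          case (elim n)
          have "(\<Sum>i=1..n. - Q i \<omega> - expectation (\<lambda>\<omega>. - Q i \<omega>)) = - ?S n \<omega>"
            by (simp add: sum_negf[symmetric])
          then show ?case using elim by (simp add: pos_le_divide_eq)
        qed
        then show "\<exists>\<^sub>F n in sequentially. - ((1 + e k) * sqrt (s2 + e k)) \<le> ?S n \<omega> / lil_scale W n"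
          by (rule eventually_frequently[rotated]) simp
      qed
    qed
    moreover have "(\<lambda>k. - ((1 + e k) * sqrt (s2 + e k))) \<longlonglongrightarrow> sqrt s2"
      using tendsto_minus[OF ulim] True by simp
    ultimately show ?thesis by (intro exI[of _ "\<lambda>k. - ((1 + e k) * sqrt (s2 + e k))"]) simp
  qed
  then obtain l where l: "l \<longlonglongrightarrow> sqrt s2"
    and lAE: "AE \<omega> in M. \<forall>k. \<exists>\<^sub>F n in sequentially. l k \<le> ?S n \<omega> / lil_scale W n" by blast
  show ?thesis using up lAE
  proof eventually_elim
    case (elim \<omega>)
    then show ?case by (intro limsup_eqI[OF _ ulim _ l]) auto
  qed
qed

section \<open>Bandwidth sequences\<close>

locale regular_sequence =
  fixes p :: "nat \<Rightarrow> real" and \<beta> :: "real \<Rightarrow> real"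
  assumes p_pos: "\<And>i. 1 \<le> i \<Longrightarrow> 0 < p i" and p_le_1: "\<And>i. p i \<le> 1"
    and np_top: "filterlim (\<lambda>n. real n * p n) at_top sequentially"
    and mean_lim: "\<And>q::real. q \<le> 2 \<Longrightarrow> (\<lambda>n. (1 / real n) * (\<Sum>i=1..n. (p i / p n) powr q)) \<longlonglongrightarrow> \<beta> q"
begin

lemma sum_powr_eq:
  assumes "1 \<le> n"
  shows "(\<Sum>i=1..n. p i powr q) = real n * p n powr q * ((1 / real n) * (\<Sum>i=1..n. (p i / p n) powr q))"
proof -
  have "(\<Sum>i=1..n. (p i / p n) powr q) = (\<Sum>i=1..n. p i powr q / p n powr q)"
    by (intro sum.cong refl powr_divide)
  also have "\<dots> = (\<Sum>i=1..n. p i powr q) / p n powr q" by (simp add: sum_divide_distrib)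
  finally show ?thesis using assms p_pos[OF assms] by simp
qed

text \<open>For \<open>a > 0\<close> one has \<open>a + 1 / a \<ge> 2\<close>. Averaging over
  \<open>a = c * (p i / p n) powr q\<close> and letting \<open>n\<close> grow gives
  \<open>c * \<beta> q + \<beta> (- q) / c \<ge> 2\<close> for every \<open>c > 0\<close>, which
  fails for large \<open>c\<close> if \<open>\<beta> q \<le> 0\<close>. Both \<open>q\<close> and
  \<open>- q\<close> must be admissible exponents, hence the range.\<close>

lemma beta_pos:
  assumes "- 2 \<le> q" "q \<le> 2"
  shows "0 < \<beta> q"
proof (rule ccontr)
  assume neg: "\<not> 0 < \<beta> q"
  \<comment> \<open>Large enough for \<open>\<beta> (- q) / c \<le> 1\<close>, while
    \<open>c * \<beta> q\<close> is at most 0 by assumption.\<close>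
  define c where "c = \<bar>\<beta> (- q)\<bar> + 1"
  have c: "0 < c" by (simp add: c_def)
  have "2 \<le> c * \<beta> q + \<beta> (- q) / c"
  proof (rule LIMSEQ_le_const)
    show "(\<lambda>n. c * ((1 / real n) * (\<Sum>i=1..n. (p i / p n) powr q)) + ((1 / real n) * (\<Sum>i=1..n. (p i / p n) powr (- q))) / c)
       \<longlonglongrightarrow> c * \<beta> q + \<beta> (- q) / c"
      using assms c by (intro tendsto_intros mean_lim) auto
    have "2 \<le> c * ((1 / real n) * (\<Sum>i=1..n. (p i / p n) powr q)) + ((1 / real n) * (\<Sum>i=1..n. (p i / p n) powr (- q))) / c"
      if n: "1 \<le> n" for n
    proof -
      have "2 \<le> c * (p i / p n) powr q + (p i / p n) powr (- q) / c" if i: "i \<in> {1..n}" for i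
      proof -
        define a where "a = c * (p i / p n) powr q"
        have a: "0 < a" using c p_pos[of i] p_pos[of n] i by (simp add: a_def)
        have "0 \<le> (a - 1)\<^sup>2" by simp
        then have "2 * a \<le> a * a + 1" by (simp add: power2_eq_square algebra_simps)
        then have "2 \<le> a + 1 / a" using a by (simp add: field_simps)
        then show ?thesis by (simp add: a_def powr_minus field_simps)
      qed
      then have "(\<Sum>i=1..n. 2) \<le> (\<Sum>i=1..n. c * (p i / p n) powr q + (p i / p n) powr (- q) / c)"
        by (rule sum_mono)
      then have "(1 / real n) * (2 * real n) \<le> (1 / real n) * (c * (\<Sum>i=1..n. (p i / p n) powr q) + (\<Sum>i=1..n. (p i / p n) powr (- q)) / c)"
        by (intro mult_left_mono) (simp_all add: sum.distrib sum_distrib_left sum_divide_distrib)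
      then show ?thesis using n by (simp add: algebra_simps)
    qed
    then show "\<exists>N. \<forall>n\<ge>N. 2 \<le> c * ((1 / real n) * (\<Sum>i=1..n. (p i / p n) powr q)) + ((1 / real n) * (\<Sum>i=1..n. (p i / p n) powr (- q))) / c"
      by blast
  qed
  moreover have "c * \<beta> q \<le> 0" using neg c by (simp add: mult_nonneg_nonpos)
  moreover have "\<beta> (- q) / c \<le> 1" using c by (simp add: c_def field_simps)
  ultimately show False by simp
qed

text \<open>This is what the growth bounds ask of the weights \<open>p i powr q\<close>, with
  \<open>\<gamma> = 1 / \<beta> q\<close>.\<close>

lemma last_term_ratio:
  assumes "- 2 \<le> q" "q \<le> 2"
  shows "(\<lambda>n. real n * p n powr q / (\<Sum>i=1..n. p i powr q)) \<longlonglongrightarrow> 1 / \<beta> q"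
proof -
  have "(\<lambda>n. 1 / ((1 / real n) * (\<Sum>i=1..n. (p i / p n) powr q))) \<longlonglongrightarrow> 1 / \<beta> q"
    using beta_pos[OF assms] assms by (intro tendsto_divide tendsto_const mean_lim) auto
  moreover have "\<forall>\<^sub>F n in sequentially. 1 / ((1 / real n) * (\<Sum>i=1..n. (p i / p n) powr q)) = real n * p n powr q / (\<Sum>i=1..n. p i powr q)"
    using eventually_ge_at_top[of 1]
  proof eventually_elim
    case (elim n)
    then show ?case unfolding sum_powr_eq[OF elim] using p_pos[OF elim] by simp
  qed
  ultimately show ?thesis by (rule Lim_transform_eventually)
qed

text \<open>As \<open>p \<le> 1\<close> and \<open>q \<le> 1\<close>, the sum is at least
  \<open>n * p n\<close> times a mean with a positive limit.\<close>

lemma sum_powr_top: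
  assumes "- 2 \<le> q" "q \<le> 1"
  shows "filterlim (\<lambda>n. \<Sum>i=1..n. p i powr q) at_top sequentially"
proof (rule filterlim_at_top_mono)
  show "filterlim (\<lambda>n. ((1 / real n) * (\<Sum>i=1..n. (p i / p n) powr q)) * (real n * p n)) at_top sequentially"
    using assms by (intro filterlim_tendsto_pos_mult_at_top[OF mean_lim beta_pos np_top]) auto
  show "\<forall>\<^sub>F n in sequentially. ((1 / real n) * (\<Sum>i=1..n. (p i / p n) powr q)) * (real n * p n) \<le> (\<Sum>i=1..n. p i powr q)"
    using eventually_ge_at_top[of 1]
  proof eventually_elim
    case (elim n)
    have "p n powr 1 \<le> p n powr q" using p_pos[OF elim] p_le_1[of n] assms by (intro powr_mono') auto
    then have "p n \<le> p n powr q" using p_pos[OF elim] by simp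
    then have "((1 / real n) * (\<Sum>i=1..n. (p i / p n) powr q)) * (real n * p n) \<le> ((1 / real n) * (\<Sum>i=1..n. (p i / p n) powr q)) * (real n * p n powr q)"
      by (intro mult_left_mono mult_nonneg_nonneg sum_nonneg) auto
    also have "\<dots> = (\<Sum>i=1..n. p i powr q)" unfolding sum_powr_eq[OF elim] by (simp add: mult_ac)
    finally show ?case .
  qed
qed

text \<open>For the weights \<open>p\<close> themselves, \<open>n * p n\<close> is comparable with
  \<open>W n\<close>, and \<open>W n\<close> grows at least like
  \<open>n powr (\<gamma> / 2)\<close>. So \<open>n * p n\<close> tends to infinity at a power rate,
  with \<open>\<kappa> = \<gamma> / 2\<close>; \<open>C\<close> also absorbs the early
  indices.\<close>

lemma p_lower_bound:
  obtains C \<kappa> where "0 < C" "0 < \<kappa>" "\<And>i. 1 \<le> i \<Longrightarrow> 1 / p i \<le> C * real i powr (1 - \<kappa>)"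
proof -
  define W where "W = (\<lambda>n. \<Sum>i=1..n. p i)"
  define \<gamma> where "\<gamma> = 1 / \<beta> 1"
  have gam: "0 < \<gamma>" using beta_pos[of 1] by (simp add: \<gamma>_def)
  have W1: "W n = (\<Sum>i=1..n. p i powr 1)" for n
    unfolding W_def
  proof (intro sum.cong refl)
    fix i assume "i \<in> {1..n}"
    then show "p i = p i powr 1" using p_pos[of i] by simp
  qed
  have Wpos: "0 < W n" if "1 \<le> n" for n unfolding W_def using that p_pos by (intro sum_pos) auto
  have "\<forall>\<^sub>F n in sequentially. real n * p n powr 1 / (\<Sum>i=1..n. p i powr 1) = real n * p n / W n"
    using eventually_ge_at_top[of 1]
  proof eventually_elim
    case (elim n)
    then show ?case unfolding W1 using p_pos[of n] by simp
  qed
  moreover have "(\<lambda>n. real n * p n powr 1 / (\<Sum>i=1..n. p i powr 1)) \<longlonglongrightarrow> 1 / \<beta> 1"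
    by (rule last_term_ratio) auto
  ultimately have lim: "(\<lambda>n. real n * p n / W n) \<longlonglongrightarrow> \<gamma>"
    unfolding \<gamma>_def by (rule Lim_transform_eventually[rotated])
  obtain n0 where n0: "1 \<le> n0" and
    reg: "\<And>n m. n0 \<le> n \<Longrightarrow> n \<le> m \<Longrightarrow> (real m / real n) powr (\<gamma> / 2) * W n \<le> W m \<and> W m \<le> (real m / real n) powr (2 * \<gamma>) * W n"
    using regular_variation_bounds[OF p_pos W_def lim gam] by blast
  have "\<forall>\<^sub>F n in sequentially. \<gamma> / 2 < real n * p n / W n \<and> n0 \<le> n"
    using order_tendstoD(1)[OF lim, of "\<gamma> / 2"] gam eventually_ge_at_top[of n0] by (intro eventually_conj) auto
  then obtain n1 where n1: "\<And>n. n1 \<le> n \<Longrightarrow> \<gamma> / 2 < real n * p n / W n \<and> n0 \<le> n"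
    unfolding eventually_sequentially by blast
  define \<kappa> where "\<kappa> = \<gamma> / 2"
  define c where "c = \<gamma> / 2 * (W n0 / real n0 powr \<kappa>)"
  have c: "0 < c" using gam Wpos[OF n0] n0 by (simp add: c_def)
  define f where "f = (\<lambda>i. (1 / p i) / real i powr (1 - \<kappa>))"
  have f0: "0 \<le> f i" if "1 \<le> i" for i using p_pos[OF that] by (simp add: f_def)
  have tail: "f i \<le> 1 / c" if i: "n1 \<le> i" for i
  proof -
    have ii: "1 \<le> i" "n0 \<le> i" using n1[OF i] n0 by auto
    have "c * real i powr \<kappa> = \<gamma> / 2 * ((real i / real n0) powr \<kappa> * W n0)"
      using n0 ii by (simp add: c_def powr_divide)
    also have "\<dots> \<le> \<gamma> / 2 * W i" using reg[of n0 i] ii gam by (intro mult_left_mono) (auto simp: \<kappa>_def)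
    also have "\<dots> \<le> real i * p i" using n1[OF i] Wpos[OF ii(1)] by (simp add: field_simps)
    finally have "c * real i powr \<kappa> \<le> real i * p i" .
    then show ?thesis using c p_pos[OF ii(1)] ii by (simp add: f_def powr_diff field_simps)
  qed
  define C where "C = 1 / c + (\<Sum>i=1..<n1. f i)"
  have S: "0 \<le> (\<Sum>i=1..<n1. f i)" using f0 by (intro sum_nonneg) auto
  have C: "0 < C" using c S by (simp add: C_def add_pos_nonneg)
  have "f i \<le> C" if "1 \<le> i" for i
  proof (cases "n1 \<le> i")
    case False
    then have "f i \<le> (\<Sum>i=1..<n1. f i)" using that f0 by (intro member_le_sum) auto
    then show ?thesis using c by (simp add: C_def add_increasing)
  next
    case True
    then show ?thesis unfolding C_def using tail[OF True] S by linarith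
  qed
  then have fC: "f i \<le> C" if "1 \<le> i" for i using that .
  have "1 / p i \<le> C * real i powr (1 - \<kappa>)" if "1 \<le> i" for i
  proof -
    have "0 < real i powr (1 - \<kappa>)" using that by simp
    then show ?thesis using fC[OF that] unfolding f_def by (simp only: pos_divide_le_eq)
  qed
  then show thesis using that[OF C, of \<kappa>] gam by (simp add: \<kappa>_def)
qed

end

section \<open>Weighted sums of localized noise\<close>

text \<open>Markov's inequality: where \<open>a < \<bar>R \<omega>\<bar>\<close>, the factor
  \<open>(\<bar>R \<omega>\<bar> / a) ^ m\<close> is at least 1.\<close>

lemma (in prob_space) expectation_tail_le:
  fixes R :: "'a \<Rightarrow> real"
  assumes R[measurable]: "R \<in> borel_measurable M" and i: "integrable M (\<lambda>\<omega>. \<bar>R \<omega>\<bar> ^ (j + m))" and a: "0 < a"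
  shows "integrable M (\<lambda>\<omega>. \<bar>R \<omega>\<bar> ^ j * of_bool (a < \<bar>R \<omega>\<bar>))"
    and "expectation (\<lambda>\<omega>. \<bar>R \<omega>\<bar> ^ j * of_bool (a < \<bar>R \<omega>\<bar>)) \<le> expectation (\<lambda>\<omega>. \<bar>R \<omega>\<bar> ^ (j + m)) / a ^ m"
proof -
  have pw: "\<bar>R \<omega>\<bar> ^ j * of_bool (a < \<bar>R \<omega>\<bar>) \<le> \<bar>R \<omega>\<bar> ^ (j + m) / a ^ m" for \<omega>
  proof (cases "a < \<bar>R \<omega>\<bar>")
    case True
    have "a ^ m \<le> \<bar>R \<omega>\<bar> ^ m" using True a by (intro power_mono) auto
    then have "\<bar>R \<omega>\<bar> ^ j * a ^ m \<le> \<bar>R \<omega>\<bar> ^ j * \<bar>R \<omega>\<bar> ^ m" by (intro mult_left_mono) auto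
    then show ?thesis using True a by (simp add: pos_le_divide_eq power_add)
  qed (use a in simp)
  have ia: "integrable M (\<lambda>\<omega>. \<bar>R \<omega>\<bar> ^ (j + m) / a ^ m)" using i by simp
  show ii: "integrable M (\<lambda>\<omega>. \<bar>R \<omega>\<bar> ^ j * of_bool (a < \<bar>R \<omega>\<bar>))"
    by (rule Bochner_Integration.integrable_bound[OF ia]) (use pw a in auto)
  have "expectation (\<lambda>\<omega>. \<bar>R \<omega>\<bar> ^ j * of_bool (a < \<bar>R \<omega>\<bar>)) \<le> expectation (\<lambda>\<omega>. \<bar>R \<omega>\<bar> ^ (j + m) / a ^ m)"
    by (rule integral_mono[OF ii ia pw])
  then show "expectation (\<lambda>\<omega>. \<bar>R \<omega>\<bar> ^ j * of_bool (a < \<bar>R \<omega>\<bar>)) \<le> expectation (\<lambda>\<omega>. \<bar>R \<omega>\<bar> ^ (j + m)) / a ^ m" by simp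
qed

lemma powr_one_minus_squared:
  assumes "0 < (x::real)"
  shows "(x powr (1 - l))\<^sup>2 = x powr (1 - 2 * l) * x"
proof -
  have "(x powr (1 - l))\<^sup>2 = x powr ((1 - 2 * l) + 1)" by (simp add: power2_eq_square powr_add[symmetric])
  also have "\<dots> = x powr (1 - 2 * l) * x" using assms by (simp only: powr_add powr_one)
  finally show ?thesis .
qed

text \<open>The origin of the weights \<open>p i powr (1 - 2 * l)\<close>: relative to them the
  squares of the summands no longer depend on \<open>l\<close>.\<close>

lemma weighted_square_div:
  assumes "0 < (x::real)"
  shows "(x powr (- l) * y)\<^sup>2 / x powr (1 - 2 * l) = y\<^sup>2 / x"
  using assms by (simp add: power_mult_distrib powr_power powr_diff powr_minus field_simps powr_add[symmetric])

text \<open>Here \<open>k i\<close> is the kernel weight and \<open>R i\<close> the response minus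
  \<open>r x\<close>. The pairs are independent across \<open>i\<close>, whereas \<open>k i\<close>
  and \<open>R i\<close> may depend on each other. Tails enter through moments of every order that
  are bounded uniformly in \<open>i\<close>, and \<open>mean_kR\<close> expresses the local
  bias.\<close>

locale weighted_noise = prob_space M + regular_sequence p \<beta>
  for M :: "'a measure" and p \<beta> +
  fixes k R :: "nat \<Rightarrow> 'a \<Rightarrow> real" and h :: "nat \<Rightarrow> real" and l \<alpha> m1 m2 s2 C b :: real
  assumes ind: "indep_vars (\<lambda>_. borel \<Otimes>\<^sub>M borel) (\<lambda>i \<omega>. (k i \<omega>, R i \<omega>)) {1..}"
    and k_nonneg: "\<And>i \<omega>. 0 \<le> k i \<omega>" and k_le: "\<And>i \<omega>. k i \<omega> \<le> b"
    and moments: "\<And>m::nat. \<exists>D. \<forall>i\<ge>1. integrable M (\<lambda>\<omega>. \<bar>R i \<omega>\<bar> ^ m) \<and> expectation (\<lambda>\<omega>. \<bar>R i \<omega>\<bar> ^ m) \<le> D"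
    and p_lim: "p \<longlonglongrightarrow> 0"
    and mean_k: "(\<lambda>i. expectation (k i) / p i) \<longlonglongrightarrow> m1" and m1_pos: "0 < m1"
    and mean_k2: "(\<lambda>i. expectation (\<lambda>\<omega>. (k i \<omega>)\<^sup>2) / p i) \<longlonglongrightarrow> m2"
    and mean_kR: "\<forall>\<^sub>F i in sequentially. \<bar>expectation (\<lambda>\<omega>. k i \<omega> * R i \<omega>)\<bar> \<le> C * (h i * p i)" and C_nonneg: "0 \<le> C"
    and mean_kR2: "(\<lambda>i. expectation (\<lambda>\<omega>. (k i \<omega> * R i \<omega>)\<^sup>2) / p i) \<longlonglongrightarrow> s2"
    and l: "0 \<le> l" "l \<le> 1" and h_pos: "\<And>i. 1 \<le> i \<Longrightarrow> 0 < h i"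
    and A_lim: "(\<lambda>n. (1 / real n) * (\<Sum>i=1..n. (h i / h n) * (p i / p n) powr (1 - l))) \<longlonglongrightarrow> \<alpha>"
    and nh2: "(\<lambda>n. real n * (h n)\<^sup>2) \<longlonglongrightarrow> 0"
begin

lemma k_measurable[measurable]: "1 \<le> i \<Longrightarrow> k i \<in> borel_measurable M"
  and R_measurable[measurable]: "1 \<le> i \<Longrightarrow> R i \<in> borel_measurable M"
proof -
  assume "1 \<le> i"
  then have "(\<lambda>\<omega>. (k i \<omega>, R i \<omega>)) \<in> measurable M (borel \<Otimes>\<^sub>M borel)"
    using ind unfolding indep_vars_def by auto
  from measurable_compose[OF this measurable_fst] measurable_compose[OF this measurable_snd]
  show "k i \<in> borel_measurable M" "R i \<in> borel_measurable M" by simp_all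
qed

lemma b_nonneg: "0 \<le> b"
  using k_nonneg k_le order_trans by blast

definition W :: "nat \<Rightarrow> real" where "W = (\<lambda>n. \<Sum>i=1..n. p i powr (1 - 2 * l))"

lemma W_eq: "1 \<le> n \<Longrightarrow> W n = real n * p n powr (1 - 2 * l) * ((1 / real n) * (\<Sum>i=1..n. (p i / p n) powr (1 - 2 * l)))"
  unfolding W_def by (rule sum_powr_eq)

lemma sum_powr_pos: "1 \<le> n \<Longrightarrow> 0 < (\<Sum>i=1..n. p i powr q)"
proof (intro sum_pos)
  show "0 < p i powr q" if "i \<in> {1..n}" for i using p_pos[of i] that by simp
qed auto

lemma W_pos: "1 \<le> n \<Longrightarrow> 0 < W n"
  unfolding W_def by (rule sum_powr_pos)

lemma W_ratio: "(\<lambda>n. real n * p n powr (1 - 2 * l) / W n) \<longlonglongrightarrow> 1 / \<beta> (1 - 2 * l)"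
  unfolding W_def using l by (intro last_term_ratio) auto

lemma beta_W_pos: "0 < \<beta> (1 - 2 * l)" "0 < \<beta> (1 - l)"
  using l by (auto intro!: beta_pos)

lemma lil_scale_W_top: "filterlim (lil_scale W) at_top sequentially"
proof -
  have "filterlim (\<lambda>n::nat. ln (ln (real n))) at_top sequentially" by real_asymp
  then have "filterlim (\<lambda>n. 2 * (W n * ln (ln (real n)))) at_top sequentially"
    using l unfolding W_def
    by (intro filterlim_tendsto_pos_mult_at_top[OF tendsto_const] filterlim_at_top_mult_at_top sum_powr_top) auto
  then have "filterlim (\<lambda>n. sqrt (2 * (W n * ln (ln (real n))))) at_top sequentially"
    by (rule filterlim_compose[OF sqrt_at_top])
  then show ?thesis by (simp add: lil_scale_def[abs_def] mult.assoc)
qed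

lemma inverse_p_powr_l_le: "1 \<le> i \<Longrightarrow> p i powr (- l) \<le> 1 / p i"
proof -
  assume i: "1 \<le> i"
  have "p i powr (- l) \<le> p i powr (- 1)" using p_pos[OF i] p_le_1[of i] l by (intro powr_mono') auto
  then show ?thesis using p_pos[OF i] by (simp add: powr_minus_divide)
qed

lemma indep_kR: "indep_vars (\<lambda>_. borel) (\<lambda>i \<omega>. f i (k i \<omega>) (R i \<omega>)) {1..}"
  if [measurable]: "\<And>i. (\<lambda>z. f i (fst z) (snd z)) \<in> borel_measurable (borel \<Otimes>\<^sub>M borel)" for f :: "nat \<Rightarrow> real \<Rightarrow> real \<Rightarrow> real"
  using indep_vars_compose2[OF ind, of "\<lambda>i z. f i (fst z) (snd z)" "\<lambda>_. borel"] that by simp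

section \<open>Almost sure limit of the denominator\<close>

text \<open>Deviations from the mean have at most the order of \<open>lil_scale W n\<close>, by the
  upper law for \<open>Q\<close> and for \<open>- Q\<close>. Divided by the norming this is of order
  \<open>sqrt (ln (ln n) / (n * p n))\<close>, which vanishes since \<open>n * p n\<close> grows at
  a power rate. The means average to \<open>m1\<close> relative to the weights
  \<open>p i powr (1 - l)\<close>.\<close>

lemma denominator_limit:
  "AE \<omega> in M. (\<lambda>n. (\<Sum>i=1..n. p i powr (- l) * k i \<omega>) / (real n * p n powr (1 - l))) \<longlonglongrightarrow> \<beta> (1 - l) * m1"
proof -
  obtain D \<kappa> where D: "0 < D" "0 < \<kappa>" "\<And>i. 1 \<le> i \<Longrightarrow> 1 / p i \<le> D * real i powr (1 - \<kappa>)"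
    using p_lower_bound by blast
  define Q where "Q = (\<lambda>i \<omega>. p i powr (- l) * k i \<omega>)"
  have sq: "(p i powr (- l) * y)\<^sup>2 / p i powr (1 - 2 * l) = y\<^sup>2 / p i" if "1 \<le> i" for i y
    using p_pos[OF that] by (rule weighted_square_div)
  have EQ: "expectation (Q i) = p i powr (- l) * expectation (k i)" for i by (simp add: Q_def)
  have ind': "indep_vars (\<lambda>_. borel) Q {1..}" unfolding Q_def by (rule indep_kR) measurable
  have Wd: "W = (\<lambda>n. \<Sum>i=1..n. p i powr (1 - 2 * l))" by (simp add: W_def)
  have q2: "(\<lambda>i. expectation (\<lambda>\<omega>. (Q i \<omega>)\<^sup>2) / p i powr (1 - 2 * l)) \<longlonglongrightarrow> m2"
  proof (rule Lim_transform_eventually[OF mean_k2])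
    show "\<forall>\<^sub>F i in sequentially. expectation (\<lambda>\<omega>. (k i \<omega>)\<^sup>2) / p i = expectation (\<lambda>\<omega>. (Q i \<omega>)\<^sup>2) / p i powr (1 - 2 * l)"
      using eventually_ge_at_top[of 1]
    proof eventually_elim
      case (elim i)
      have "expectation (\<lambda>\<omega>. (Q i \<omega>)\<^sup>2) / p i powr (1 - 2 * l) = expectation (\<lambda>\<omega>. (Q i \<omega>)\<^sup>2 / p i powr (1 - 2 * l))" by simp
      also have "\<dots> = expectation (\<lambda>\<omega>. (k i \<omega>)\<^sup>2 / p i)" by (simp add: Q_def sq[OF elim])
      finally show ?case by simp
    qed
  qed
  have q1: "(\<lambda>i. (expectation (Q i))\<^sup>2 / p i powr (1 - 2 * l)) \<longlonglongrightarrow> 0"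
  proof -
    have "(\<lambda>i. (expectation (k i) / p i) * (expectation (k i) / p i) * p i) \<longlonglongrightarrow> m1 * m1 * 0"
      by (intro tendsto_mult mean_k p_lim)
    moreover have "\<forall>\<^sub>F i in sequentially. (expectation (k i) / p i) * (expectation (k i) / p i) * p i = (expectation (Q i))\<^sup>2 / p i powr (1 - 2 * l)"
      using eventually_ge_at_top[of 1]
    proof eventually_elim
      case (elim i)
      show ?case unfolding EQ sq[OF elim] using p_pos[OF elim] by (simp add: power2_eq_square)
    qed
    ultimately show ?thesis by (simp add: tendsto_cong)
  qed
  have Qb: "(Q i \<omega>)\<^sup>2 \<le> (b\<^sup>2 * D) * (p i powr (1 - 2 * l) * real i powr (1 - \<kappa>))" if i: "1 \<le> i" for i \<omega>
  proof -
    have "(Q i \<omega>)\<^sup>2 = (k i \<omega>)\<^sup>2 / p i * p i powr (1 - 2 * l)" using sq[OF i, of "k i \<omega>"] p_pos[OF i] by (simp add: Q_def field_simps)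
    also have "\<dots> \<le> b\<^sup>2 * (D * real i powr (1 - \<kappa>)) * p i powr (1 - 2 * l)"
      using D(3)[OF i] power_mono[OF k_le[of i \<omega>] k_nonneg, of 2] p_pos[OF i]
        mult_mono[of "(k i \<omega>)\<^sup>2" "b\<^sup>2" "1 / p i" "D * real i powr (1 - \<kappa>)"]
      by (intro mult_right_mono) auto
    finally show ?thesis by (simp add: mult_ac)
  qed
  have bpos: "0 \<le> b\<^sup>2 * D" using D by simp
  have wpos: "0 < p i powr (1 - 2 * l)" if "1 \<le> i" for i using p_pos[OF that] by simp
  have gam: "0 < 1 / \<beta> (1 - 2 * l)" using beta_W_pos by simp
  have lim: "(\<lambda>n. real n * p n powr (1 - 2 * l) / W n) \<longlonglongrightarrow> 1 / \<beta> (1 - 2 * l)" by (rule W_ratio)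
  have m20: "0 \<le> m2" by (rule regular_lil_bounds(4)[OF ind' wpos Wd lim gam Qb bpos D(2) q2 q1])
  have scale: "\<forall>\<^sub>F n in sequentially. 0 < lil_scale W n"
    by (rule regular_lil_bounds(3)[OF ind' wpos Wd lim gam Qb bpos D(2) q2 q1])
  \<comment> \<open>Only the order of magnitude matters; \<open>m2 + 1\<close> exceeds
    \<open>m2\<close> and is positive even if \<open>m2 = 0\<close>.\<close>
  have up: "AE \<omega> in M. \<forall>\<^sub>F n in sequentially. (\<Sum>i=1..n. Q i \<omega> - expectation (Q i)) \<le> (1 + 1) * sqrt (m2 + 1) * lil_scale W n"
    by (rule regular_lil_bounds(1)[OF ind' wpos Wd lim gam Qb bpos D(2) q2 q1]) (use m20 in auto)
  have ind'': "indep_vars (\<lambda>_. borel) (\<lambda>i \<omega>. - Q i \<omega>) {1..}" by (rule indep_vars_compose2[OF ind']) auto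
  have lo: "AE \<omega> in M. \<forall>\<^sub>F n in sequentially. (\<Sum>i=1..n. - Q i \<omega> - expectation (\<lambda>\<omega>. - Q i \<omega>)) \<le> (1 + 1) * sqrt (m2 + 1) * lil_scale W n"
    by (rule regular_lil_bounds(1)[OF ind'' wpos Wd lim gam _ bpos D(2), where ?s2.0=m2]) (use m20 Qb q2 q1 in auto)
  define N where "N = (\<lambda>n. real n * p n powr (1 - l))"
  have Npos: "0 < N n" if "1 \<le> n" for n using that p_pos[OF that] by (simp add: N_def)
  have sc: "(\<lambda>n. lil_scale W n / N n) \<longlonglongrightarrow> 0"
  proof -
    have "(\<lambda>n. real n powr (- \<kappa>) * ln (ln (real n))) \<longlonglongrightarrow> 0" using D(2) by real_asymp
    from tendsto_mult_left[OF this, of D]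
    have a1: "(\<lambda>n. D * (real n powr (- \<kappa>) * ln (ln (real n)))) \<longlonglongrightarrow> 0" by simp
    have a2: "\<forall>\<^sub>F n in sequentially. ln (ln (real n)) / (real n * p n) \<le> D * (real n powr (- \<kappa>) * ln (ln (real n)))"
      using eventually_lnln_pos eventually_ge_at_top[of 1]
    proof eventually_elim
      case (elim n)
      have "(1 / p n) * (ln (ln (real n)) / real n) \<le> (D * real n powr (1 - \<kappa>)) * (ln (ln (real n)) / real n)"
        using D(3)[OF elim(2)] divide_nonneg_nonneg[of "ln (ln (real n))" "real n"] elim(1) by (intro mult_right_mono) linarith+
      also have "\<dots> = D * (real n powr (- \<kappa>) * ln (ln (real n)))"
        using elim(2) by (simp add: powr_diff powr_minus field_simps)
      finally show ?case by (simp add: mult.commute)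
    qed
    have a3: "\<forall>\<^sub>F n in sequentially. 0 \<le> ln (ln (real n)) / (real n * p n)"
      using eventually_lnln_pos eventually_ge_at_top[of 1]
    proof eventually_elim
      case (elim n)
      then show ?case using p_pos[of n] by (intro divide_nonneg_nonneg mult_nonneg_nonneg) linarith+
    qed
    have L0: "(\<lambda>n. ln (ln (real n)) / (real n * p n)) \<longlonglongrightarrow> 0"
      by (rule tendsto_sandwich[OF a3 a2 tendsto_const a1])
    have "(\<lambda>n. sqrt (2 * ((1 / real n) * (\<Sum>i=1..n. (p i / p n) powr (1 - 2 * l))) * (ln (ln (real n)) / (real n * p n)))) \<longlonglongrightarrow> sqrt (2 * \<beta> (1 - 2 * l) * 0)"
      using l by (intro tendsto_real_sqrt tendsto_mult tendsto_const mean_lim L0) auto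
    moreover have "\<forall>\<^sub>F n in sequentially. sqrt (2 * ((1 / real n) * (\<Sum>i=1..n. (p i / p n) powr (1 - 2 * l))) * (ln (ln (real n)) / (real n * p n))) = lil_scale W n / N n"
      using eventually_ge_at_top[of 1]
    proof eventually_elim
      case (elim n)
      have "lil_scale W n / N n = sqrt (2 * W n * ln (ln (real n)) / (N n)\<^sup>2)"
        using Npos[OF elim] by (simp add: lil_scale_def real_sqrt_divide)
      also have "(N n)\<^sup>2 = (real n * p n powr (1 - 2 * l)) * (real n * p n)"
        unfolding N_def power_mult_distrib powr_one_minus_squared[OF p_pos[OF elim]] by (simp add: power2_eq_square)
      finally show ?case using elim p_pos[OF elim] by (simp add: W_eq[OF elim])
    qed
    ultimately show ?thesis by (simp add: tendsto_cong)
  qed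
  have mean: "(\<lambda>n. (\<Sum>i=1..n. expectation (Q i)) / N n) \<longlonglongrightarrow> \<beta> (1 - l) * m1"
  proof -
    have 1: "(\<lambda>n. (\<Sum>i=1..n. expectation (Q i)) / (\<Sum>i=1..n. p i powr (1 - l))) \<longlonglongrightarrow> m1"
    proof (rule weighted_cesaro)
      show "0 < p i powr (1 - l)" if "1 \<le> i" for i using p_pos[OF that] by simp
      show "filterlim (\<lambda>n. \<Sum>i=1..n. p i powr (1 - l)) at_top sequentially" using l by (intro sum_powr_top) auto
      have "\<forall>\<^sub>F i in sequentially. expectation (k i) / p i = expectation (Q i) / p i powr (1 - l)"
        using eventually_ge_at_top[of 1]
      proof eventually_elim
        case (elim i)
        then show ?case using p_pos[of i] by (simp add: EQ powr_diff powr_minus field_simps)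
      qed
      then show "(\<lambda>i. expectation (Q i) / p i powr (1 - l)) \<longlonglongrightarrow> m1" by (rule Lim_transform_eventually[OF mean_k])
    qed
    have "(\<lambda>n. ((1 / real n) * (\<Sum>i=1..n. (p i / p n) powr (1 - l))) * ((\<Sum>i=1..n. expectation (Q i)) / (\<Sum>i=1..n. p i powr (1 - l)))) \<longlonglongrightarrow> \<beta> (1 - l) * m1"
      using l by (intro tendsto_mult mean_lim 1) auto
    moreover have "\<forall>\<^sub>F n in sequentially. ((1 / real n) * (\<Sum>i=1..n. (p i / p n) powr (1 - l))) * ((\<Sum>i=1..n. expectation (Q i)) / (\<Sum>i=1..n. p i powr (1 - l))) = (\<Sum>i=1..n. expectation (Q i)) / N n"
      using eventually_ge_at_top[of 1]
    proof eventually_elim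
      case (elim n)
      let ?B = "(1 / real n) * (\<Sum>i=1..n. (p i / p n) powr (1 - l))"
      have e: "(\<Sum>i=1..n. p i powr (1 - l)) = N n * ?B" unfolding N_def by (rule sum_powr_eq[OF elim])
      have "0 < (\<Sum>i=1..n. p i powr (1 - l))" by (rule sum_powr_pos[OF elim])
      then have "?B \<noteq> 0" unfolding e by (metis mult_zero_right less_irrefl)
      moreover have "B * (S / (N n * B)) = S / N n" if "B \<noteq> 0" for B S using that by simp
      ultimately show ?case unfolding e by blast
    qed
    ultimately show ?thesis by (rule Lim_transform_eventually)
  qed
  show ?thesis using up lo
  proof eventually_elim
    case (elim \<omega>)
    define S where "S = (\<lambda>n. \<Sum>i=1..n. Q i \<omega> - expectation (Q i))"
    have "(\<lambda>n. S n / N n) \<longlonglongrightarrow> 0"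
    proof (rule Lim_null_comparison)
      show "\<forall>\<^sub>F n in sequentially. norm (S n / N n) \<le> (2 * sqrt (m2 + 1)) * (lil_scale W n / N n)"
        using elim eventually_ge_at_top[of 1]
      proof eventually_elim
        case (elim n)
        have "(\<Sum>i=1..n. - Q i \<omega> - expectation (\<lambda>\<omega>. - Q i \<omega>)) = - S n" unfolding S_def sum_negf[symmetric] by simp
        then have "\<bar>S n\<bar> \<le> (1 + 1) * sqrt (m2 + 1) * lil_scale W n"
          using elim(1,2) unfolding S_def by linarith
        then show ?case using Npos[OF elim(3)] by (simp add: abs_divide divide_right_mono)
      qed
      show "(\<lambda>n. (2 * sqrt (m2 + 1)) * (lil_scale W n / N n)) \<longlonglongrightarrow> 0"
        using tendsto_mult_left[OF sc, of "2 * sqrt (m2 + 1)"] by simp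
    qed
    from tendsto_add[OF this mean]
    have "(\<lambda>n. S n / N n + (\<Sum>i=1..n. expectation (Q i)) / N n) \<longlonglongrightarrow> \<beta> (1 - l) * m1" by simp
    moreover have "S n / N n + (\<Sum>i=1..n. expectation (Q i)) / N n = (\<Sum>i=1..n. p i powr (- l) * k i \<omega>) / (real n * p n powr (1 - l))" for n
      by (simp add: S_def N_def Q_def sum_subtractf add_divide_distrib[symmetric])
    ultimately show ?case by simp
  qed
qed

end

context weighted_noise
begin

section \<open>Bias, truncation and limit superior of the numerator\<close>

text \<open>For large \<open>n\<close> the quotient equals the mean in \<open>A_lim\<close> times
  \<open>sqrt (n * (h n)^2 * p n / (2 * B * ln (ln n)))\<close>, where \<open>B\<close> is the mean
  of exponent \<open>1 - 2 * l\<close>. The mean converges and the root tends to 0.\<close>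

lemma bias_sum_negligible: "(\<lambda>n. (\<Sum>i=1..n. h i * p i powr (1 - l)) / lil_scale W n) \<longlonglongrightarrow> 0"
proof -
  let ?A = "\<lambda>n. (1 / real n) * (\<Sum>i=1..n. (h i / h n) * (p i / p n) powr (1 - l))"
  let ?B = "\<lambda>n. (1 / real n) * (\<Sum>i=1..n. (p i / p n) powr (1 - 2 * l))"
  have L: "(\<lambda>n::nat. 1 / ln (ln (real n))) \<longlonglongrightarrow> 0" by real_asymp
  have "(\<lambda>n. sqrt (real n * (h n)\<^sup>2 * p n / (2 * ?B n) * (1 / ln (ln (real n)))) * ?A n) \<longlonglongrightarrow> sqrt (0 * 0 / (2 * \<beta> (1 - 2 * l)) * 0) * \<alpha>"
    using l beta_W_pos by (intro tendsto_mult[OF tendsto_real_sqrt A_lim] tendsto_mult tendsto_divide mean_lim L nh2 p_lim tendsto_const) auto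
  moreover have "\<forall>\<^sub>F n in sequentially. sqrt (real n * (h n)\<^sup>2 * p n / (2 * ?B n) * (1 / ln (ln (real n)))) * ?A n = (\<Sum>i=1..n. h i * p i powr (1 - l)) / lil_scale W n"
    using eventually_ge_at_top[of 1] eventually_lnln_pos
  proof eventually_elim
    case (elim n)
    have p: "0 < p n" and hn: "0 < h n" using p_pos h_pos elim by auto
    define N where "N = real n * h n * p n powr (1 - l)"
    have N: "0 < N" using p hn elim by (simp add: N_def)
    have "(h i / h n) * (p i / p n) powr (1 - l) = h i * p i powr (1 - l) / (h n * p n powr (1 - l))" for i
      by (simp add: powr_divide)
    then have A: "(\<Sum>i=1..n. h i * p i powr (1 - l)) = N * ?A n"
      using p hn elim by (simp add: N_def sum_divide_distrib[symmetric])
    have Bp: "0 < ?B n"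
    proof -
      have "0 < (\<Sum>i=1..n. (p i / p n) powr (1 - 2 * l))" 
      proof (intro sum_pos)
        show "0 < (p i / p n) powr (1 - 2 * l)" if "i \<in> {1..n}" for i using p p_pos[of i] that by simp
      qed (use elim in auto)
      then show ?thesis using elim by simp
    qed
    have N2: "N\<^sup>2 = (real n * (h n)\<^sup>2 * p n) * (real n * p n powr (1 - 2 * l))"
      unfolding N_def power_mult_distrib powr_one_minus_squared[OF p] by (simp add: power2_eq_square)
    define u where "u = real n * p n powr (1 - 2 * l)"
    have u: "0 < u" using p elim by (simp add: u_def)
    define LL where "LL = ln (ln (real n))"
    have LL: "0 < LL" using elim by (simp only: LL_def)
    have Wn: "W n = u * ?B n" unfolding u_def by (rule W_eq[OF elim(1)])
    have "N / lil_scale W n = sqrt (N\<^sup>2 / (2 * W n * LL))"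
      using N by (simp add: lil_scale_def real_sqrt_divide LL_def)
    also have "N\<^sup>2 / (2 * W n * LL) = real n * (h n)\<^sup>2 * p n / (2 * ?B n) * (1 / LL)"
      unfolding N2 Wn u_def[symmetric] using u Bp LL by simp
    finally have e: "N / lil_scale W n = sqrt (real n * (h n)\<^sup>2 * p n / (2 * ?B n) * (1 / LL))" .
    show ?case unfolding A LL_def[symmetric] e[symmetric] by (simp only: times_divide_eq_left)
  qed
  ultimately have "(\<lambda>n. (\<Sum>i=1..n. h i * p i powr (1 - l)) / lil_scale W n) \<longlonglongrightarrow> sqrt (0 * 0 / (2 * \<beta> (1 - 2 * l)) * 0) * \<alpha>"
    by (rule Lim_transform_eventually)
  then show ?thesis by simp
qed

text \<open>Markov's inequality with \<open>m \<ge> 3 / \<delta>\<close>, so that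
  \<open>i powr (\<delta> * m) \<ge> i ^ 3\<close>. The cube leaves a summable
  \<open>1 / i ^ 2\<close> after division by \<open>p i\<close>, since \<open>1 / p i\<close> is at
  most of order \<open>i\<close>.\<close>

lemma tail_moment_bound:
  assumes \<delta>: "0 < \<delta>"
  obtains D where "0 \<le> D"
    "\<And>i. 1 \<le> i \<Longrightarrow> integrable M (\<lambda>\<omega>. \<bar>R i \<omega>\<bar> ^ j * of_bool (real i powr \<delta> < \<bar>R i \<omega>\<bar>))"
    "\<And>i. 1 \<le> i \<Longrightarrow> expectation (\<lambda>\<omega>. \<bar>R i \<omega>\<bar> ^ j * of_bool (real i powr \<delta> < \<bar>R i \<omega>\<bar>)) \<le> D / real i ^ 3"
proof -
  define m where "m = nat \<lceil>3 / \<delta>\<rceil>"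
  have "3 / \<delta> \<le> real m" unfolding m_def by linarith
  then have m: "3 \<le> \<delta> * real m" using \<delta> by (simp add: field_simps)
  obtain D where D: "\<And>i. i \<ge> 1 \<Longrightarrow> integrable M (\<lambda>\<omega>. \<bar>R i \<omega>\<bar> ^ (j + m)) \<and> expectation (\<lambda>\<omega>. \<bar>R i \<omega>\<bar> ^ (j + m)) \<le> D"
    using moments[of "j + m"] by blast
  have "0 \<le> expectation (\<lambda>\<omega>. \<bar>R 1 \<omega>\<bar> ^ (j + m))" by (rule Bochner_Integration.integral_nonneg) simp
  then have D0: "0 \<le> D" by (rule order_trans[OF _ conjunct2[OF D[OF order_refl]]])
  show thesis
  proof (rule that[OF D0])
    fix i :: nat assume i: "1 \<le> i"
    have a: "0 < real i powr \<delta>" using i by simp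
    note t = expectation_tail_le[OF R_measurable[OF i] _ a, of j m]
    show "integrable M (\<lambda>\<omega>. \<bar>R i \<omega>\<bar> ^ j * of_bool (real i powr \<delta> < \<bar>R i \<omega>\<bar>))" using t(1) D[OF i] by blast
    have "expectation (\<lambda>\<omega>. \<bar>R i \<omega>\<bar> ^ j * of_bool (real i powr \<delta> < \<bar>R i \<omega>\<bar>)) \<le> expectation (\<lambda>\<omega>. \<bar>R i \<omega>\<bar> ^ (j + m)) / (real i powr \<delta>) ^ m"
      using t(2) D[OF i] by blast
    also have "\<dots> \<le> D / (real i powr \<delta>) ^ m" using D[OF i] a by (intro divide_right_mono) auto
    also have "\<dots> \<le> D / real i ^ 3"
    proof (rule divide_left_mono)
      have "real i ^ 3 = real i powr 3" using i by simp
      also have "\<dots> \<le> real i powr (\<delta> * real m)" using i m by (intro powr_mono) auto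
      also have "\<dots> = (real i powr \<delta>) ^ m" using i by (simp add: powr_power mult.commute)
      finally show "real i ^ 3 \<le> (real i powr \<delta>) ^ m" .
    qed (use D0 i in auto)
    finally show "expectation (\<lambda>\<omega>. \<bar>R i \<omega>\<bar> ^ j * of_bool (real i powr \<delta> < \<bar>R i \<omega>\<bar>)) \<le> D / real i ^ 3" .
  qed
qed

text \<open>Almost surely the part \<open>U\<close> beyond the truncation has finitely many nonzero
  terms, so the law is applied to the bounded part \<open>V\<close>. The mean of \<open>V\<close> is
  that of \<open>k * R\<close> minus that of \<open>U\<close>: a local bias of order
  \<open>h i * p i\<close> and a tail of order \<open>1 / i ^ 3\<close>.\<close>

lemma numerator_lil:
  "AE \<omega> in M. limsup (\<lambda>n. ereal ((\<Sum>i=1..n. p i powr (- l) * (k i \<omega> * R i \<omega>)) / lil_scale W n)) = ereal (sqrt s2)"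
proof -
  obtain D \<kappa> where D: "0 < D" "0 < \<kappa>" "\<And>i. 1 \<le> i \<Longrightarrow> 1 / p i \<le> D * real i powr (1 - \<kappa>)"
    using p_lower_bound by blast
  have pinv: "1 / p i \<le> D * real i" if "1 \<le> i" for i
  proof -
    have "real i powr (1 - \<kappa>) \<le> real i powr 1" using that D(2) by (intro powr_mono) auto
    then have "D * real i powr (1 - \<kappa>) \<le> D * real i" using D(1) by (intro mult_left_mono) auto
    then show ?thesis using D(3)[OF that] by linarith
  qed
  \<comment> \<open>Then \<open>V^2\<close> is at most \<open>b^2 * i powr (\<kappa> / 2)\<close>,
    which uses up half of the power gained in
    \<open>1 / p i \<le> D * i powr (1 - \<kappa>)\<close>.\<close>
  define \<delta> where "\<delta> = \<kappa> / 4"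
  have \<delta>: "0 < \<delta>" using D by (simp add: \<delta>_def)
  define big where "big = (\<lambda>i \<omega>. real i powr \<delta> < \<bar>R i \<omega>\<bar>)"
  \<comment> \<open>The orders 0, 1 and 2 control the probability of truncation, the mean of
    \<open>U\<close> and its second moment.\<close>
  obtain D0 where D0: "0 \<le> D0" "\<And>i. 1 \<le> i \<Longrightarrow> integrable M (\<lambda>\<omega>. \<bar>R i \<omega>\<bar> ^ 0 * of_bool (big i \<omega>))"
    "\<And>i. 1 \<le> i \<Longrightarrow> expectation (\<lambda>\<omega>. \<bar>R i \<omega>\<bar> ^ 0 * of_bool (big i \<omega>)) \<le> D0 / real i ^ 3"
    unfolding big_def using tail_moment_bound[OF \<delta>, of 0] by blast
  obtain D1 where D1: "0 \<le> D1" "\<And>i. 1 \<le> i \<Longrightarrow> integrable M (\<lambda>\<omega>. \<bar>R i \<omega>\<bar> ^ 1 * of_bool (big i \<omega>))"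
    "\<And>i. 1 \<le> i \<Longrightarrow> expectation (\<lambda>\<omega>. \<bar>R i \<omega>\<bar> ^ 1 * of_bool (big i \<omega>)) \<le> D1 / real i ^ 3"
    unfolding big_def using tail_moment_bound[OF \<delta>, of 1] by blast
  obtain D2 where D2: "0 \<le> D2" "\<And>i. 1 \<le> i \<Longrightarrow> integrable M (\<lambda>\<omega>. \<bar>R i \<omega>\<bar> ^ 2 * of_bool (big i \<omega>))"
    "\<And>i. 1 \<le> i \<Longrightarrow> expectation (\<lambda>\<omega>. \<bar>R i \<omega>\<bar> ^ 2 * of_bool (big i \<omega>)) \<le> D2 / real i ^ 3"
    unfolding big_def using tail_moment_bound[OF \<delta>, of 2] by blast
  have bigm[measurable]: "Measurable.pred M (big i)" if "1 \<le> i" for i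
  proof -
    note R_measurable[OF that, measurable]
    show ?thesis unfolding big_def by measurable
  qed
  define V where "V = (\<lambda>i \<omega>. k i \<omega> * (R i \<omega> * of_bool (\<not> big i \<omega>)))"
  define U where "U = (\<lambda>i \<omega>. k i \<omega> * (R i \<omega> * of_bool (big i \<omega>)))"
  \<comment> \<open>\<open>V\<close> and \<open>U\<close> are never both nonzero, so the square has
    no cross term.\<close>
  have VU: "k i \<omega> * R i \<omega> = V i \<omega> + U i \<omega>" and VU2: "(k i \<omega> * R i \<omega>)\<^sup>2 = (V i \<omega>)\<^sup>2 + (U i \<omega>)\<^sup>2" for i \<omega>
    by (auto simp: V_def U_def)
  have Vm[measurable]: "V i \<in> borel_measurable M" and Um[measurable]: "U i \<in> borel_measurable M" if "1 \<le> i" for i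
  proof -
    note k_measurable[OF that, measurable] R_measurable[OF that, measurable] bigm[OF that, measurable]
    show "V i \<in> borel_measurable M" "U i \<in> borel_measurable M" unfolding V_def U_def by measurable
  qed
  have Vle: "\<bar>V i \<omega>\<bar> \<le> b * real i powr \<delta>" for i \<omega>
    unfolding V_def abs_mult using k_le[of i \<omega>] k_nonneg[of i \<omega>] b_nonneg
    by (intro mult_mono) (auto simp: big_def not_less)
  have Ule: "\<bar>U i \<omega>\<bar> \<le> b * (\<bar>R i \<omega>\<bar> ^ 1 * of_bool (big i \<omega>))" and U2le: "(U i \<omega>)\<^sup>2 \<le> b\<^sup>2 * (\<bar>R i \<omega>\<bar> ^ 2 * of_bool (big i \<omega>))" for i \<omega>
  proof -
    show "\<bar>U i \<omega>\<bar> \<le> b * (\<bar>R i \<omega>\<bar> ^ 1 * of_bool (big i \<omega>))"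
      unfolding U_def abs_mult using k_le[of i \<omega>] k_nonneg[of i \<omega>] by (intro mult_mono) auto
    then have "\<bar>U i \<omega>\<bar>\<^sup>2 \<le> (b * (\<bar>R i \<omega>\<bar> ^ 1 * of_bool (big i \<omega>)))\<^sup>2" by (intro power_mono) auto
    then show "(U i \<omega>)\<^sup>2 \<le> b\<^sup>2 * (\<bar>R i \<omega>\<bar> ^ 2 * of_bool (big i \<omega>))" by (auto simp: power_mult_distrib)
  qed
  have Ui: "integrable M (U i)" and EU: "\<bar>expectation (U i)\<bar> \<le> b * D1 / real i ^ 3"
    and U2i: "integrable M (\<lambda>\<omega>. (U i \<omega>)\<^sup>2)" and EU2: "expectation (\<lambda>\<omega>. (U i \<omega>)\<^sup>2) \<le> b\<^sup>2 * D2 / real i ^ 3" if i: "1 \<le> i" for i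
  proof -
    note Um[OF i, measurable]
    have i1: "integrable M (\<lambda>\<omega>. b * (\<bar>R i \<omega>\<bar> ^ 1 * of_bool (big i \<omega>)))" using D1(2)[OF i] by (rule integrable_mult_right)
    have i2: "integrable M (\<lambda>\<omega>. b\<^sup>2 * (\<bar>R i \<omega>\<bar> ^ 2 * of_bool (big i \<omega>)))" using D2(2)[OF i] by (rule integrable_mult_right)
    show a: "integrable M (U i)"
      by (rule Bochner_Integration.integrable_bound[OF i1]) (use Ule b_nonneg in \<open>auto simp: abs_mult\<close>)
    show c: "integrable M (\<lambda>\<omega>. (U i \<omega>)\<^sup>2)"
      by (rule Bochner_Integration.integrable_bound[OF i2]) (use U2le in \<open>auto simp: abs_mult\<close>)
    have "\<bar>expectation (U i)\<bar> \<le> expectation (\<lambda>\<omega>. \<bar>U i \<omega>\<bar>)" using integral_norm_bound[of M "U i"] by simp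
    also have "\<dots> \<le> expectation (\<lambda>\<omega>. b * (\<bar>R i \<omega>\<bar> ^ 1 * of_bool (big i \<omega>)))"
      using a i1 Ule by (intro integral_mono integrable_abs) auto
    also have "\<dots> = b * expectation (\<lambda>\<omega>. \<bar>R i \<omega>\<bar> ^ 1 * of_bool (big i \<omega>))" by (rule integral_mult_right_zero)
    also have "\<dots> \<le> b * (D1 / real i ^ 3)" using D1(3)[OF i] b_nonneg by (intro mult_left_mono)
    finally show "\<bar>expectation (U i)\<bar> \<le> b * D1 / real i ^ 3" by simp
    have "expectation (\<lambda>\<omega>. (U i \<omega>)\<^sup>2) \<le> expectation (\<lambda>\<omega>. b\<^sup>2 * (\<bar>R i \<omega>\<bar> ^ 2 * of_bool (big i \<omega>)))"
      using c i2 U2le by (intro integral_mono)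
    also have "\<dots> = b\<^sup>2 * expectation (\<lambda>\<omega>. \<bar>R i \<omega>\<bar> ^ 2 * of_bool (big i \<omega>))" by (rule integral_mult_right_zero)
    also have "\<dots> \<le> b\<^sup>2 * (D2 / real i ^ 3)" using D2(3)[OF i] by (intro mult_left_mono) auto
    finally show "expectation (\<lambda>\<omega>. (U i \<omega>)\<^sup>2) \<le> b\<^sup>2 * D2 / real i ^ 3" by simp
  qed
  have Vi: "integrable M (V i)" and V2i: "integrable M (\<lambda>\<omega>. (V i \<omega>)\<^sup>2)" if i: "1 \<le> i" for i
  proof -
    note Vm[OF i, measurable]
    show "integrable M (V i)" by (rule integrable_bounded[OF _ Vle]) simp
    show "integrable M (\<lambda>\<omega>. (V i \<omega>)\<^sup>2)"
      by (rule integrable_bounded[where b="(b * real i powr \<delta>)\<^sup>2"]) (use power_mono[OF Vle, where n=2] in auto)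
  qed
  have EV: "expectation (V i) = expectation (\<lambda>\<omega>. k i \<omega> * R i \<omega>) - expectation (U i)"
    and EV2: "expectation (\<lambda>\<omega>. (V i \<omega>)\<^sup>2) = expectation (\<lambda>\<omega>. (k i \<omega> * R i \<omega>)\<^sup>2) - expectation (\<lambda>\<omega>. (U i \<omega>)\<^sup>2)" if i: "1 \<le> i" for i
  proof -
    show "expectation (V i) = expectation (\<lambda>\<omega>. k i \<omega> * R i \<omega>) - expectation (U i)"
      using Ui[OF i] Vi[OF i] unfolding VU by simp
    show "expectation (\<lambda>\<omega>. (V i \<omega>)\<^sup>2) = expectation (\<lambda>\<omega>. (k i \<omega> * R i \<omega>)\<^sup>2) - expectation (\<lambda>\<omega>. (U i \<omega>)\<^sup>2)"
      using U2i[OF i] V2i[OF i] unfolding VU2 by simp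
  qed
  have EVle: "\<forall>\<^sub>F i in sequentially. \<bar>expectation (V i)\<bar> \<le> C * (h i * p i) + b * D1 / real i ^ 3"
    using mean_kR eventually_ge_at_top[of 1]
  proof eventually_elim
    case (elim i)
    then show ?case using EV[OF elim(2)] EU[OF elim(2)] by linarith
  qed
  define Q where "Q = (\<lambda>i \<omega>. p i powr (- l) * V i \<omega>)"
  have sq: "(p i powr (- l) * y)\<^sup>2 / p i powr (1 - 2 * l) = y\<^sup>2 / p i" if "1 \<le> i" for i y
    using p_pos[OF that] by (rule weighted_square_div)
  have EQ: "expectation (Q i) = p i powr (- l) * expectation (V i)" for i by (simp add: Q_def)
  have indQ: "indep_vars (\<lambda>_. borel) Q {1..}"
    unfolding Q_def V_def big_def by (rule indep_kR[of "\<lambda>i x y. p i powr (- l) * (x * (y * of_bool (\<not> real i powr \<delta> < \<bar>y\<bar>)))"]) measurable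
  have Wd: "W = (\<lambda>n. \<Sum>i=1..n. p i powr (1 - 2 * l))" by (simp add: W_def)
  have Qb: "(Q i \<omega>)\<^sup>2 \<le> (b\<^sup>2 * D) * (p i powr (1 - 2 * l) * real i powr (1 - \<kappa> / 2))" if i: "1 \<le> i" for i \<omega>
  proof -
    have "(V i \<omega>)\<^sup>2 \<le> (b * real i powr \<delta>)\<^sup>2" using power_mono[OF Vle, where n=2, of i \<omega>] by simp
    also have "\<dots> = b\<^sup>2 * real i powr (\<kappa> / 2)" using i by (simp add: power_mult_distrib powr_power \<delta>_def)
    finally have v: "(V i \<omega>)\<^sup>2 \<le> b\<^sup>2 * real i powr (\<kappa> / 2)" .
    have "(Q i \<omega>)\<^sup>2 = (V i \<omega>)\<^sup>2 * (1 / p i) * p i powr (1 - 2 * l)" using sq[OF i, of "V i \<omega>"] p_pos[OF i] by (simp add: Q_def field_simps)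
    also have "\<dots> \<le> (b\<^sup>2 * real i powr (\<kappa> / 2)) * (D * real i powr (1 - \<kappa>)) * p i powr (1 - 2 * l)"
      using D(3)[OF i] v p_pos[OF i] by (intro mult_right_mono mult_mono) auto
    also have "\<dots> = (b\<^sup>2 * D) * (p i powr (1 - 2 * l) * (real i powr (\<kappa> / 2) * real i powr (1 - \<kappa>)))" by (simp only: mult_ac)
    also have "real i powr (\<kappa> / 2) * real i powr (1 - \<kappa>) = real i powr (1 - \<kappa> / 2)"
      unfolding powr_add[symmetric] by (rule arg_cong[where f="\<lambda>e. real i powr e"]) (simp add: field_simps)
    finally show ?thesis .
  qed
  have q2: "(\<lambda>i. expectation (\<lambda>\<omega>. (Q i \<omega>)\<^sup>2) / p i powr (1 - 2 * l)) \<longlonglongrightarrow> s2"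
  proof -
    have "(\<lambda>i. expectation (\<lambda>\<omega>. (U i \<omega>)\<^sup>2) / p i) \<longlonglongrightarrow> 0"
    proof (rule Lim_null_comparison)
      show "\<forall>\<^sub>F i in sequentially. norm (expectation (\<lambda>\<omega>. (U i \<omega>)\<^sup>2) / p i) \<le> b\<^sup>2 * D2 * D * (1 / real i ^ 2)"
        using eventually_ge_at_top[of 1]
      proof eventually_elim
        case (elim i)
        have "0 \<le> expectation (\<lambda>\<omega>. (U i \<omega>)\<^sup>2)" by simp
        then have "norm (expectation (\<lambda>\<omega>. (U i \<omega>)\<^sup>2) / p i) = expectation (\<lambda>\<omega>. (U i \<omega>)\<^sup>2) * (1 / p i)"
          using p_pos[OF elim] by simp
        also have "\<dots> \<le> (b\<^sup>2 * D2 / real i ^ 3) * (D * real i)"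
          using EU2[OF elim] pinv[OF elim] p_pos[OF elim] D2(1) by (intro mult_mono) auto
        also have "\<dots> = b\<^sup>2 * D2 * D * (1 / real i ^ 2)" using elim by (simp add: power3_eq_cube power2_eq_square)
        finally show ?case .
      qed
      have "(\<lambda>i. 1 / real i ^ 2) \<longlonglongrightarrow> 0" by real_asymp
      from tendsto_mult_left[OF this, of "b\<^sup>2 * D2 * D"] show "(\<lambda>i. b\<^sup>2 * D2 * D * (1 / real i ^ 2)) \<longlonglongrightarrow> 0" by simp
    qed
    from tendsto_diff[OF mean_kR2 this]
    have "(\<lambda>i. expectation (\<lambda>\<omega>. (k i \<omega> * R i \<omega>)\<^sup>2) / p i - expectation (\<lambda>\<omega>. (U i \<omega>)\<^sup>2) / p i) \<longlonglongrightarrow> s2" by simp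
    moreover have "\<forall>\<^sub>F i in sequentially. expectation (\<lambda>\<omega>. (k i \<omega> * R i \<omega>)\<^sup>2) / p i - expectation (\<lambda>\<omega>. (U i \<omega>)\<^sup>2) / p i = expectation (\<lambda>\<omega>. (Q i \<omega>)\<^sup>2) / p i powr (1 - 2 * l)"
      using eventually_ge_at_top[of 1]
    proof eventually_elim
      case (elim i)
      have "expectation (\<lambda>\<omega>. (Q i \<omega>)\<^sup>2) / p i powr (1 - 2 * l) = expectation (\<lambda>\<omega>. (Q i \<omega>)\<^sup>2 / p i powr (1 - 2 * l))" by simp
      also have "\<dots> = expectation (\<lambda>\<omega>. (V i \<omega>)\<^sup>2 / p i)" by (simp add: Q_def sq[OF elim])
      finally show ?case by (simp add: EV2[OF elim] diff_divide_distrib)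
    qed
    ultimately show ?thesis by (rule Lim_transform_eventually)
  qed
  \<comment> \<open>After division by \<open>p i\<close> the squared bias is of order
    \<open>h^2 * p \<le> i * h^2\<close>, which vanishes by \<open>nh2\<close>, and the squared tail
    is of order \<open>1 / i ^ 5\<close>.\<close>
  have q1: "(\<lambda>i. (expectation (Q i))\<^sup>2 / p i powr (1 - 2 * l)) \<longlonglongrightarrow> 0"
  proof (rule Lim_null_comparison)
    show "\<forall>\<^sub>F i in sequentially. norm ((expectation (Q i))\<^sup>2 / p i powr (1 - 2 * l)) \<le> 2 * C\<^sup>2 * (real i * (h i)\<^sup>2) + 2 * (b * D1)\<^sup>2 * D * (1 / real i ^ 5)"
      using EVle eventually_ge_at_top[of 1]
    proof eventually_elim
      case (elim i)
      have p: "0 < p i" by (rule p_pos[OF elim(2)])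
      have "norm ((expectation (Q i))\<^sup>2 / p i powr (1 - 2 * l)) = (expectation (V i))\<^sup>2 * (1 / p i)"
        unfolding EQ sq[OF elim(2)] using p by simp
      also have "(expectation (V i))\<^sup>2 \<le> (C * (h i * p i) + b * D1 / real i ^ 3)\<^sup>2"
        using power_mono[OF elim(1), of 2] by simp
      also have "\<dots> \<le> 2 * (C * (h i * p i))\<^sup>2 + 2 * (b * D1 / real i ^ 3)\<^sup>2" using zero_le_power2[of "C * (h i * p i) - b * D1 / real i ^ 3"] by (simp only: power2_sum power2_diff)
      finally have "norm ((expectation (Q i))\<^sup>2 / p i powr (1 - 2 * l)) \<le> (2 * (C * (h i * p i))\<^sup>2 + 2 * (b * D1 / real i ^ 3)\<^sup>2) * (1 / p i)"
        using p by (simp add: divide_right_mono)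
      also have "\<dots> = 2 * C\<^sup>2 * ((h i)\<^sup>2 * p i) + 2 * (b * D1 / real i ^ 3)\<^sup>2 * (1 / p i)"
        using p by (simp add: power2_eq_square field_simps)
      also have "\<dots> \<le> 2 * C\<^sup>2 * (real i * (h i)\<^sup>2) + 2 * (b * D1 / real i ^ 3)\<^sup>2 * (D * real i)"
      proof (intro add_mono mult_left_mono pinv[OF elim(2)])
        have "(h i)\<^sup>2 * p i \<le> (h i)\<^sup>2 * real i" using p_le_1[of i] elim(2) by (intro mult_left_mono) (auto intro: order_trans)
        then show "(h i)\<^sup>2 * p i \<le> real i * (h i)\<^sup>2" by (simp add: mult.commute)
      qed auto
      also have "2 * (b * D1 / real i ^ 3)\<^sup>2 * (D * real i) = 2 * (b * D1)\<^sup>2 * D * (1 / real i ^ 5)"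
        using elim(2) by (simp add: power_divide eval_nat_numeral)
      finally show ?case .
    qed
    have "(\<lambda>i. 1 / real i ^ 5) \<longlonglongrightarrow> 0" by real_asymp
    from tendsto_add[OF tendsto_mult_left[OF nh2, of "2 * C\<^sup>2"] tendsto_mult_left[OF this, of "2 * (b * D1)\<^sup>2 * D"]]
    show "(\<lambda>i. 2 * C\<^sup>2 * (real i * (h i)\<^sup>2) + 2 * (b * D1)\<^sup>2 * D * (1 / real i ^ 5)) \<longlonglongrightarrow> 0" by simp
  qed
  have bpos: "0 \<le> b\<^sup>2 * D" using D by simp
  have kp: "0 < \<kappa> / 2" using D by simp
  have wpos: "0 < p i powr (1 - 2 * l)" if "1 \<le> i" for i using p_pos[OF that] by simp
  have gam: "0 < 1 / \<beta> (1 - 2 * l)" using beta_W_pos by simp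
  have lil: "AE \<omega> in M. limsup (\<lambda>n. ereal ((\<Sum>i=1..n. Q i \<omega> - expectation (Q i)) / lil_scale W n)) = ereal (sqrt s2)"
    by (rule regular_lil[OF indQ wpos Wd W_ratio gam Qb bpos kp q2 q1])
  have bias: "(\<lambda>n. (\<Sum>i=1..n. expectation (Q i)) / lil_scale W n) \<longlonglongrightarrow> 0"
  proof -
    obtain i0 where i0: "\<And>i. i0 \<le> i \<Longrightarrow> \<bar>expectation (V i)\<bar> \<le> C * (h i * p i) + b * D1 / real i ^ 3"
      using EVle unfolding eventually_sequentially by blast
    define E0 where "E0 = (\<Sum>i<i0. \<bar>expectation (Q i)\<bar>)"
    define G where "G = (\<Sum>i. 1 / real i ^ 2)"
    have sG: "summable (\<lambda>i. 1 / real i ^ 2)" using inverse_power_summable[of 2, where 'a=real] by (simp add: divide_inverse)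
    \<comment> \<open>Three sources: the local bias, the tail beyond the truncation, and the indices
      below \<open>i0\<close>, to which the eventual bound on the mean does not extend.\<close>
    have term_le: "\<bar>expectation (Q i)\<bar> \<le> C * (h i * p i powr (1 - l)) + b * D1 * D * (1 / real i ^ 2) + (if i < i0 then \<bar>expectation (Q i)\<bar> else 0)"
      if i: "1 \<le> i" for i
    proof (cases "i < i0")
      case True
      then show ?thesis using C_nonneg h_pos[OF i] b_nonneg D1(1) D(1) by (simp add: add_increasing less_imp_le)
    next
      case False
      have p: "0 < p i" by (rule p_pos[OF i])
      have "\<bar>expectation (Q i)\<bar> = p i powr (- l) * \<bar>expectation (V i)\<bar>" by (simp add: EQ abs_mult)
      also have "\<dots> \<le> p i powr (- l) * (C * (h i * p i) + b * D1 / real i ^ 3)"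
        using i0[of i] False by (intro mult_left_mono) auto
      also have "\<dots> = C * (h i * (p i powr (- l) * p i powr 1)) + p i powr (- l) * (b * D1 / real i ^ 3)"
        using p by (simp add: algebra_simps)
      also have "p i powr (- l) * p i powr 1 = p i powr (1 - l)" unfolding powr_add[symmetric] by simp
      \<comment> \<open>Here \<open>p i powr (- l) \<le> 1 / p i \<le> D * i\<close> lowers the cube
        to a summable square.\<close>
      also have "p i powr (- l) * (b * D1 / real i ^ 3) \<le> (D * real i) * (b * D1 / real i ^ 3)"
        using inverse_p_powr_l_le[OF i] pinv[OF i] b_nonneg D1(1) by (intro mult_right_mono) auto
      also have "(D * real i) * (b * D1 / real i ^ 3) = b * D1 * D * (1 / real i ^ 2)"
        using i by (simp add: power3_eq_cube power2_eq_square)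
      finally show ?thesis using False by simp
    qed
    have sum_le: "\<bar>\<Sum>i=1..n. expectation (Q i)\<bar> \<le> C * (\<Sum>i=1..n. h i * p i powr (1 - l)) + (b * D1 * D * G + E0)" for n
    proof -
      have "\<bar>\<Sum>i=1..n. expectation (Q i)\<bar> \<le> (\<Sum>i=1..n. \<bar>expectation (Q i)\<bar>)" by (rule sum_abs)
      also have "\<dots> \<le> (\<Sum>i=1..n. C * (h i * p i powr (1 - l)) + b * D1 * D * (1 / real i ^ 2) + (if i < i0 then \<bar>expectation (Q i)\<bar> else 0))"
        by (intro sum_mono term_le) auto
      also have "\<dots> = C * (\<Sum>i=1..n. h i * p i powr (1 - l)) + b * D1 * D * (\<Sum>i=1..n. 1 / real i ^ 2) + (\<Sum>i=1..n. (if i < i0 then \<bar>expectation (Q i)\<bar> else 0))"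
        by (simp only: sum.distrib sum_distrib_left)
      also have "(\<Sum>i=1..n. 1 / real i ^ 2) \<le> G" unfolding G_def by (rule sum_le_suminf[OF sG]) auto
      also have "(\<Sum>i=1..n. (if i < i0 then \<bar>expectation (Q i)\<bar> else 0)) = (\<Sum>i\<in>{1..n} \<inter> {..<i0}. \<bar>expectation (Q i)\<bar>)"
        by (simp add: sum.inter_restrict lessThan_def)
      also have "\<dots> \<le> E0" unfolding E0_def by (intro sum_mono2) auto
      finally show ?thesis using b_nonneg D1(1) D(1) by (simp add: mult_left_mono add.assoc)
    qed
    have sc: "\<forall>\<^sub>F n in sequentially. 0 < lil_scale W n"
      using lil_scale_W_top by (simp add: filterlim_at_top_dense)
    show ?thesis
    proof (rule Lim_null_comparison)
      show "\<forall>\<^sub>F n in sequentially. norm ((\<Sum>i=1..n. expectation (Q i)) / lil_scale W n)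
        \<le> C * ((\<Sum>i=1..n. h i * p i powr (1 - l)) / lil_scale W n) + (b * D1 * D * G + E0) / lil_scale W n"
        using sc
      proof eventually_elim
        case (elim n)
        have "norm ((\<Sum>i=1..n. expectation (Q i)) / lil_scale W n) = \<bar>\<Sum>i=1..n. expectation (Q i)\<bar> / lil_scale W n" using elim by simp
        also have "\<dots> \<le> (C * (\<Sum>i=1..n. h i * p i powr (1 - l)) + (b * D1 * D * G + E0)) / lil_scale W n"
          using sum_le[of n] elim by (intro divide_right_mono) auto
        finally show ?case by (simp add: add_divide_distrib)
      qed
      have "(\<lambda>n. (b * D1 * D * G + E0) / lil_scale W n) \<longlonglongrightarrow> 0"
        by (intro tendsto_divide_0[OF tendsto_const] filterlim_at_top_imp_at_infinity lil_scale_W_top)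
      from tendsto_add[OF tendsto_mult_left[OF bias_sum_negligible, of C] this]
      show "(\<lambda>n. C * ((\<Sum>i=1..n. h i * p i powr (1 - l)) / lil_scale W n) + (b * D1 * D * G + E0) / lil_scale W n) \<longlonglongrightarrow> 0"
        by simp
    qed
  qed
  \<comment> \<open>The events are taken at \<open>Suc i\<close>, since measurability of
    \<open>big\<close> is established from index 1 on.\<close>
  have "AE \<omega> in M. \<forall>\<^sub>F i in sequentially. \<omega> \<in> space M - {\<omega> \<in> space M. big (Suc i) \<omega>}"
  proof (rule borel_cantelli_AE1)
    have pr: "prob {\<omega> \<in> space M. big i \<omega>} \<le> D0 / real i ^ 3" if i: "1 \<le> i" for i
    proof -
      note bigm[OF i, measurable]
      have "prob {\<omega> \<in> space M. big i \<omega>} = expectation (\<lambda>\<omega>. of_bool (big i \<omega>))"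
        by (rule expectation_of_bool(1)[symmetric]) measurable
      then show ?thesis using D0(3)[OF i] by simp
    qed
    have "summable (\<lambda>i. 1 / real i ^ 3)" using inverse_power_summable[of 3, where 'a=real] by (simp add: divide_inverse)
    then have "summable (\<lambda>i. D0 * (1 / real (Suc i) ^ 3))"
      by (intro summable_mult) (simp only: summable_Suc_iff[of "\<lambda>i. 1 / real i ^ 3"])
    then show "summable (\<lambda>i. prob {\<omega> \<in> space M. big (Suc i) \<omega>})"
    proof (rule summable_comparison_test'[where N=0])
      show "norm (prob {\<omega> \<in> space M. big (Suc i) \<omega>}) \<le> D0 * (1 / real (Suc i) ^ 3)" for i
        using pr[of "Suc i"] by simp
    qed
    show "{\<omega> \<in> space M. big (Suc i) \<omega>} \<in> sets M" for i using bigm[of "Suc i"] by simp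
  qed (simp add: emeasure_eq_measure)
  with lil show ?thesis
  proof eventually_elim
    case (elim \<omega>)
    obtain i0 where i0: "\<And>i. i0 \<le> i \<Longrightarrow> \<not> big (Suc i) \<omega>"
      using elim(2) unfolding eventually_sequentially by blast
    have "(\<lambda>n. (\<Sum>i=1..n. p i powr (- l) * U i \<omega>) / lil_scale W n) \<longlonglongrightarrow> 0"
    proof (rule Lim_transform_eventually)
      show "(\<lambda>n. (\<Sum>i=1..i0. p i powr (- l) * U i \<omega>) / lil_scale W n) \<longlonglongrightarrow> 0"
        by (intro tendsto_divide_0[OF tendsto_const] filterlim_at_top_imp_at_infinity lil_scale_W_top)
      show "\<forall>\<^sub>F n in sequentially. (\<Sum>i=1..i0. p i powr (- l) * U i \<omega>) / lil_scale W n = (\<Sum>i=1..n. p i powr (- l) * U i \<omega>) / lil_scale W n"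
        using eventually_ge_at_top[of i0]
      proof eventually_elim
        case (elim n)
        have "U i \<omega> = 0" if "i \<in> {1..n} - {1..i0}" for i
          using i0[of "i - 1"] that by (cases i) (auto simp: U_def)
        then have "(\<Sum>i=1..i0. p i powr (- l) * U i \<omega>) = (\<Sum>i=1..n. p i powr (- l) * U i \<omega>)"
          using elim by (intro sum.mono_neutral_left) auto
        then show ?case by simp
      qed
    qed
    \<comment> \<open>Two sequences that tend to 0 are added back, the means removed by centring and
      the part beyond the truncation; the limit superior stays the same.\<close>
    from tendsto_add[OF bias this]
    have "(\<lambda>n. ereal ((\<Sum>i=1..n. expectation (Q i)) / lil_scale W n + (\<Sum>i=1..n. p i powr (- l) * U i \<omega>) / lil_scale W n)) \<longlonglongrightarrow> ereal 0"
      by simp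
    from ereal_limsup_lim_add[OF this, of "\<lambda>n. ereal ((\<Sum>i=1..n. Q i \<omega> - expectation (Q i)) / lil_scale W n)"]
    have "limsup (\<lambda>n. ereal ((\<Sum>i=1..n. expectation (Q i)) / lil_scale W n + (\<Sum>i=1..n. p i powr (- l) * U i \<omega>) / lil_scale W n)
       + ereal ((\<Sum>i=1..n. Q i \<omega> - expectation (Q i)) / lil_scale W n)) = ereal (sqrt s2)"
      using elim(1) by simp
    moreover have "(\<Sum>i=1..n. expectation (Q i)) / lil_scale W n + (\<Sum>i=1..n. p i powr (- l) * U i \<omega>) / lil_scale W n
       + (\<Sum>i=1..n. Q i \<omega> - expectation (Q i)) / lil_scale W n = (\<Sum>i=1..n. p i powr (- l) * (k i \<omega> * R i \<omega>)) / lil_scale W n" for n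
      unfolding add_divide_distrib[symmetric]
      by (rule arg_cong[where f="\<lambda>u. u / lil_scale W n"]) (simp add: Q_def sum_subtractf sum.distrib distrib_left VU)
    ultimately show ?case by simp
  qed
qed

text \<open>The normalised quotient is eventually a convergent factor with limit
  \<open>c > 0\<close> times the quotient of \<open>numerator_lil\<close>, and such a factor may be
  taken out of a limit superior.\<close>

lemma ratio_lil:
  "AE \<omega> in M. limsup (\<lambda>n. ereal (sqrt (real n * p n / ln (ln (real n)))
      * ((\<Sum>i=1..n. p i powr (- l) * (k i \<omega> * R i \<omega>)) / (\<Sum>i=1..n. p i powr (- l) * k i \<omega>))))
    = ereal (sqrt (2 * \<beta> (1 - 2 * l) * s2) / (\<beta> (1 - l) * m1))"
  using denominator_limit numerator_lil
proof eventually_elim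
  case (elim \<omega>)
  let ?B = "\<lambda>n. (1 / real n) * (\<Sum>i=1..n. (p i / p n) powr (1 - 2 * l))"
  define N where "N = (\<lambda>n. real n * p n powr (1 - l))"
  define S where "S = (\<lambda>n. \<Sum>i=1..n. p i powr (- l) * (k i \<omega> * R i \<omega>))"
  define D where "D = (\<lambda>n. \<Sum>i=1..n. p i powr (- l) * k i \<omega>)"
  define d where "d = \<beta> (1 - l) * m1"
  have d: "0 < d" using beta_W_pos m1_pos by (simp add: d_def)
  have Dl: "(\<lambda>n. D n / N n) \<longlonglongrightarrow> d" using elim(1) by (simp add: D_def N_def d_def)
  define c where "c = sqrt (2 * \<beta> (1 - 2 * l)) / d"
  have c: "0 < c" using d beta_W_pos by (simp add: c_def)
  have "(\<lambda>n. sqrt (2 * ?B n) / (D n / N n)) \<longlonglongrightarrow> c"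
    unfolding c_def using d l by (intro tendsto_divide Dl tendsto_real_sqrt tendsto_mult tendsto_const mean_lim) auto
  then have "(\<lambda>n. ereal (sqrt (2 * ?B n) / (D n / N n))) \<longlonglongrightarrow> ereal c" by simp
  from ereal_limsup_lim_mult[OF this, of "\<lambda>n. ereal (S n / lil_scale W n)"]
  have "limsup (\<lambda>n. ereal (sqrt (2 * ?B n) / (D n / N n)) * ereal (S n / lil_scale W n)) = ereal c * ereal (sqrt s2)"
    using c elim(2) unfolding S_def by simp
  moreover have "limsup (\<lambda>n. ereal (sqrt (real n * p n / ln (ln (real n))) * (S n / D n)))
     = limsup (\<lambda>n. ereal (sqrt (2 * ?B n) / (D n / N n)) * ereal (S n / lil_scale W n))"
  proof (rule Limsup_eq)
    show "\<forall>\<^sub>F n in sequentially. ereal (sqrt (real n * p n / ln (ln (real n))) * (S n / D n))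
      = ereal (sqrt (2 * ?B n) / (D n / N n)) * ereal (S n / lil_scale W n)"
      using eventually_ge_at_top[of 1] eventually_lnln_pos
    proof eventually_elim
      case (elim n)
      have p: "0 < p n" by (rule p_pos[OF elim(1)])
      have N: "0 < N n" using p elim by (simp add: N_def)
      define LL where "LL = ln (ln (real n))"
      have LL: "0 < LL" using elim by (simp only: LL_def)
      have Wn: "0 < W n" by (rule W_pos[OF elim(1)])
      have sc: "lil_scale W n = sqrt (2 * W n * LL)" by (simp add: lil_scale_def LL_def)
      have sc0: "0 < lil_scale W n" unfolding sc using Wn LL by simp
      have "lil_scale W n * sqrt (real n * p n / LL) = sqrt (2 * W n * (real n * p n))"
        unfolding sc real_sqrt_mult[symmetric] using LL by simp
      also have "2 * W n * (real n * p n) = 2 * ?B n * (N n)\<^sup>2"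
      proof -
        have "(N n)\<^sup>2 = (real n * p n powr (1 - 2 * l)) * (real n * p n)"
          unfolding N_def power_mult_distrib powr_one_minus_squared[OF p] by (simp add: power2_eq_square)
        then show ?thesis unfolding W_eq[OF elim(1)] by (simp only: mult_ac)
      qed
      also have "sqrt (2 * ?B n * (N n)\<^sup>2) = sqrt (2 * ?B n) * N n" using N by (simp only: real_sqrt_mult real_sqrt_abs abs_of_pos)
      finally have "sqrt (real n * p n / LL) = sqrt (2 * ?B n) * N n / lil_scale W n"
        using sc0 by (simp add: field_simps)
      then have "sqrt (real n * p n / LL) * (S n / D n) = sqrt (2 * ?B n) / (D n / N n) * (S n / lil_scale W n)"
        by simp
      then show ?case by (simp add: LL_def)
    qed
  qed
  moreover have "c * sqrt s2 = sqrt (2 * \<beta> (1 - 2 * l) * s2) / (\<beta> (1 - l) * m1)"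
    by (simp add: c_def d_def real_sqrt_mult)
  ultimately show ?case by (simp add: S_def D_def)
qed

end

section \<open>Conditional expectations near the point\<close>

text \<open>The factor \<open>G (U \<omega>)\<close> is measurable for the sigma-algebra generated
  by \<open>U\<close>, so it can be taken out of the conditional expectation. It is bounded, so the
  products inherit integrability. When \<open>G\<close> vanishes off a small ball, only the values
  of \<open>g\<close> on that ball matter.\<close>

lemma (in prob_space) cond_exp_given_integral:
  assumes ce: "cond_exp_given M S U Z g" and U[measurable]: "U \<in> measurable M S"
    and G[measurable]: "G \<in> borel_measurable S" and Gb: "\<And>u. \<bar>G u\<bar> \<le> B"
  shows "integrable M (\<lambda>\<omega>. G (U \<omega>) * Z \<omega>)" and "integrable M (\<lambda>\<omega>. G (U \<omega>) * g (U \<omega>))"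
    and "expectation (\<lambda>\<omega>. G (U \<omega>) * Z \<omega>) = expectation (\<lambda>\<omega>. G (U \<omega>) * g (U \<omega>))"
proof -
  have Zi: "integrable M Z" and g[measurable]: "g \<in> borel_measurable S"
    and AE: "AE \<omega> in M. real_cond_exp M (vimage_algebra (space M) U S) Z \<omega> = g (U \<omega>)"
    using ce unfolding cond_exp_given_def by auto
  have sub: "subalgebra M (vimage_algebra (space M) U S)"
    unfolding subalgebra_def using sets_image_in_sets[OF refl U] by simp
  interpret finite_measure_subalgebra M "vimage_algebra (space M) U S" by unfold_locales (rule sub)
  have Um: "U \<in> measurable (vimage_algebra (space M) U S) S"
    using measurable_space[OF U] by (intro measurable_vimage_algebra1) auto
  have GU: "(\<lambda>\<omega>. G (U \<omega>)) \<in> borel_measurable (vimage_algebra (space M) U S)"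
    by (rule measurable_compose[OF Um G])
  have Zm[measurable]: "Z \<in> borel_measurable M" using Zi by auto
  show i: "integrable M (\<lambda>\<omega>. G (U \<omega>) * Z \<omega>)"
  proof (rule Bochner_Integration.integrable_bound[where f="\<lambda>\<omega>. B * Z \<omega>"])
    show "AE \<omega> in M. norm (G (U \<omega>) * Z \<omega>) \<le> norm (B * Z \<omega>)"
      using Gb by (intro AE_I2) (auto simp: abs_mult intro!: mult_right_mono order_trans[OF Gb])
  qed (use Zi in auto)
  note c = real_cond_exp_intg[OF i GU Zm]
  have AE': "AE \<omega> in M. G (U \<omega>) * real_cond_exp M (vimage_algebra (space M) U S) Z \<omega> = G (U \<omega>) * g (U \<omega>)"
    using AE by eventually_elim simp
  show "integrable M (\<lambda>\<omega>. G (U \<omega>) * g (U \<omega>))"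
    by (rule integrable_cong_AE_imp[OF c(1) _ AE']) measurable
  show "expectation (\<lambda>\<omega>. G (U \<omega>) * Z \<omega>) = expectation (\<lambda>\<omega>. G (U \<omega>) * g (U \<omega>))"
    unfolding c(2)[symmetric] by (rule integral_cong_AE[OF _ _ AE']) (use c(1) in measurable)
qed

text \<open>\<open>(y + \<bar>c\<bar>) ^ m\<close> is eventually below
  \<open>exp (lam * y powr \<mu>)\<close>, and a constant bounds the power for smaller values of
  \<open>\<bar>Y \<omega>\<bar>\<close>.\<close>

lemma (in prob_space) exp_moment_imp_moments:
  fixes Y :: "'a \<Rightarrow> real"
  assumes Y[measurable]: "Y \<in> borel_measurable M" and pos: "0 < lam" "0 < \<mu>"
    and i: "integrable M (\<lambda>\<omega>. exp (lam * \<bar>Y \<omega>\<bar> powr \<mu>))"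
  shows "integrable M (\<lambda>\<omega>. \<bar>Y \<omega> - c\<bar> ^ m)"
proof -
  have "((\<lambda>y. (y + \<bar>c\<bar>) ^ m * exp (- lam * y powr \<mu>)) \<longlongrightarrow> 0) at_top"
    using pos by real_asymp
  then have "\<forall>\<^sub>F y in at_top. (y + \<bar>c\<bar>) ^ m * exp (- lam * y powr \<mu>) < 1" by (rule order_tendstoD) simp
  then obtain y0 where y0: "\<And>y. y0 \<le> y \<Longrightarrow> (y + \<bar>c\<bar>) ^ m * exp (- lam * y powr \<mu>) < 1"
    unfolding eventually_at_top_linorder by blast
  have bound: "\<bar>y - c\<bar> ^ m \<le> (\<bar>y0\<bar> + \<bar>c\<bar>) ^ m + exp (lam * \<bar>y\<bar> powr \<mu>)" for y
  proof (cases "y0 \<le> \<bar>y\<bar>")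
    case True
    have "\<bar>y - c\<bar> ^ m \<le> (\<bar>y\<bar> + \<bar>c\<bar>) ^ m" by (intro power_mono) auto
    also have "\<dots> \<le> exp (lam * \<bar>y\<bar> powr \<mu>)" using y0[OF True] by (simp add: exp_minus field_simps)
    finally show ?thesis by (simp add: add_increasing)
  next
    case False
    have "\<bar>y - c\<bar> ^ m \<le> (\<bar>y0\<bar> + \<bar>c\<bar>) ^ m" using False by (intro power_mono) auto
    then show ?thesis by (simp add: add_increasing2)
  qed
  show ?thesis
  proof (rule Bochner_Integration.integrable_bound)
    show "integrable M (\<lambda>\<omega>. (\<bar>y0\<bar> + \<bar>c\<bar>) ^ m + exp (lam * \<bar>Y \<omega>\<bar> powr \<mu>))" using i by simp
    show "AE \<omega> in M. norm (\<bar>Y \<omega> - c\<bar> ^ m) \<le> norm ((\<bar>y0\<bar> + \<bar>c\<bar>) ^ m + exp (lam * \<bar>Y \<omega>\<bar> powr \<mu>))"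
      using bound by (intro AE_I2) (auto intro: order_trans)
  qed simp
qed

text \<open>The derivative is twice the product of \<open>K\<close> and its derivative, and the
  bounded factor \<open>K\<close> preserves integrability. This makes the kernel limit available for
  the square, whence \<open>M2\<close>.\<close>

lemma unit_deriv_square:
  fixes K :: "real \<Rightarrow> real"
  assumes K: "K differentiable_on {0..1}" and i: "set_integrable lborel {0..1} (unit_deriv K)"
    and b: "\<And>t. \<bar>K t\<bar> \<le> b"
  shows "(\<lambda>u. (K u)\<^sup>2) differentiable_on {0..1}" and "set_integrable lborel {0..1} (unit_deriv (\<lambda>u. (K u)\<^sup>2))"
proof -
  show "(\<lambda>u. (K u)\<^sup>2) differentiable_on {0..1}"
    using K unfolding differentiable_on_def by (auto intro: differentiable_power)
  have d: "unit_deriv (\<lambda>u. (K u)\<^sup>2) s = 2 * K s * unit_deriv K s" if s: "s \<in> {0..1}" for s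
  proof (rule vector_derivative_within_closed_interval[OF _ s])
    have "(K has_vector_derivative unit_deriv K s) (at s within {0..1})"
      using K s unfolding differentiable_on_def by (subst vector_derivative_works[symmetric]) auto
    then have "(K has_field_derivative unit_deriv K s) (at s within {0..1})"
      by (simp add: has_real_derivative_iff_has_vector_derivative)
    then have "((\<lambda>u. (K u)\<^sup>2) has_field_derivative 2 * K s * unit_deriv K s) (at s within {0..1})"
      by (auto intro!: derivative_eq_intros)
    then show "((\<lambda>u. (K u)\<^sup>2) has_vector_derivative 2 * K s * unit_deriv K s) (at s within {0..1})"
      by (simp add: has_real_derivative_iff_has_vector_derivative)
  qed simp
  have "continuous_on {0..1} K" using K by (rule differentiable_imp_continuous_on)
  then have Km[measurable]: "(\<lambda>s. indicator {0..1} s *\<^sub>R K s) \<in> borel_measurable borel"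
    by (intro borel_measurable_continuous_on_indicator) auto
  have i': "integrable lborel (\<lambda>s. indicator {0..1} s *\<^sub>R unit_deriv K s)" using i by (simp add: set_integrable_def)
  have "integrable lborel (\<lambda>s. 2 * (indicator {0..1} s *\<^sub>R K s) * (indicator {0..1} s *\<^sub>R unit_deriv K s))"
  proof (rule Bochner_Integration.integrable_bound)
    show "integrable lborel (\<lambda>s. 2 * b * (indicator {0..1} s *\<^sub>R unit_deriv K s))" using i' by (intro integrable_mult_right)
    show "AE s in lborel. norm (2 * (indicator {0..1} s *\<^sub>R K s) * (indicator {0..1} s *\<^sub>R unit_deriv K s))
       \<le> norm (2 * b * (indicator {0..1} s *\<^sub>R unit_deriv K s))"
      using b by (intro AE_I2) (auto simp: indicator_def abs_mult intro!: mult_right_mono order_trans[OF b])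
  qed (use i' in measurable)
  also have "(\<lambda>s. 2 * (indicator {0..1} s *\<^sub>R K s) * (indicator {0..1} s *\<^sub>R unit_deriv K s))
     = (\<lambda>s. indicator {0..1} s *\<^sub>R unit_deriv (\<lambda>u. (K u)\<^sup>2) s)"
    by (rule ext) (auto simp: indicator_def d)
  finally show "set_integrable lborel {0..1} (unit_deriv (\<lambda>u. (K u)\<^sup>2))" by (simp add: set_integrable_def)
qed

lemma borel_measurable_shift:
  fixes N :: "'e::real_normed_vector \<Rightarrow> real"
  assumes "N \<in> borel_measurable borel"
  shows "(\<lambda>y. N (y - x)) \<in> borel_measurable borel"
proof -
  have "(\<lambda>y. y - x) \<in> borel_measurable borel" by (intro borel_measurable_continuous_onI continuous_intros)
  from measurable_compose[OF this assms] show ?thesis .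
qed

lemma expectation_abs_le:
  fixes f g :: "'a \<Rightarrow> real"
  assumes "integrable M f" "integrable M g" "\<And>\<omega>. \<omega> \<in> space M \<Longrightarrow> \<bar>f \<omega>\<bar> \<le> g \<omega>"
  shows "\<bar>\<integral>\<omega>. f \<omega> \<partial>M\<bar> \<le> (\<integral>\<omega>. g \<omega> \<partial>M)"
proof -
  have "\<bar>\<integral>\<omega>. f \<omega> \<partial>M\<bar> \<le> (\<integral>\<omega>. \<bar>f \<omega>\<bar> \<partial>M)" using integral_norm_bound[of M f] by simp
  also have "\<dots> \<le> (\<integral>\<omega>. g \<omega> \<partial>M)" using assms by (intro integral_mono integrable_abs) auto
  finally show ?thesis .
qed

text \<open>The value \<open>\<phi> 0\<close> is forced to be 0 although \<open>T = 0\<close> is a null event: \<open>\<phi>\<close> is continuous at 0 and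
  averages of \<open>\<phi>(T)\<close> over small balls agree with those of \<open>r(X) - r(x)\<close>.\<close>

lemma (in prob_space) local_bias:
  fixes N :: "'e::real_normed_vector \<Rightarrow> real" and X :: "'a \<Rightarrow> 'e"
  assumes X[measurable]: "X \<in> measurable M borel" and N[measurable]: "N \<in> borel_measurable borel" and N0: "\<And>y. 0 \<le> N y"
    and reg: "cond_exp_given M borel X Y r"
    and phi: "cond_exp_given M borel (\<lambda>\<omega>. N (X \<omega> - x)) (\<lambda>\<omega>. r (X \<omega>) - r x) \<phi>"
    and phi_diff: "\<phi> differentiable (at 0 within {0..})"
    and Fpos: "\<And>t. 0 < t \<Longrightarrow> 0 < prob {\<omega> \<in> space M. N (X \<omega> - x) \<le> t}"
    and rcont: "\<And>e. 0 < e \<Longrightarrow> \<exists>d>0. \<forall>y. N (y - x) < d \<longrightarrow> \<bar>r y - r x\<bar> < e"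
    and K[measurable]: "K \<in> borel_measurable borel" and Kb: "\<And>t. \<bar>K t\<bar> \<le> b" and K0: "\<And>t. 1 < t \<Longrightarrow> K t = 0"
  shows "\<exists>C\<ge>0. \<exists>\<delta>>0. \<forall>h. 0 < h \<and> h < \<delta> \<longrightarrow>
    \<bar>expectation (\<lambda>\<omega>. K (N (X \<omega> - x) / h) * (Y \<omega> - r x))\<bar> \<le> C * (h * prob {\<omega> \<in> space M. N (X \<omega> - x) \<le> h})"
proof -
  define T where "T = (\<lambda>\<omega>. N (X \<omega> - x))"
  note Nm[measurable] = borel_measurable_shift[OF N, of x]
  have Tm[measurable]: "T \<in> borel_measurable M" unfolding T_def by measurable
  define F where "F = (\<lambda>t. prob {\<omega> \<in> space M. T \<omega> \<le> t})"
  have ob: "expectation (\<lambda>\<omega>. of_bool (T \<omega> \<le> t)) = F t" "integrable M (\<lambda>\<omega>. of_bool (T \<omega> \<le> t) :: real)" for t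
    unfolding F_def by (intro expectation_of_bool, measurable)+
  have Yi: "integrable M Y" using reg by (simp add: cond_exp_given_def)
  have ri: "integrable M (\<lambda>\<omega>. r (X \<omega>) - r x)" using phi by (simp add: cond_exp_given_def)
  have phi': "cond_exp_given M borel T (\<lambda>\<omega>. r (X \<omega>) - r x) \<phi>" using phi by (simp add: T_def)
  obtain D where "(\<phi> has_field_derivative D) (at 0 within {0..})"
    using phi_diff by (auto simp: real_differentiable_def)
  then have "((\<lambda>t. (\<phi> t - \<phi> 0) / (t - 0)) \<longlongrightarrow> D) (at 0 within {0..})" by (simp add: has_field_derivative_iff)
  then have "\<forall>\<^sub>F t in at 0 within {0..}. dist ((\<phi> t - \<phi> 0) / (t - 0)) D < 1" by (rule tendstoD) simp
  then obtain d where d: "0 < d" "\<And>t. 0 \<le> t \<Longrightarrow> t \<noteq> 0 \<Longrightarrow> t < d \<Longrightarrow> \<bar>(\<phi> t - \<phi> 0) / t - D\<bar> < 1"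
    unfolding eventually_at by (auto simp: dist_real_def)
  \<comment> \<open>A Lipschitz constant of \<open>\<phi>\<close> at 0; the 1 is the tolerance
    granted to the difference quotient.\<close>
  define C where "C = \<bar>D\<bar> + 1"
  have C0: "0 < C" by (simp add: C_def)
  have lip: "\<bar>\<phi> t - \<phi> 0\<bar> \<le> C * t" if "0 \<le> t" "t < d" for t
  proof (cases "t = 0")
    case False
    then have "\<bar>(\<phi> t - \<phi> 0) / t\<bar> \<le> C" using d(2)[of t] that by (simp add: C_def)
    then show ?thesis using False that by (simp add: abs_divide pos_divide_le_eq)
  qed simp
  have phi0: "\<phi> 0 = 0"
  proof (rule ccontr)
    assume ne: "\<phi> 0 \<noteq> 0"
    \<comment> \<open>Replacing \<open>r (X \<omega>) - r x\<close> by 0 and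
      \<open>\<phi> (T \<omega>)\<close> by \<open>\<phi> 0\<close> costs at most
      \<open>e * F \<eta>\<close> each. This gives \<open>\<bar>\<phi> 0\<bar> \<le> 2 * e\<close>,
      a contradiction for a third of \<open>\<bar>\<phi> 0\<bar>\<close>.\<close>
    define e where "e = \<bar>\<phi> 0\<bar> / 3"
    have e: "0 < e" using ne by (simp add: e_def)
    obtain d' where d': "0 < d'" "\<And>y. N (y - x) < d' \<Longrightarrow> \<bar>r y - r x\<bar> < e" using rcont[OF e] by blast
    define \<eta> where "\<eta> = min (min (d / 2) (d' / 2)) (e / C)"
    have eta: "0 < \<eta>" "\<eta> < d" "\<eta> < d'" "C * \<eta> \<le> e"
    proof -
      show "0 < \<eta>" "\<eta> < d" "\<eta> < d'" using d d' e C0 by (auto simp: \<eta>_def)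
      have "\<eta> \<le> e / C" by (simp add: \<eta>_def)
      then show "C * \<eta> \<le> e" using C0 by (simp add: field_simps)
    qed
    define G where "G = (\<lambda>t::real. of_bool (t \<le> \<eta>) :: real)"
    have Gm[measurable]: "G \<in> borel_measurable borel" unfolding G_def by measurable
    have Gb: "\<bar>G t\<bar> \<le> 1" for t by (simp add: G_def)
    note ce = cond_exp_given_integral[OF phi' Tm Gm Gb]
    have iG: "integrable M (\<lambda>\<omega>. e * G (T \<omega>))" unfolding G_def using ob(2) by (rule integrable_mult_right)
    have EG: "expectation (\<lambda>\<omega>. e * G (T \<omega>)) = e * F \<eta>" unfolding G_def using ob(1)[of \<eta>] by simp
    have 1: "\<bar>expectation (\<lambda>\<omega>. G (T \<omega>) * (r (X \<omega>) - r x))\<bar> \<le> e * F \<eta>"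
      unfolding EG[symmetric]
    proof (rule expectation_abs_le[OF ce(1) iG])
      fix \<omega> show "\<bar>G (T \<omega>) * (r (X \<omega>) - r x)\<bar> \<le> e * G (T \<omega>)"
        using d'(2)[of "X \<omega>"] eta by (auto simp: G_def T_def less_imp_le)
    qed
    have i0: "integrable M (\<lambda>\<omega>. \<phi> 0 * G (T \<omega>))" unfolding G_def using ob(2) by (rule integrable_mult_right)
    have 2: "\<bar>expectation (\<lambda>\<omega>. \<phi> 0 * G (T \<omega>) - G (T \<omega>) * \<phi> (T \<omega>))\<bar> \<le> e * F \<eta>"
      unfolding EG[symmetric]
    proof (rule expectation_abs_le[OF Bochner_Integration.integrable_diff[OF i0 ce(2)] iG])
      fix \<omega> show "\<bar>\<phi> 0 * G (T \<omega>) - G (T \<omega>) * \<phi> (T \<omega>)\<bar> \<le> e * G (T \<omega>)"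
      proof (cases "T \<omega> \<le> \<eta>")
        case True
        have T0: "0 \<le> T \<omega>" using N0 by (simp add: T_def)
        have "\<bar>\<phi> (T \<omega>) - \<phi> 0\<bar> \<le> C * T \<omega>" using True eta by (intro lip T0) auto
        also have "\<dots> \<le> C * \<eta>" using True C0 by (intro mult_left_mono) auto
        also have "\<dots> \<le> e" by (rule eta)
        finally show ?thesis using True by (simp add: G_def abs_minus_commute)
      qed (simp add: G_def)
    qed
    have "expectation (\<lambda>\<omega>. \<phi> 0 * G (T \<omega>) - G (T \<omega>) * \<phi> (T \<omega>)) = \<phi> 0 * F \<eta> - expectation (\<lambda>\<omega>. G (T \<omega>) * \<phi> (T \<omega>))"
      using i0 ce(2) ob(1)[of \<eta>] by (simp add: G_def)
    with 1 2 have "\<bar>\<phi> 0 * F \<eta>\<bar> \<le> 2 * (e * F \<eta>)" unfolding ce(3) by linarith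
    moreover have "0 < F \<eta>" using Fpos[OF eta(1)] by (simp add: F_def T_def)
    ultimately have "\<bar>\<phi> 0\<bar> \<le> 2 * e" by (simp add: abs_mult)
    then show False using e by (simp add: e_def)
  qed
  have b0: "0 \<le> b" using Kb[of 0] by linarith
  have "\<bar>expectation (\<lambda>\<omega>. K (N (X \<omega> - x) / h) * (Y \<omega> - r x))\<bar> \<le> b * C * (h * prob {\<omega> \<in> space M. N (X \<omega> - x) \<le> h})"
    if h: "0 < h" "h < d" for h
  proof -
    have Km: "(\<lambda>t. K (t / h)) \<in> borel_measurable borel" by measurable
    have Km': "(\<lambda>y. K (N (y - x) / h)) \<in> borel_measurable borel" by measurable
    note ce1 = cond_exp_given_integral[OF reg X Km' Kb, folded T_def]
    have ce1': "integrable M (\<lambda>\<omega>. K (T \<omega> / h) * Y \<omega>)" "integrable M (\<lambda>\<omega>. K (T \<omega> / h) * r (X \<omega>))"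
      "expectation (\<lambda>\<omega>. K (T \<omega> / h) * Y \<omega>) = expectation (\<lambda>\<omega>. K (T \<omega> / h) * r (X \<omega>))"
      using ce1 by (simp_all add: T_def)
    note ce2 = cond_exp_given_integral[OF phi' Tm Km Kb]
    have Ki: "integrable M (\<lambda>\<omega>. K (T \<omega> / h))" by (rule integrable_bounded[OF _ Kb]) measurable
    \<comment> \<open>Two conditionings: on \<open>X\<close>, which turns \<open>Y\<close> into
      \<open>r (X \<omega>)\<close>, then on \<open>T\<close>, which turns
      \<open>r (X \<omega>) - r x\<close> into \<open>\<phi> (T \<omega>)\<close>. The kernel weight
      is a function of \<open>T\<close>, hence also of \<open>X\<close>.\<close>
    have "expectation (\<lambda>\<omega>. K (T \<omega> / h) * (Y \<omega> - r x)) = expectation (\<lambda>\<omega>. K (T \<omega> / h) * (r (X \<omega>) - r x))"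
      using ce1' Ki by (simp add: right_diff_distrib)
    also have "\<dots> = expectation (\<lambda>\<omega>. K (T \<omega> / h) * \<phi> (T \<omega>))" by (rule ce2(3))
    finally have "\<bar>expectation (\<lambda>\<omega>. K (T \<omega> / h) * (Y \<omega> - r x))\<bar> = \<bar>expectation (\<lambda>\<omega>. K (T \<omega> / h) * \<phi> (T \<omega>))\<bar>" by simp
    also have "\<dots> \<le> expectation (\<lambda>\<omega>. b * C * h * of_bool (T \<omega> \<le> h))"
    proof (rule expectation_abs_le[OF ce2(2) integrable_mult_right[OF ob(2)]])
      fix \<omega> show "\<bar>K (T \<omega> / h) * \<phi> (T \<omega>)\<bar> \<le> b * C * h * of_bool (T \<omega> \<le> h)"
      proof (cases "T \<omega> \<le> h")
        case True
        have T0: "0 \<le> T \<omega>" using N0 by (simp add: T_def)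
        have "\<bar>\<phi> (T \<omega>)\<bar> \<le> C * T \<omega>" using lip[OF T0] True h phi0 by simp
        also have "\<dots> \<le> C * h" using True C0 by (intro mult_left_mono) auto
        finally have "\<bar>K (T \<omega> / h)\<bar> * \<bar>\<phi> (T \<omega>)\<bar> \<le> b * (C * h)" using Kb b0 by (intro mult_mono) auto
        then show ?thesis using True by (simp add: abs_mult mult.assoc)
      next
        case False
        then have "1 < T \<omega> / h" using h by (simp add: field_simps)
        then show ?thesis using False by (simp add: K0)
      qed
    qed
    also have "\<dots> = b * C * h * F h" using ob(1)[of h] by simp
    finally show ?thesis by (simp add: T_def F_def mult.assoc)
  qed
  moreover have "0 \<le> b * C" using b0 C0 by simp
  ultimately show ?thesis using d(1) by blast
qed

text \<open>Expand \<open>Y - r x\<close> as \<open>r (X \<omega>) - r x\<close> plus noise. The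
  cross term vanishes by conditioning on \<open>X\<close>. The kernel vanishes outside the ball of
  radius \<open>h\<close>; inside it, continuity makes the first square small and
  \<open>\<sigma>2 (X \<omega>)\<close> close to \<open>\<sigma>2 x\<close>. The error is relative
  to the second moment of the kernel weight, whose ratio to the small ball probability has a
  limit.\<close>

lemma (in prob_space) local_variance:
  fixes N :: "'e::real_normed_vector \<Rightarrow> real" and X :: "'a \<Rightarrow> 'e"
  assumes X[measurable]: "X \<in> measurable M borel" and N[measurable]: "N \<in> borel_measurable borel"
    and r[measurable]: "r \<in> borel_measurable borel"
    and model: "\<And>\<omega>. \<omega> \<in> space M \<Longrightarrow> Y \<omega> = r (X \<omega>) + \<epsilon> \<omega>"
    and noise: "cond_exp_given M borel X \<epsilon> (\<lambda>_. 0)" "cond_exp_given M borel X (\<lambda>\<omega>. (\<epsilon> \<omega>)\<^sup>2) \<sigma>2"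
    and rcont: "\<And>e. 0 < e \<Longrightarrow> \<exists>d>0. \<forall>y. N (y - x) < d \<longrightarrow> \<bar>r y - r x\<bar> < e"
    and scont: "\<And>e. 0 < e \<Longrightarrow> \<exists>d>0. \<forall>y. N (y - x) < d \<longrightarrow> \<bar>\<sigma>2 y - \<sigma>2 x\<bar> < e"
    and K[measurable]: "K \<in> borel_measurable borel" and Kb: "\<And>t. \<bar>K t\<bar> \<le> b" and K0: "\<And>t. 1 < t \<Longrightarrow> K t = 0"
    and e: "0 < e"
  shows "\<exists>\<delta>>0. \<forall>h. 0 < h \<and> h < \<delta> \<longrightarrow>
    \<bar>expectation (\<lambda>\<omega>. (K (N (X \<omega> - x) / h) * (Y \<omega> - r x))\<^sup>2) - \<sigma>2 x * expectation (\<lambda>\<omega>. (K (N (X \<omega> - x) / h))\<^sup>2)\<bar>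
      \<le> e * expectation (\<lambda>\<omega>. (K (N (X \<omega> - x) / h))\<^sup>2)"
proof -
  \<comment> \<open>Gives \<open>e1^2 \<le> e / 2\<close>, and keeps
    \<open>r (X \<omega>) - r x\<close> within 1 where the kernel is nonzero, so that the weight of
    the noise in the cross term is bounded.\<close>
  define e1 where "e1 = min 1 (e / 2)"
  have e1: "0 < e1" "e1 \<le> 1" "e1 \<le> e / 2" using e by (auto simp: e1_def)
  obtain d1 where d1: "0 < d1" "\<And>y. N (y - x) < d1 \<Longrightarrow> \<bar>r y - r x\<bar> < e1" using rcont[OF e1(1)] by blast
  obtain d2 where d2: "0 < d2" "\<And>y. N (y - x) < d2 \<Longrightarrow> \<bar>\<sigma>2 y - \<sigma>2 x\<bar> < e / 2" using scont[of "e / 2"] e by auto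
  note Nm[measurable] = borel_measurable_shift[OF N, of x]
  have "\<bar>expectation (\<lambda>\<omega>. (K (N (X \<omega> - x) / h) * (Y \<omega> - r x))\<^sup>2) - \<sigma>2 x * expectation (\<lambda>\<omega>. (K (N (X \<omega> - x) / h))\<^sup>2)\<bar>
      \<le> e * expectation (\<lambda>\<omega>. (K (N (X \<omega> - x) / h))\<^sup>2)" if h: "0 < h" "h < min d1 d2" for h
  proof -
    define k where "k = (\<lambda>y. (K (N (y - x) / h))\<^sup>2)"
    have km[measurable]: "k \<in> borel_measurable borel" unfolding k_def by measurable
    have k0: "0 \<le> k y" for y by (simp add: k_def)
    have kb: "\<bar>k y\<bar> \<le> b\<^sup>2" for y unfolding k_def using power_mono[OF Kb, where n=2] by simp
    \<comment> \<open>A nonzero weight places \<open>y\<close> in the ball of radius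
      \<open>h\<close>, which is smaller than both continuity radii.\<close>
    have loc: "k y = 0 \<or> N (y - x) < d1 \<and> N (y - x) < d2" for y
    proof (cases "h < N (y - x)")
      case True
      then have "1 < N (y - x) / h" using h by simp
      then show ?thesis by (simp add: k_def K0)
    qed (use h in auto)
    have rk: "\<bar>k y * (r y - r x)\<bar> \<le> b\<^sup>2" for y
    proof (cases "k y = 0")
      case False
      then have "\<bar>r y - r x\<bar> \<le> 1" using loc[of y] d1(2)[of y] e1 by auto
      then have "\<bar>k y\<bar> * \<bar>r y - r x\<bar> \<le> b\<^sup>2 * 1" using kb by (intro mult_mono) auto
      then show ?thesis by (simp add: abs_mult)
    qed simp
    have rkm: "(\<lambda>y. k y * (r y - r x)) \<in> borel_measurable borel" by measurable
    note c1 = cond_exp_given_integral[OF noise(1) X rkm rk]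
    note c2 = cond_exp_given_integral[OF noise(2) X km kb]
    have i3: "integrable M (\<lambda>\<omega>. k (X \<omega>) * (r (X \<omega>) - r x)\<^sup>2)"
    proof (rule integrable_bounded[where b="b\<^sup>2"])
      fix \<omega>
      show "\<bar>k (X \<omega>) * (r (X \<omega>) - r x)\<^sup>2\<bar> \<le> b\<^sup>2"
      proof (cases "k (X \<omega>) = 0")
        case False
        then have "\<bar>r (X \<omega>) - r x\<bar> \<le> 1" using loc[of "X \<omega>"] d1(2)[of "X \<omega>"] e1 by auto
        then have "(r (X \<omega>) - r x)\<^sup>2 \<le> 1" by (simp add: abs_square_le_1)
        then have "\<bar>k (X \<omega>)\<bar> * \<bar>(r (X \<omega>) - r x)\<^sup>2\<bar> \<le> b\<^sup>2 * 1" using kb by (intro mult_mono) auto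
        then show ?thesis by (simp add: abs_mult)
      qed simp
    qed measurable
    have i4: "integrable M (\<lambda>\<omega>. k (X \<omega>))" by (rule integrable_bounded[OF _ kb]) measurable
    have "expectation (\<lambda>\<omega>. (K (N (X \<omega> - x) / h) * (Y \<omega> - r x))\<^sup>2)
       = expectation (\<lambda>\<omega>. k (X \<omega>) * (r (X \<omega>) - r x)\<^sup>2 + 2 * (k (X \<omega>) * (r (X \<omega>) - r x) * \<epsilon> \<omega>) + k (X \<omega>) * (\<epsilon> \<omega>)\<^sup>2)"
      by (intro Bochner_Integration.integral_cong refl) (simp add: model k_def power2_eq_square algebra_simps)
    also have "\<dots> = expectation (\<lambda>\<omega>. k (X \<omega>) * (r (X \<omega>) - r x)\<^sup>2) + 2 * expectation (\<lambda>\<omega>. k (X \<omega>) * (r (X \<omega>) - r x) * \<epsilon> \<omega>) + expectation (\<lambda>\<omega>. k (X \<omega>) * (\<epsilon> \<omega>)\<^sup>2)"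
      using i3 c1(1) c2(1) by simp
    also have "\<dots> = expectation (\<lambda>\<omega>. k (X \<omega>) * (r (X \<omega>) - r x)\<^sup>2) + expectation (\<lambda>\<omega>. k (X \<omega>) * \<sigma>2 (X \<omega>))"
      unfolding c1(3) c2(3) by simp
    finally have eq: "expectation (\<lambda>\<omega>. (K (N (X \<omega> - x) / h) * (Y \<omega> - r x))\<^sup>2) - \<sigma>2 x * expectation (\<lambda>\<omega>. k (X \<omega>))
        = expectation (\<lambda>\<omega>. k (X \<omega>) * (r (X \<omega>) - r x)\<^sup>2 + k (X \<omega>) * \<sigma>2 (X \<omega>) - \<sigma>2 x * k (X \<omega>))"
      using i3 i4 c2(2) by simp
    have "\<bar>expectation (\<lambda>\<omega>. k (X \<omega>) * (r (X \<omega>) - r x)\<^sup>2 + k (X \<omega>) * \<sigma>2 (X \<omega>) - \<sigma>2 x * k (X \<omega>))\<bar> \<le> expectation (\<lambda>\<omega>. e * k (X \<omega>))"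
    proof (rule expectation_abs_le)
      fix \<omega>
      let ?y = "X \<omega>"
      show "\<bar>k ?y * (r ?y - r x)\<^sup>2 + k ?y * \<sigma>2 ?y - \<sigma>2 x * k ?y\<bar> \<le> e * k ?y"
      proof (cases "k ?y = 0")
        case False
        then have a: "\<bar>r ?y - r x\<bar> < e1" "\<bar>\<sigma>2 ?y - \<sigma>2 x\<bar> < e / 2" using loc[of ?y] d1(2)[of ?y] d2(2)[of ?y] by auto
        have "\<bar>r ?y - r x\<bar> * \<bar>r ?y - r x\<bar> \<le> e1 * 1" using a(1) e1 by (intro mult_mono) auto
        then have "(r ?y - r x)\<^sup>2 \<le> e / 2" using e1(3) by (simp add: power2_eq_square abs_mult_self_eq)
        then have "\<bar>(r ?y - r x)\<^sup>2 + (\<sigma>2 ?y - \<sigma>2 x)\<bar> \<le> e"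
          using a(2) zero_le_power2[of "r ?y - r x"] by linarith
        then have "\<bar>k ?y\<bar> * \<bar>(r ?y - r x)\<^sup>2 + (\<sigma>2 ?y - \<sigma>2 x)\<bar> \<le> k ?y * e" using k0 by (intro mult_mono) auto
        then show ?thesis by (simp add: abs_mult[symmetric] algebra_simps)
      qed simp
    qed (use i3 i4 c2(2) in auto)
    then show ?thesis using eq by (simp add: k_def)
  qed
  then show ?thesis using d1(1) d2(1) by (intro exI[of _ "min d1 d2"]) auto
qed

lemma tendsto_of_relative_error:
  fixes a b :: "nat \<Rightarrow> real"
  assumes b: "b \<longlonglongrightarrow> m" and b0: "\<forall>\<^sub>F n in sequentially. 0 \<le> b n"
    and ab: "\<And>e. 0 < e \<Longrightarrow> \<forall>\<^sub>F n in sequentially. \<bar>a n - s * b n\<bar> \<le> e * b n"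
  shows "a \<longlonglongrightarrow> s * m"
proof -
  have "(\<lambda>n. a n - s * b n) \<longlonglongrightarrow> 0"
  proof (rule tendstoI)
    fix e :: real assume e: "0 < e"
    define e' where "e' = e / (\<bar>m\<bar> + 2)"
    have e': "0 < e'" using e by (simp add: e'_def)
    have "\<forall>\<^sub>F n in sequentially. b n < \<bar>m\<bar> + 1" using b by (intro order_tendstoD(2)) auto
    with ab[OF e'] b0 show "\<forall>\<^sub>F n in sequentially. dist (a n - s * b n) 0 < e"
    proof eventually_elim
      case (elim n)
      have "\<bar>a n - s * b n\<bar> \<le> e' * (\<bar>m\<bar> + 1)"
        using elim e' mult_left_mono[of "b n" "\<bar>m\<bar> + 1" e'] by linarith
      also have "\<dots> < e' * (\<bar>m\<bar> + 2)" using e' by (intro mult_strict_left_mono) auto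
      also have "\<dots> = e"
      proof -
        have "\<bar>m\<bar> + 2 \<noteq> 0" by linarith
        then show ?thesis by (simp add: e'_def)
      qed
      finally show ?case by simp
    qed
  qed
  from tendsto_add[OF this tendsto_mult_left[OF b, of s]] show ?thesis by simp
qed

lemma seminorm_continuous_onD:
  assumes N: "is_seminorm N" and V: "seminorm_nhd N x V" "seminorm_continuous_on N V f" and e: "0 < e"
  shows "\<exists>d>0. \<forall>y. N (y - x) < d \<longrightarrow> \<bar>f y - f x\<bar> < e"
proof -
  obtain \<delta> where \<delta>: "0 < \<delta>" "{y. N (y - x) < \<delta>} \<subseteq> V" using V(1) by (auto simp: seminorm_nhd_def)
  have "N (0 *\<^sub>R 0) = \<bar>0\<bar> * N 0" using N unfolding is_seminorm_def by blast
  then have "N (x - x) < \<delta>" using \<delta> by simp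
  then have "x \<in> V" using \<delta> by blast
  then obtain d where d: "0 < d" "\<And>y. y \<in> V \<Longrightarrow> N (y - x) < d \<Longrightarrow> \<bar>f y - f x\<bar> < e"
    using V(2) e unfolding seminorm_continuous_on_def by meson
  then show ?thesis using \<delta> by (intro exI[of _ "min d \<delta>"]) auto
qed

section \<open>The regression model as an instance of the abstract setting\<close>

theorem theorem2:
  fixes M :: "'a measure"
    and N :: "'e::banach \<Rightarrow> real"
    and X :: "'a \<Rightarrow> 'e" and Y :: "'a \<Rightarrow> real"
    and Xs :: "nat \<Rightarrow> 'a \<Rightarrow> 'e" and Ys \<epsilon> :: "nat \<Rightarrow> 'a \<Rightarrow> real"
    and r \<sigma>2 :: "'e \<Rightarrow> real"
    and x :: 'e
    and F K \<phi> \<tau>0 \<beta> :: "real \<Rightarrow> real"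
    and h :: "nat \<Rightarrow> real"
    and l \<alpha>l lam \<mu> \<alpha> :: real
  assumes prob: "prob_space M"
    and seminorm: "is_seminorm N" "N \<in> borel_measurable borel"
    and iid: "iid_copies M (borel \<Otimes>\<^sub>M borel) (\<lambda>\<omega>. (X \<omega>, Y \<omega>)) (\<lambda>i \<omega>. (Xs i \<omega>, Ys i \<omega>)) {1..}"
    and regression: "cond_exp_given M borel X Y r"
    and model: "\<And>i \<omega>. i \<ge> 1 \<Longrightarrow> \<omega> \<in> space M \<Longrightarrow> Ys i \<omega> = r (Xs i \<omega>) + \<epsilon> i \<omega>"
    and noise_mean: "\<And>i. i \<ge> 1 \<Longrightarrow> cond_exp_given M borel (Xs i) (\<epsilon> i) (\<lambda>_. 0)"
    and noise_var: "\<And>i. i \<ge> 1 \<Longrightarrow> cond_exp_given M borel (Xs i) (\<lambda>\<omega>. (\<epsilon> i \<omega>)\<^sup>2) \<sigma>2"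
    and F_eq: "F = small_ball_prob M N X x"
    and h_pos: "\<And>n. n \<ge> 1 \<Longrightarrow> h n > 0"
    and l_range: "l \<in> {0..1}"
    and H1_cont: "\<exists>V. seminorm_nhd N x V \<and> seminorm_continuous_on N V r
                       \<and> seminorm_continuous_on N V \<sigma>2"
    and H1_F0: "F 0 = 0"
    and H1_phi: "cond_exp_given M borel (\<lambda>\<omega>. N (X \<omega> - x)) (\<lambda>\<omega>. r (X \<omega>) - r x) \<phi>"
    and H1_phi_diff: "\<phi> differentiable (at 0 within {0..})"
    and H2_nonneg: "\<And>t. K t \<ge> 0"
    and H2_bounded: "bounded (range K)"
    and H2_support: "closure {t. K t \<noteq> 0} = {0..1}"
    and H2_inf: "(INF t\<in>{0..1}. K t) > 0"
    and K_diff: "K differentiable_on {0..1}"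
    and K_deriv_integrable: "set_integrable lborel {0..1} (unit_deriv K)"
    and H3: "\<And>s. s \<in> {0..1} \<Longrightarrow> ((\<lambda>t. F (t * s) / F t) \<longlongrightarrow> \<tau>0 s) (at_right 0)"
    and H4_h: "h \<longlonglongrightarrow> 0"
    and H4_nF: "filterlim (\<lambda>n. real n * F (h n)) at_top sequentially"
    and H4_A: "(\<lambda>n. A_mean F h n l) \<longlonglongrightarrow> \<alpha>l"
    and H4_B: "\<And>q. q \<le> 2 \<Longrightarrow> (\<lambda>n. B_mean F h n q) \<longlonglongrightarrow> \<beta> q"
    and H5_pos: "lam > 0" "\<mu> > 0"
    and H5: "integrable M (\<lambda>\<omega>. exp (lam * \<bar>Y \<omega>\<bar> powr \<mu>))"
    and H6_alpha: "\<alpha> \<ge> 0"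
    and H6_a: "filterlim (\<lambda>n. real n * F (h n) * ln (real n) powr (- 1 - 2 / \<mu>)
                               / ln (ln (real n)) powr (2 * (\<alpha> + 1))) at_top sequentially"
    and H6_b: "(\<lambda>n. ln (real n) powr (2 / \<mu>) * F (h n)) \<longlonglongrightarrow> 0"
    and undersmoothing: "(\<lambda>n. real n * (h n)\<^sup>2) \<longlonglongrightarrow> 0"
  shows "AE \<omega> in M.
           limsup (\<lambda>n. ereal (sqrt (real n * F (h n) / ln (ln (real n)))
                              * (recursive_estimator F K N h Xs Ys l n x \<omega> - r x)))
           = ereal (sqrt (2 * \<beta> (1 - 2 * l) * \<sigma>2 x * M2 K \<tau>0) / (\<beta> (1 - l) * M1 K \<tau>0))"
proof -
  interpret prob_space M by (rule prob)
  have Nsym: "N (x - y) = N (y - x)" for y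
  proof -
    have "N ((- 1) *\<^sub>R (y - x)) = \<bar>- 1\<bar> * N (y - x)" using seminorm(1) unfolding is_seminorm_def by blast
    then show ?thesis by simp
  qed
  have N0: "0 \<le> N y" for y using seminorm(1) unfolding is_seminorm_def by blast
  note Nm[measurable] = seminorm(2)
  have XY: "(\<lambda>\<omega>. (X \<omega>, Y \<omega>)) \<in> measurable M (borel \<Otimes>\<^sub>M borel)"
    and indXY: "indep_vars (\<lambda>_. borel \<Otimes>\<^sub>M borel) (\<lambda>i \<omega>. (Xs i \<omega>, Ys i \<omega>)) {1..}"
    and dis: "\<And>i. 1 \<le> i \<Longrightarrow> distr M (borel \<Otimes>\<^sub>M borel) (\<lambda>\<omega>. (Xs i \<omega>, Ys i \<omega>)) = distr M (borel \<Otimes>\<^sub>M borel) (\<lambda>\<omega>. (X \<omega>, Y \<omega>))"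
    using iid unfolding iid_copies_def by auto
  have XYs: "(\<lambda>\<omega>. (Xs i \<omega>, Ys i \<omega>)) \<in> measurable M (borel \<Otimes>\<^sub>M borel)" if "1 \<le> i" for i
    using indXY that unfolding indep_vars_def by auto
  have Xm[measurable]: "X \<in> measurable M borel" and Ym[measurable]: "Y \<in> borel_measurable M"
    using measurable_compose[OF XY measurable_fst] measurable_compose[OF XY measurable_snd] by simp_all
  have Xsm: "Xs i \<in> measurable M borel" if "1 \<le> i" for i
    using measurable_compose[OF XYs[OF that] measurable_fst] by simp
  \<comment> \<open>Expectations and integrability pass between the copies and \<open>(X, Y)\<close>
    because the joint laws agree.\<close>
  have tr: "expectation (\<lambda>\<omega>. f (Xs i \<omega>, Ys i \<omega>)) = expectation (\<lambda>\<omega>. f (X \<omega>, Y \<omega>))"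
    and tri: "integrable M (\<lambda>\<omega>. f (Xs i \<omega>, Ys i \<omega>)) \<longleftrightarrow> integrable M (\<lambda>\<omega>. f (X \<omega>, Y \<omega>))"
    if i: "1 \<le> i" and f: "f \<in> borel_measurable (borel \<Otimes>\<^sub>M borel)" for i and f :: "'e \<times> real \<Rightarrow> real"
    using integral_distr[OF XYs[OF i] f] integral_distr[OF XY f] integrable_distr_eq[OF XYs[OF i] f] integrable_distr_eq[OF XY f]
    unfolding dis[OF i] by simp_all
  define T where "T = (\<lambda>\<omega>. N (X \<omega> - x))"
  note Nxm[measurable] = borel_measurable_shift[OF Nm, of x]
  have Tm[measurable]: "T \<in> borel_measurable M" unfolding T_def by measurable
  have T0: "0 \<le> T \<omega>" for \<omega> using N0 by (simp add: T_def)
  have Fdef: "F = (\<lambda>t. prob {\<omega> \<in> space M. T \<omega> \<le> t})"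
    by (rule ext) (simp add: F_eq small_ball_prob_def Nsym T_def)
  have Fmono: "F s \<le> F t" if "s \<le> t" for s t unfolding Fdef using that by (intro finite_measure_mono) auto
  \<comment> \<open>Every ball has positive probability: \<open>n * F (h n)\<close> tends to
    infinity while \<open>h n\<close> tends to 0, and \<open>F\<close> is monotone.\<close>
  have Fpos: "0 < F t" if "0 < t" for t
  proof -
    have "\<forall>\<^sub>F n in sequentially. 0 < real n * F (h n)" using H4_nF by (simp add: filterlim_at_top_dense)
    moreover have "\<forall>\<^sub>F n in sequentially. h n < t" using H4_h that by (intro order_tendstoD(2)) auto
    ultimately have "\<forall>\<^sub>F n in sequentially. 0 < F t"
    proof eventually_elim
      case (elim n)
      then have "0 < F (h n)" by (simp add: zero_less_mult_iff)
      then show ?case using Fmono[of "h n" t] elim by simp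
    qed
    then show ?thesis by simp
  qed
  obtain b where Kb: "\<And>t. \<bar>K t\<bar> \<le> b" using H2_bounded by (auto simp: bounded_iff)
  have Kout: "K t = 0" if "t \<notin> {0..1}" for t using closure_subset[of "{t. K t \<noteq> 0}"] that H2_support by auto
  have K0: "K t = 0" if "1 < t" for t using that by (intro Kout) auto
  \<comment> \<open>\<open>K\<close> is continuous on the unit interval and vanishes outside it, by
    its support.\<close>
  have Km[measurable]: "K \<in> borel_measurable borel"
  proof -
    have "(\<lambda>s. indicator {0..1} s *\<^sub>R K s) \<in> borel_measurable borel"
      using K_diff by (intro borel_measurable_continuous_on_indicator differentiable_imp_continuous_on) auto
    moreover have "(\<lambda>s. indicator {0..1} s *\<^sub>R K s) = K"
    proof
      show "indicator {0..1} s *\<^sub>R K s = K s" for s by (cases "s \<in> {0..1}") (use Kout[of s] in simp_all)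
    qed
    ultimately show ?thesis by simp
  qed
  have rm[measurable]: "r \<in> borel_measurable borel" using regression by (simp add: cond_exp_given_def)
  obtain V where V: "seminorm_nhd N x V" "seminorm_continuous_on N V r" "seminorm_continuous_on N V \<sigma>2" using H1_cont by blast
  note rcont = seminorm_continuous_onD[OF seminorm(1) V(1,2)]
  note scont = seminorm_continuous_onD[OF seminorm(1) V(1,3)]
  define p where "p = (\<lambda>i. F (h i))"
  define k where "k = (\<lambda>i \<omega>. K (N (x - Xs i \<omega>) / h i))"
  define R where "R = (\<lambda>i \<omega>. Ys i \<omega> - r x)"
  have p_pos: "0 < p i" if "1 \<le> i" for i using Fpos[OF h_pos[OF that]] by (simp add: p_def)
  have KT: "of_bool (T \<omega> \<le> h i) * K (T \<omega> / h i) = K (T \<omega> / h i)" "of_bool (T \<omega> \<le> h i) * (K (T \<omega> / h i))\<^sup>2 = (K (T \<omega> / h i))\<^sup>2"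
    if "1 \<le> i" for i \<omega>
    using K0[of "T \<omega> / h i"] h_pos[OF that] by (auto simp: not_le)
  have lim1: "(\<lambda>i. expectation (\<lambda>\<omega>. K (T \<omega> / h i)) / p i) \<longlonglongrightarrow> M1 K \<tau>0"
  proof -
    have "(\<lambda>i. expectation (\<lambda>\<omega>. of_bool (T \<omega> \<le> h i) * K (T \<omega> / h i)) / F (h i)) \<longlonglongrightarrow> M1 K \<tau>0"
      unfolding M1_def by (rule kernel_ratio_limit[OF K_diff K_deriv_integrable Tm T0 Fdef Fpos H3 h_pos H4_h])
    moreover have "\<forall>\<^sub>F i in sequentially. expectation (\<lambda>\<omega>. of_bool (T \<omega> \<le> h i) * K (T \<omega> / h i)) / F (h i) = expectation (\<lambda>\<omega>. K (T \<omega> / h i)) / p i"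
      using eventually_ge_at_top[of 1] by eventually_elim (simp only: KT p_def)
    ultimately show ?thesis by (rule Lim_transform_eventually)
  qed
  have lim2: "(\<lambda>i. expectation (\<lambda>\<omega>. (K (T \<omega> / h i))\<^sup>2) / p i) \<longlonglongrightarrow> M2 K \<tau>0"
  proof -
    note sq = unit_deriv_square[OF K_diff K_deriv_integrable Kb]
    have "(\<lambda>i. expectation (\<lambda>\<omega>. of_bool (T \<omega> \<le> h i) * (K (T \<omega> / h i))\<^sup>2) / F (h i)) \<longlonglongrightarrow> M2 K \<tau>0"
      unfolding M2_def by (rule kernel_ratio_limit[OF sq Tm T0 Fdef Fpos H3 h_pos H4_h])
    moreover have "\<forall>\<^sub>F i in sequentially. expectation (\<lambda>\<omega>. of_bool (T \<omega> \<le> h i) * (K (T \<omega> / h i))\<^sup>2) / F (h i) = expectation (\<lambda>\<omega>. (K (T \<omega> / h i))\<^sup>2) / p i"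
      using eventually_ge_at_top[of 1] by eventually_elim (simp only: KT p_def)
    ultimately show ?thesis by (rule Lim_transform_eventually)
  qed
  define c where "c = (INF t\<in>{0..1}. K t)"
  have Kc: "c \<le> K t" if "t \<in> {0..1}" for t
    unfolding c_def using that H2_nonneg by (intro cINF_lower bdd_belowI2[where m=0]) auto
  \<comment> \<open>The infimum \<open>c\<close> of the kernel gives \<open>c * F h\<close> as a
    lower bound for the expected kernel weight, so in the limit \<open>M1\<close> is at least
    \<open>c > 0\<close>.\<close>
  have M1pos: "0 < M1 K \<tau>0"
  proof -
    have "c \<le> M1 K \<tau>0"
    proof (rule LIMSEQ_le_const[OF lim1], intro exI[of _ 1] allI impI)
      fix i :: nat assume i: "1 \<le> i"
      have hi: "0 < h i" by (rule h_pos[OF i])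
      have "c * p i = expectation (\<lambda>\<omega>. c * of_bool (T \<omega> \<le> h i))"
        using expectation_of_bool(1)[of "\<lambda>\<omega>. T \<omega> \<le> h i"] by (simp add: p_def Fdef)
      also have "\<dots> \<le> expectation (\<lambda>\<omega>. K (T \<omega> / h i))"
      proof (rule integral_mono)
        show "integrable M (\<lambda>\<omega>. c * of_bool (T \<omega> \<le> h i))"
          by (intro integrable_mult_right expectation_of_bool(2)) measurable
        show "integrable M (\<lambda>\<omega>. K (T \<omega> / h i))" by (rule integrable_bounded[OF _ Kb]) measurable
        show "c * of_bool (T \<omega> \<le> h i) \<le> K (T \<omega> / h i)" for \<omega>
          using Kc[of "T \<omega> / h i"] T0[of \<omega>] hi H2_nonneg by auto
      qed
      finally show "c \<le> expectation (\<lambda>\<omega>. K (T \<omega> / h i)) / p i" using p_pos[OF i] by (simp add: pos_le_divide_eq)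
    qed
    then show ?thesis using H2_inf by (simp add: c_def)
  qed
  have kf: "(\<lambda>z. K (N (fst z - x) / h i)) \<in> borel_measurable (borel \<Otimes>\<^sub>M (borel :: real measure))" for i
  proof -
    note measurable_compose[OF measurable_fst Nxm, measurable]
    show ?thesis by measurable
  qed
  have kRf: "(\<lambda>z. K (N (fst z - x) / h i) * (snd z - r x)) \<in> borel_measurable (borel \<Otimes>\<^sub>M borel)" for i
    using kf by measurable
  have kf2: "(\<lambda>z. (K (N (fst z - x) / h i))\<^sup>2) \<in> borel_measurable (borel \<Otimes>\<^sub>M (borel :: real measure))" for i
    using kf by (rule borel_measurable_power)
  have kRf2: "(\<lambda>z. (K (N (fst z - x) / h i) * (snd z - r x))\<^sup>2) \<in> borel_measurable (borel \<Otimes>\<^sub>M borel)" for i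
    using kRf by (rule borel_measurable_power)
  have k_eq: "k i \<omega> = K (N (Xs i \<omega> - x) / h i)" for i \<omega> by (simp add: k_def Nsym)
  have Ek: "expectation (k i) = expectation (\<lambda>\<omega>. K (T \<omega> / h i))" if i: "1 \<le> i" for i
    using tr[OF i kf[of i]] by (simp add: k_eq[abs_def] T_def)
  have Ek2: "expectation (\<lambda>\<omega>. (k i \<omega>)\<^sup>2) = expectation (\<lambda>\<omega>. (K (T \<omega> / h i))\<^sup>2)" if i: "1 \<le> i" for i
    using tr[OF i kf2[of i]] by (simp add: k_eq T_def)
  have EkR: "expectation (\<lambda>\<omega>. k i \<omega> * R i \<omega>) = expectation (\<lambda>\<omega>. K (T \<omega> / h i) * (Y \<omega> - r x))" if i: "1 \<le> i" for i
    using tr[OF i kRf[of i]] by (simp add: k_eq T_def R_def)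
  \<comment> \<open>The noise is attached to the copies, so the second moment is computed with the
    first copy. The bias uses \<open>(X, Y)\<close> instead, to which \<open>regression\<close> and
    \<open>H1_phi\<close> refer.\<close>
  have EkR2: "expectation (\<lambda>\<omega>. (k i \<omega> * R i \<omega>)\<^sup>2) = expectation (\<lambda>\<omega>. (K (N (Xs 1 \<omega> - x) / h i) * (Ys 1 \<omega> - r x))\<^sup>2)" if i: "1 \<le> i" for i
    using tr[OF i kRf2[of i]] tr[OF order_refl kRf2[of i]]
    by (simp add: k_eq R_def)
  have Ek2': "expectation (\<lambda>\<omega>. (K (N (Xs 1 \<omega> - x) / h i))\<^sup>2) = expectation (\<lambda>\<omega>. (K (T \<omega> / h i))\<^sup>2)" for i
    using tr[OF order_refl kf2[of i]] by (simp add: T_def)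
  have mean_k: "(\<lambda>i. expectation (k i) / p i) \<longlonglongrightarrow> M1 K \<tau>0"
    by (rule Lim_transform_eventually[OF lim1 eventually_mono[OF eventually_ge_at_top[of 1]]]) (simp add: Ek)
  have mean_k2: "(\<lambda>i. expectation (\<lambda>\<omega>. (k i \<omega>)\<^sup>2) / p i) \<longlonglongrightarrow> M2 K \<tau>0"
    by (rule Lim_transform_eventually[OF lim2 eventually_mono[OF eventually_ge_at_top[of 1]]]) (simp add: Ek2)
  have Fpos': "0 < prob {\<omega> \<in> space M. N (X \<omega> - x) \<le> t}" if "0 < t" for t
    using Fpos[OF that] by (simp add: Fdef T_def)
  obtain C \<delta> where C: "0 \<le> C" "0 < \<delta>" "\<And>t. 0 < t \<Longrightarrow> t < \<delta> \<Longrightarrow>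
      \<bar>expectation (\<lambda>\<omega>. K (N (X \<omega> - x) / t) * (Y \<omega> - r x))\<bar> \<le> C * (t * prob {\<omega> \<in> space M. N (X \<omega> - x) \<le> t})"
    using local_bias[OF Xm Nm N0 regression H1_phi H1_phi_diff Fpos' rcont Km Kb K0] by blast
  have mean_kR: "\<forall>\<^sub>F i in sequentially. \<bar>expectation (\<lambda>\<omega>. k i \<omega> * R i \<omega>)\<bar> \<le> C * (h i * p i)"
    using order_tendstoD(2)[OF H4_h C(2)] eventually_ge_at_top[of 1]
  proof eventually_elim
    case (elim i)
    show ?case using C(3)[OF h_pos[OF elim(2)] elim(1)] unfolding EkR[OF elim(2)] by (simp add: T_def p_def Fdef)
  qed
  have mean_kR2: "(\<lambda>i. expectation (\<lambda>\<omega>. (k i \<omega> * R i \<omega>)\<^sup>2) / p i) \<longlonglongrightarrow> \<sigma>2 x * M2 K \<tau>0"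
  proof (rule tendsto_of_relative_error[OF lim2])
    show "\<forall>\<^sub>F i in sequentially. 0 \<le> expectation (\<lambda>\<omega>. (K (T \<omega> / h i))\<^sup>2) / p i"
      using eventually_ge_at_top[of 1] by eventually_elim (intro divide_nonneg_pos p_pos Bochner_Integration.integral_nonneg, auto)
    fix e :: real assume e: "0 < e"
    obtain \<delta>' where d: "0 < \<delta>'" "\<And>t. 0 < t \<Longrightarrow> t < \<delta>' \<Longrightarrow>
      \<bar>expectation (\<lambda>\<omega>. (K (N (Xs 1 \<omega> - x) / t) * (Ys 1 \<omega> - r x))\<^sup>2) - \<sigma>2 x * expectation (\<lambda>\<omega>. (K (N (Xs 1 \<omega> - x) / t))\<^sup>2)\<bar>
        \<le> e * expectation (\<lambda>\<omega>. (K (N (Xs 1 \<omega> - x) / t))\<^sup>2)"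
      using local_variance[OF Xsm[OF order_refl] Nm rm model[OF order_refl] noise_mean[OF order_refl] noise_var[OF order_refl] rcont scont Km Kb K0 e] by blast
    show "\<forall>\<^sub>F i in sequentially. \<bar>expectation (\<lambda>\<omega>. (k i \<omega> * R i \<omega>)\<^sup>2) / p i - \<sigma>2 x * (expectation (\<lambda>\<omega>. (K (T \<omega> / h i))\<^sup>2) / p i)\<bar>
        \<le> e * (expectation (\<lambda>\<omega>. (K (T \<omega> / h i))\<^sup>2) / p i)"
      using order_tendstoD(2)[OF H4_h d(1)] eventually_ge_at_top[of 1]
    proof eventually_elim
      case (elim i)
      have p: "0 < p i" by (rule p_pos[OF elim(2)])
      let ?E = "expectation (\<lambda>\<omega>. (K (T \<omega> / h i))\<^sup>2)"
      have "\<bar>expectation (\<lambda>\<omega>. (k i \<omega> * R i \<omega>)\<^sup>2) - \<sigma>2 x * ?E\<bar> / p i \<le> e * ?E / p i"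
        using d(2)[OF h_pos[OF elim(2)] elim(1)] p unfolding EkR2[OF elim(2)] Ek2' by (intro divide_right_mono) auto
      moreover have "expectation (\<lambda>\<omega>. (k i \<omega> * R i \<omega>)\<^sup>2) / p i - \<sigma>2 x * (?E / p i) = (expectation (\<lambda>\<omega>. (k i \<omega> * R i \<omega>)\<^sup>2) - \<sigma>2 x * ?E) / p i"
        by (simp add: diff_divide_distrib)
      ultimately show ?case using p by (simp add: abs_divide)
    qed
  qed
  have moments: "\<exists>D. \<forall>i\<ge>1. integrable M (\<lambda>\<omega>. \<bar>R i \<omega>\<bar> ^ m) \<and> expectation (\<lambda>\<omega>. \<bar>R i \<omega>\<bar> ^ m) \<le> D" for m
  proof (intro exI allI impI)
    fix i :: nat assume i: "1 \<le> i"
    have f: "(\<lambda>z :: 'e \<times> real. \<bar>snd z - r x\<bar> ^ m) \<in> borel_measurable (borel \<Otimes>\<^sub>M borel)" by measurable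
    show "integrable M (\<lambda>\<omega>. \<bar>R i \<omega>\<bar> ^ m) \<and> expectation (\<lambda>\<omega>. \<bar>R i \<omega>\<bar> ^ m) \<le> expectation (\<lambda>\<omega>. \<bar>Y \<omega> - r x\<bar> ^ m)"
      using tr[OF i f] tri[OF i f] exp_moment_imp_moments[OF Ym H5_pos H5, of "r x" m] by (simp add: R_def)
  qed
  \<comment> \<open>The logarithmic factor in \<open>H6_b\<close> is eventually at least 1, so
    \<open>F (h n)\<close> lies below a null sequence.\<close>
  have p_lim: "p \<longlonglongrightarrow> 0"
  proof (rule Lim_null_comparison[OF _ H6_b])
    have "\<forall>\<^sub>F n::nat in sequentially. 1 \<le> ln (real n)" by real_asymp
    then show "\<forall>\<^sub>F n in sequentially. norm (p n) \<le> ln (real n) powr (2 / \<mu>) * F (h n)"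
      using eventually_ge_at_top[of 1]
    proof eventually_elim
      case (elim n)
      have "1 \<le> ln (real n) powr (2 / \<mu>)" using elim H5_pos by (intro ge_one_powr_ge_zero) auto
      then have "1 * p n \<le> ln (real n) powr (2 / \<mu>) * p n" using p_pos[OF elim(2)] by (intro mult_right_mono) auto
      then show ?case using p_pos[OF elim(2)] by (simp add: p_def)
    qed
  qed
  have ind: "indep_vars (\<lambda>_. borel \<Otimes>\<^sub>M borel) (\<lambda>i \<omega>. (k i \<omega>, R i \<omega>)) {1..}"
  proof -
    have "(\<lambda>z. (K (N (fst z - x) / h i), snd z - r x)) \<in> measurable (borel \<Otimes>\<^sub>M borel) (borel \<Otimes>\<^sub>M borel)" for i
      using kf by measurable
    from indep_vars_compose2[OF indXY this] show ?thesis by (simp add: k_eq R_def)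
  qed
  \<comment> \<open>The variance parameter is the noise variance at the point times
    \<open>M2\<close>, the limit of the second moment of the kernel weight relative to
    \<open>p\<close>.\<close>
  interpret weighted_noise M p \<beta> k R h l \<alpha>l "M1 K \<tau>0" "M2 K \<tau>0" "\<sigma>2 x * M2 K \<tau>0" C b
  proof
    show "filterlim (\<lambda>n. real n * p n) at_top sequentially" using H4_nF by (simp add: p_def)
    show "(\<lambda>n. (1 / real n) * (\<Sum>i=1..n. (p i / p n) powr q)) \<longlonglongrightarrow> \<beta> q" if "q \<le> 2" for q
      using H4_B[OF that] unfolding B_mean_def p_def .
    show "(\<lambda>n. (1 / real n) * (\<Sum>i=1..n. (h i / h n) * (p i / p n) powr (1 - l))) \<longlonglongrightarrow> \<alpha>l"
      using H4_A unfolding A_mean_def p_def .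
    show "p i \<le> 1" for i by (simp add: p_def Fdef)
    show "k i \<omega> \<le> b" for i \<omega> using Kb[of "N (x - Xs i \<omega>) / h i"] by (simp add: k_def)
  qed (use p_pos ind H2_nonneg moments p_lim mean_k M1pos mean_k2 mean_kR C mean_kR2 l_range h_pos undersmoothing in \<open>auto simp: k_def\<close>)
  show ?thesis
    using ratio_lil denominator_limit
  proof eventually_elim
    case (elim \<omega>)
    define S where "S = (\<lambda>n. \<Sum>i=1..n. p i powr (- l) * (k i \<omega> * R i \<omega>))"
    define D where "D = (\<lambda>n. \<Sum>i=1..n. p i powr (- l) * k i \<omega>)"
    have "0 < \<beta> (1 - l) * M1 K \<tau>0" using beta_W_pos M1pos by simp
    then have Dpos: "\<forall>\<^sub>F n in sequentially. 0 < D n / (real n * p n powr (1 - l))"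
      using elim(2) unfolding D_def by (intro order_tendstoD(1))
    have "limsup (\<lambda>n. ereal (sqrt (real n * F (h n) / ln (ln (real n))) * (recursive_estimator F K N h Xs Ys l n x \<omega> - r x)))
        = limsup (\<lambda>n. ereal (sqrt (real n * p n / ln (ln (real n))) * (S n / D n)))"
    proof (rule Limsup_eq)
      show "\<forall>\<^sub>F n in sequentially. ereal (sqrt (real n * F (h n) / ln (ln (real n))) * (recursive_estimator F K N h Xs Ys l n x \<omega> - r x))
        = ereal (sqrt (real n * p n / ln (ln (real n))) * (S n / D n))"
        using Dpos
      proof eventually_elim
        case (elim n)
        then have "D n \<noteq> 0" by auto
        have den: "(\<Sum>i=1..n. 1 / F (h i) powr l * K (N (x - Xs i \<omega>) / h i)) = D n"
          unfolding D_def k_def p_def by (simp add: powr_minus_divide)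
        \<comment> \<open>Writing each response as \<open>R\<close> plus \<open>r x\<close> makes
          the error of the estimator exactly \<open>S n / D n\<close>.\<close>
        have num: "(\<Sum>i=1..n. Ys i \<omega> / F (h i) powr l * K (N (x - Xs i \<omega>) / h i)) = S n + r x * D n"
          unfolding S_def D_def sum_distrib_left sum.distrib[symmetric]
          by (rule sum.cong) (simp_all add: k_def R_def p_def powr_minus_divide algebra_simps add_divide_distrib[symmetric])
        have "recursive_estimator F K N h Xs Ys l n x \<omega> - r x = S n / D n"
          unfolding recursive_estimator_def den num using \<open>D n \<noteq> 0\<close> by (simp add: add_divide_distrib)
        then show ?case by (simp add: p_def)
      qed
    qed
    then show ?case using elim(1) by (simp add: S_def D_def mult.assoc)
  qed
qed

end
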